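(* Let $X$ be an essential, locally finite, cocompact CAT(0) cube complex. The following are equivalent: (1) $\partial X = B(X)$. (2) $X$ has caged hyperplanes. (3) Every open set in the space $\mathcal{U}(X)$ of ultrafilters on $X$ which contains an ultrafilter in $\partial X$ contains a hyperplane.
   Context: Conventions. CAT(0) cube complexes are connected, with unit cubes; distances and geodesics are taken in the combinatorial metric on the 1-skeleton. $X$ is locally finite if every vertex has finite valence, and cocompact if its group of isometries (cubical automorphisms) acts cocompactly. For a hyperplane $\hat h$, the closures $h,h^*$ of the two components of $X\setminus\hat h$ are its halfspaces; the hyperplane bounding a halfspace $h$ is always denoted $\hat h$. The carrier $\mathcal{C}(\hat h)\cong \hat h\times[0,1]$ is the union of all cubes meeting $\hat h$; $\mathcal{C}^+(h)$ (the positive carrier of $h$) is the subcomplex $\hat h\times\{1\}$ of the carrier, labelled so that it lies in $h$, and $\mathcal{C}^+(h^* )=\hat h\times\{0\}$. $X$ is essential if for every halfspace $h$ there are vertices in $h$ arbitrarily far from $\hat h$. Ultrafilters. An ultrafilter on $X$ is a set $\alpha$ of halfspaces such that for every halfspace $h$ exactly one of $h,h^*$ is in $\alpha$, and if $h\in\alpha$ and $h\subset k$ then $k\in\alpha$. $\mathcal{U}=\mathcal{U}(X)$ is the set of all ultrafilters, with topology having as basis $\mathcal{U}$ together with the sets $\mathcal{U}_H=\{\alpha : H\subset\alpha\}$ for $H$ a finite set of halfspaces. Vertices $v$ of $X$ are identified with ultrafilters $\alpha_v=\{h: v\in h\}$; these are exactly the ultrafilters satisfying the descending chain condition (every nested sequence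 of halfspaces in $\alpha$ has a minimal element). The Roller boundary $\partial X$ is the set of ultrafilters not satisfying the descending chain condition. An ultrafilter $\alpha$ is non-terminating if for every $h\in\alpha$ there is $k\in\alpha$ with $k\subsetneq h$. $B(X)$ is the closure in $\mathcal{U}$ of the set of non-terminating ultrafilters in $\partial X$. An open set $U\subset\mathcal{U}$ contains a hyperplane $\hat h$ if for every edge dual to $\hat h$ both endpoints (as ultrafilters) are in $U$. Caged hyperplanes. A cage in an ultrafilter $\alpha$ is a subset $K\subset\alpha$ with $\bigcap_{k\in K}\mathcal{C}^+(k)\neq\emptyset$. $X$ has caged hyperplanes if for every $\alpha\in\partial X$ and every cage $K\subset\alpha$ there is a hyperplane $\hat h\subset\bigcap_{k\in K}k$, where containment of a hyperplane in a halfspace $k$ is understood as $\hat h\subset k$ and $\hat h\neq\hat k$ (so $\hat h$ is disjoint from $\hat k$). *)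

theory Defs
  imports "HOL-Analysis.Analysis"
begin

text \<open>
  A cube complex is given by the set \<open>X\<close> of the vertex sets of its closed cubes. The vertex set of
  an \<open>n\<close>-cube is coordinatised by \<open>Pow {..<n}\<close>, whose faces are the intervals \<open>{A..B}\<close> with
  \<open>A \<subseteq> B \<subseteq> {..<n}\<close>. As usual for cubical complexes (Bridson--Haefliger, Definition I.7.32), cubes are
  embedded and two cubes that meet do so in a common face.
\<close>

definition cube_chart :: "'v set set \<Rightarrow> 'v set \<Rightarrow> nat \<Rightarrow> ('v \<Rightarrow> nat set) \<Rightarrow> bool" where
  "cube_chart X C n \<phi> \<longleftrightarrow>
     bij_betw \<phi> C (Pow {..<n}) \<and>
     (\<forall>D. D \<subseteq> C \<longrightarrow> (D \<in> X \<longleftrightarrow> (\<exists>A B. A \<subseteq> B \<and> B \<subseteq> {..<n} \<and> \<phi> ` D = {A..B})))"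

definition cube_complex :: "'v set set \<Rightarrow> bool" where
  "cube_complex X \<longleftrightarrow>
     (\<forall>C\<in>X. \<exists>n \<phi>. cube_chart X C n \<phi>) \<and>
     (\<forall>C\<in>X. \<forall>D\<in>X. C \<inter> D \<noteq> {} \<longrightarrow> C \<inter> D \<in> X)"

definition vertices :: "'v set set \<Rightarrow> 'v set" where
  "vertices X = \<Union>X"

definition edges :: "'v set set \<Rightarrow> 'v set set" where
  "edges X = {C \<in> X. card C = 2}"

definition squares :: "'v set set \<Rightarrow> 'v set set" where
  "squares X = {C \<in> X. card C = 4}"

definition edge_path :: "'v set set \<Rightarrow> 'v list \<Rightarrow> bool" where
  "edge_path X p \<longleftrightarrow>
     p \<noteq> [] \<and> set p \<subseteq> vertices X \<and> successively (\<lambda>u v. {u, v} \<in> edges X) p"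

definition connected_complex :: "'v set set \<Rightarrow> bool" where
  "connected_complex X \<longleftrightarrow>
     X \<noteq> {} \<and>
     (\<forall>u\<in>vertices X. \<forall>v\<in>vertices X. \<exists>p. edge_path X p \<and> hd p = u \<and> last p = v)"

definition comb_dist :: "'v set set \<Rightarrow> 'v \<Rightarrow> 'v \<Rightarrow> nat" where
  "comb_dist X u v = (LEAST n. \<exists>p. edge_path X p \<and> hd p = u \<and> last p = v \<and> length p = Suc n)"

text \<open>
  The fundamental group is taken to be the edge-path group: edge paths modulo removal of
  backtracks and pushing across squares.
\<close>

inductive elementary_homotopy :: "'v set set \<Rightarrow> 'v list \<Rightarrow> 'v list \<Rightarrow> bool" for X where
  backtrack: "{u, w} \<in> edges X \<Longrightarrow> elementary_homotopy X (r @ [u, w, u] @ s) (r @ [u] @ s)"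
| square: "\<lbrakk>{a, b, c, d} \<in> squares X; {a, b} \<in> edges X; {b, c} \<in> edges X;
            {c, d} \<in> edges X; {d, a} \<in> edges X\<rbrakk>
           \<Longrightarrow> elementary_homotopy X (r @ [a, b, c] @ s) (r @ [a, d, c] @ s)"

definition simply_connected_complex :: "'v set set \<Rightarrow> bool" where
  "simply_connected_complex X \<longleftrightarrow>
     connected_complex X \<and>
     (\<forall>p. edge_path X p \<and> hd p = last p \<longrightarrow> equivclp (elementary_homotopy X) p [hd p])"

text \<open>
  The link of \<open>v\<close> has as its vertices the edges at \<open>v\<close>, here represented by the neighbours of \<open>v\<close>;
  each cube at \<open>v\<close> contributes the simplex spanned by its edges at \<open>v\<close>.
\<close>

definition neighbours :: "'v set set \<Rightarrow> 'v \<Rightarrow> 'v set" where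
  "neighbours X v = {w. {v, w} \<in> edges X}"

definition link_simplices :: "'v set set \<Rightarrow> 'v \<Rightarrow> 'v set set" where
  "link_simplices X v = {C \<inter> neighbours X v | C. C \<in> X \<and> v \<in> C}"

definition flag_links :: "'v set set \<Rightarrow> bool" where
  "flag_links X \<longleftrightarrow>
     (\<forall>v\<in>vertices X. \<forall>\<sigma>. finite \<sigma> \<and> \<sigma> \<subseteq> neighbours X v \<and>
        (\<forall>a\<in>\<sigma>. \<forall>b\<in>\<sigma>. a \<noteq> b \<longrightarrow> {a, b} \<in> link_simplices X v) \<longrightarrow> \<sigma> \<in> link_simplices X v)"

definition CAT0_cube_complex :: "'v set set \<Rightarrow> bool" where
  "CAT0_cube_complex X \<longleftrightarrow> cube_complex X \<and> simply_connected_complex X \<and> flag_links X"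

definition locally_finite_complex :: "'v set set \<Rightarrow> bool" where
  "locally_finite_complex X \<longleftrightarrow> (\<forall>v\<in>vertices X. finite {e \<in> edges X. v \<in> e})"

definition cubical_automorphism :: "'v set set \<Rightarrow> ('v \<Rightarrow> 'v) \<Rightarrow> bool" where
  "cubical_automorphism X g \<longleftrightarrow> bij_betw g (vertices X) (vertices X) \<and> (\<lambda>C. g ` C) ` X = X"

text \<open>
  A compact subset lies in a finite subcomplex, so cocompactness means that the translates of
  finitely many cubes cover.
\<close>

definition cocompact_complex :: "'v set set \<Rightarrow> bool" where
  "cocompact_complex X \<longleftrightarrow>
     (\<exists>F. finite F \<and> F \<subseteq> X \<and> (\<forall>C\<in>X. \<exists>D\<in>F. \<exists>g. cubical_automorphism X g \<and> C = g ` D))"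

text \<open>
  A hyperplane is represented by the set of edges dual to it: a class of the equivalence relation
  generated by being opposite edges of a square.
\<close>

definition opposite_edges :: "'v set set \<Rightarrow> 'v set \<Rightarrow> 'v set \<Rightarrow> bool" where
  "opposite_edges X e f \<longleftrightarrow>
     e \<in> edges X \<and> f \<in> edges X \<and> e \<inter> f = {} \<and> (\<exists>Q\<in>squares X. e \<subseteq> Q \<and> f \<subseteq> Q)"

definition hyperplanes :: "'v set set \<Rightarrow> 'v set set set" where
  "hyperplanes X = {{f. equivclp (opposite_edges X) e f} | e. e \<in> edges X}"

text \<open>
  A halfspace is represented by its set of vertices. Removing the hyperplane \<open>H\<close> cuts exactly the
  edges dual to it, so the vertices of a component of the complement form a connected component of
  the 1-skeleton without the edges in \<open>H\<close>. In a CAT(0) cube complex, inclusion of closed halfspaces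
  is inclusion of their vertex sets.
\<close>

definition sides :: "'v set set \<Rightarrow> 'v set set \<Rightarrow> 'v set set" where
  "sides X H = {{w. (v, w) \<in> {(x, y). {x, y} \<in> edges X - H}\<^sup>*} | v. v \<in> vertices X}"

definition halfspaces :: "'v set set \<Rightarrow> 'v set set" where
  "halfspaces X = (\<Union>H\<in>hyperplanes X. sides X H)"

definition bounding_hyperplane :: "'v set set \<Rightarrow> 'v set \<Rightarrow> 'v set set" where
  "bounding_hyperplane X h = (THE H. H \<in> hyperplanes X \<and> h \<in> sides X H)"

definition opp :: "'v set set \<Rightarrow> 'v set \<Rightarrow> 'v set" where
  "opp X h = vertices X - h"

definition carrier_cubes :: "'v set set \<Rightarrow> 'v set set \<Rightarrow> 'v set set" where
  "carrier_cubes X H = {C \<in> X. \<exists>D\<in>X. C \<subseteq> D \<and> (\<exists>e\<in>H. e \<subseteq> D)}"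

definition positive_carrier :: "'v set set \<Rightarrow> 'v set \<Rightarrow> 'v set set" where
  "positive_carrier X h = {C \<in> carrier_cubes X (bounding_hyperplane X h). C \<subseteq> h}"

text \<open>
  Distance to the hyperplane is measured to the endpoints of its dual edges, which are within
  bounded distance of it.
\<close>

definition essential :: "'v set set \<Rightarrow> bool" where
  "essential X \<longleftrightarrow>
     (\<forall>h\<in>halfspaces X. \<forall>n. \<exists>v\<in>h. \<forall>e\<in>bounding_hyperplane X h. \<forall>u\<in>e. n \<le> comb_dist X v u)"

definition ultrafilters :: "'v set set \<Rightarrow> 'v set set set" where
  "ultrafilters X =
     {\<alpha>. \<alpha> \<subseteq> halfspaces X \<and>
         (\<forall>h\<in>halfspaces X. (h \<in> \<alpha>) \<noteq> (opp X h \<in> \<alpha>)) \<and>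
         (\<forall>h\<in>\<alpha>. \<forall>k\<in>halfspaces X. h \<subseteq> k \<longrightarrow> k \<in> \<alpha>)}"

definition basic_open :: "'v set set \<Rightarrow> 'v set set \<Rightarrow> 'v set set set" where
  "basic_open X H = {\<alpha> \<in> ultrafilters X. H \<subseteq> \<alpha>}"

text \<open>
  The sets below include \<open>ultrafilters X = basic_open X {}\<close> and are closed under finite
  intersections, so they form a basis of the topology they generate.
\<close>

definition ultrafilter_topology :: "'v set set \<Rightarrow> 'v set set topology" where
  "ultrafilter_topology X =
     topology_generated_by {basic_open X H | H. finite H \<and> H \<subseteq> halfspaces X}"

definition vertex_ultrafilter :: "'v set set \<Rightarrow> 'v \<Rightarrow> 'v set set" where
  "vertex_ultrafilter X v = {h \<in> halfspaces X. v \<in> h}"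

definition descending_chain_condition :: "'v set set \<Rightarrow> bool" where
  "descending_chain_condition \<alpha> \<longleftrightarrow>
     (\<forall>s :: nat \<Rightarrow> 'v set. (\<forall>n. s n \<in> \<alpha>) \<and> decseq s \<longrightarrow> (\<exists>m. \<forall>n. s m \<subseteq> s n))"

definition Roller_boundary :: "'v set set \<Rightarrow> 'v set set set" where
  "Roller_boundary X = {\<alpha> \<in> ultrafilters X. \<not> descending_chain_condition \<alpha>}"

definition non_terminating :: "'v set set \<Rightarrow> bool" where
  "non_terminating \<alpha> \<longleftrightarrow> (\<forall>h\<in>\<alpha>. \<exists>k\<in>\<alpha>. k \<subset> h)"

definition B_boundary :: "'v set set \<Rightarrow> 'v set set set" where
  "B_boundary X = ultrafilter_topology X closure_of {\<alpha> \<in> Roller_boundary X. non_terminating \<alpha>}"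

definition contains_hyperplane :: "'v set set \<Rightarrow> 'v set set set \<Rightarrow> 'v set set \<Rightarrow> bool" where
  "contains_hyperplane X U H \<longleftrightarrow> (\<forall>e\<in>H. \<forall>v\<in>e. vertex_ultrafilter X v \<in> U)"

text \<open>
  As there are no cubes with empty vertex set, two subcomplexes intersect iff they share a cube.
  Quantifying over \<open>C \<in> X\<close> makes the intersection over the empty family all of \<open>X\<close>.
\<close>

definition cage :: "'v set set \<Rightarrow> 'v set set \<Rightarrow> 'v set set \<Rightarrow> bool" where
  "cage X \<alpha> K \<longleftrightarrow> K \<subseteq> \<alpha> \<and> (\<exists>C\<in>X. \<forall>k\<in>K. C \<in> positive_carrier X k)"

text \<open>
  A hyperplane other than the one bounding \<open>k\<close> is contained in \<open>k\<close> iff every edge dual to it has both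
  endpoints in \<open>k\<close>: the midpoint of such an edge lies in \<open>k\<close>, and the edge is not cut by the hyperplane
  bounding \<open>k\<close>.
\<close>

definition hyperplane_in_halfspace :: "'v set set \<Rightarrow> 'v set set \<Rightarrow> 'v set \<Rightarrow> bool" where
  "hyperplane_in_halfspace X H k \<longleftrightarrow> H \<noteq> bounding_hyperplane X k \<and> (\<forall>e\<in>H. e \<subseteq> k)"

definition caged_hyperplanes :: "'v set set \<Rightarrow> bool" where
  "caged_hyperplanes X \<longleftrightarrow>
     (\<forall>\<alpha>\<in>Roller_boundary X. \<forall>K. cage X \<alpha> K \<longrightarrow>
        (\<exists>H\<in>hyperplanes X. \<forall>k\<in>K. hyperplane_in_halfspace X H k))"

end

theory Submission
  imports Defs "HOL-Library.Ramsey"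
begin

text \<open>
  The statement depends only on the family of halfspaces, each regarded as a set of vertices, and the
  proof has two independent layers: a combinatorial theory of such families, and the verification
  that the halfspaces of a CAT(0) cube complex form one.

  For the combinatorial layer, a cage in an ultrafilter is a set \<open>K\<close> of halfspaces with a common
  vertex at which each member is minimal, that is, a vertex lying in the positive carrier of each
  member (\<open>cage_iff_corner\<close>), and a hyperplane is contained in \<open>k\<close> iff one of its two halfspaces is
  properly contained in \<open>k\<close>. So (1), (2) and (3) become \<open>nonterminating_dense\<close>, \<open>cages_filled\<close> and
  \<open>neighbourhoods_filled\<close>: every finite part of a boundary ultrafilter lies in a non-terminating
  ultrafilter; every cage has a hyperplane inside it; every finite part has a hyperplane inside it.

  (2) and (3) are close. Cages are finite by local finiteness, so (3) gives (2). Conversely, a vertex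
  in the intersection of a finite \<open>M \<subseteq> \<alpha>\<close> can be moved until every adjacent halfspace below a member
  of \<open>M\<close> lies in \<open>\<alpha>\<close>; a hyperplane inside the cage of all adjacent halfspaces in \<open>\<alpha>\<close> is then inside
  \<open>M\<close>. For (3) implies (1), the hyperplanes are enumerated and a halfspace contained in
  all members of \<open>M\<close> is shrunk again and again, deciding one hyperplane at each step; the limit is non-terminating.

  The implication from (1) to (2) is the heart. A cage with no hyperplane inside it is \<open>bad\<close>: its
  sector is infinite, but no halfspace lies properly below all members. Let \<open>K\<close> be bad of the least
  size. If \<open>\<gamma>\<close> is a non-terminating ultrafilter containing \<open>K\<close>, then minimality forces each member of
  \<open>\<gamma>\<close> below \<open>k \<in> K\<close> to cross all other members of \<open>K\<close> (\<open>below_transverse\<close>); choosing such halfspaces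
  maximal yields another bad family, a cover of \<open>K\<close> (\<open>covers_exists\<close>). The corner of \<open>K\<close> is infinite
  (\<open>bad_corner_infinite\<close>), and is divided into two infinite parts by some halfspace \<open>h\<close>
  (\<open>two_sided\<close>); with a suitable \<open>h\<close>, the ultrafilter \<open>\<gamma>\<close>, and thus the cover, can be pushed to either
  side of \<open>h\<close> (\<open>nonterminating_beyond\<close>). This makes \<open>h\<close> cross all bad families that lie above \<open>K\<close>
  (\<open>good_transverse\<close>), though it does not cross the cover. Iterating, one gets covers
  \<open>\<kappa>\<^sub>0, \<kappa>\<^sub>1, \<dots>\<close> and at each stage \<open>n\<close> a halfspace that crosses \<open>\<kappa>\<^sub>0, \<dots>, \<kappa>\<^sub>n\<close> but not the next family. By
  cocompactness these halfspaces occur within a distance \<open>r\<close> that does not depend on the stage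
  (\<open>uniform_detection\<close>). Going from a vertex at the corner of the next family back to the corner of the
  previous one, the halfspaces crossing all families so far stay within distance \<open>r\<close>
  (\<open>transport\<close>) while at least one further halfspace is gained. After many steps there are more
  halfspaces near a vertex than cocompactness allows (\<open>no_counterexample\<close>).

  For the geometric layer, simple connectivity and the flag condition have to be turned into
  properties of the edge metric. Reduced edge paths modulo pushing across squares admit a normal form
  that is invariant under homotopy (\<open>normal_form_unique\<close>). Hence the 1-skeleton is bipartite and
  satisfies the quadrangle condition (\<open>quadrangle\<close>): two neighbours of \<open>v\<close> that are closer to a base
  vertex span a square with \<open>v\<close> whose fourth vertex is closer still. Everything about hyperplanes
  then follows by induction on distances: the halfspaces are the sets \<open>W a b\<close> of vertices closer to
  \<open>a\<close> than to its neighbour \<open>b\<close>, an edge crosses only its own hyperplane, and halfspaces are gated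
  (\<open>gate\<close>).
\<close>

section \<open>Halfspace systems\<close>

text \<open>
  The vertices and halfspaces of a CAT(0) cube complex, stripped of the cubes. The geometry enters
  through the last axiom: from a vertex of \<open>h\<close> one can leave a halfspace contained in \<open>h\<close> along a
  single edge, crossing no other hyperplane. In a cube complex this edge is the first one on a
  geodesic to a nearest vertex outside \<open>h\<close>.
\<close>

locale halfspace_system =
  fixes V :: "'v set" and HS :: "'v set set"
  assumes vertex_exists: "V \<noteq> {}"
    and halfspace_sub: "h \<in> HS \<Longrightarrow> h \<subseteq> V"
    and halfspace_nonempty: "h \<in> HS \<Longrightarrow> h \<noteq> {}"
    and compl_halfspace: "h \<in> HS \<Longrightarrow> V - h \<in> HS"
    and finite_separating: "u \<in> V \<Longrightarrow> v \<in> V \<Longrightarrow> finite {h \<in> HS. u \<in> h \<and> v \<notin> h}"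
    and separated: "u \<in> V \<Longrightarrow> v \<in> V \<Longrightarrow> u \<noteq> v \<Longrightarrow> \<exists>h\<in>HS. u \<in> h \<and> v \<notin> h"
    and first_step: "h \<in> HS \<Longrightarrow> x \<in> h \<Longrightarrow>
      \<exists>y\<in>V. \<exists>n\<in>HS. x \<in> n \<and> y \<notin> n \<and> n \<subseteq> h \<and> (\<forall>m\<in>HS. x \<in> m \<and> y \<notin> m \<longrightarrow> m = n)"
begin

text \<open>
  Plays the role of an edge from \<open>x\<close> to \<open>y\<close>, dual to the hyperplane that bounds \<open>n\<close>.
\<close>

definition step_out :: "'v \<Rightarrow> 'v set \<Rightarrow> 'v \<Rightarrow> bool" where
  "step_out x n y \<longleftrightarrow> x \<in> V \<and> y \<in> V \<and> n \<in> HS \<and> x \<in> n \<and> y \<notin> n \<and>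
     (\<forall>m\<in>HS. x \<in> m \<and> y \<notin> m \<longrightarrow> m = n)"

text \<open>
  The vertices of the positive carrier of \<open>n\<close>. Minimality of \<open>n\<close> among the halfspaces containing
  \<open>x\<close> replaces the existence of a dual edge at \<open>x\<close>, so that no edges are needed; the two agree by
  \<open>step_out_pc\<close> and \<open>pc_step_out\<close>.
\<close>

definition pc :: "'v set \<Rightarrow> 'v set" where
  "pc n = {x \<in> n. \<forall>q\<in>HS. x \<in> q \<and> q \<subseteq> n \<longrightarrow> q = n}"

definition adjacent :: "'v \<Rightarrow> 'v set set" where
  "adjacent x = {n \<in> HS. x \<in> pc n}"

definition transverse :: "'v set \<Rightarrow> 'v set \<Rightarrow> bool" where
  "transverse h k \<longleftrightarrow> h \<inter> k \<noteq> {} \<and> h - k \<noteq> {} \<and> k - h \<noteq> {} \<and> V - h - k \<noteq> {}"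

definition sector :: "'v set set \<Rightarrow> 'v set" where
  "sector K = {x \<in> V. \<forall>k\<in>K. x \<in> k}"

text \<open>
  The vertices lying on the positive carriers of all members, so that \<open>K\<close> is a cage iff its corner
  is nonempty.
\<close>

definition corner :: "'v set set \<Rightarrow> 'v set" where
  "corner K = {x \<in> V. \<forall>k\<in>K. x \<in> pc k}"

definition UF :: "'v set set set" where
  "UF = {\<alpha>. \<alpha> \<subseteq> HS \<and> (\<forall>h\<in>HS. (h \<in> \<alpha>) \<noteq> (V - h \<in> \<alpha>)) \<and>
     (\<forall>h\<in>\<alpha>. \<forall>k\<in>HS. h \<subseteq> k \<longrightarrow> k \<in> \<alpha>)}"

definition boundary :: "'v set set set" where
  "boundary = {\<alpha> \<in> UF. \<not> descending_chain_condition \<alpha>}"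

lemma compl_compl: "h \<in> HS \<Longrightarrow> V - (V - h) = h"
  using halfspace_sub by blast

lemma outside_exists: "h \<in> HS \<Longrightarrow> \<exists>x\<in>V. x \<notin> h"
  using compl_halfspace halfspace_nonempty by blast

lemma halfspace_mem: "h \<in> HS \<Longrightarrow> x \<in> h \<Longrightarrow> x \<in> V"
  using halfspace_sub by blast

lemma first_step_out:
  assumes "h \<in> HS" "x \<in> h"
  obtains n y where "step_out x n y" "n \<subseteq> h"
  using first_step[OF assms] halfspace_mem[OF assms] unfolding step_out_def by blast

lemma step_out_back:
  assumes "step_out x n y" shows "step_out y (V - n) x"
proof -
  have a: "x \<in> V" "y \<in> V" "n \<in> HS" "x \<in> n" "y \<notin> n" and u: "\<And>m. m \<in> HS \<Longrightarrow> x \<in> m \<Longrightarrow> y \<notin> m \<Longrightarrow> m = n"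
    using assms unfolding step_out_def by auto
  have "m = V - n" if "m \<in> HS" "y \<in> m" "x \<notin> m" for m
    using u[OF compl_halfspace[OF that(1)]] that a compl_compl[OF that(1)] by auto
  then show ?thesis using a compl_halfspace unfolding step_out_def by auto
qed

lemma step_out_pc: "step_out x n y \<Longrightarrow> x \<in> pc n"
  unfolding step_out_def pc_def by blast

lemma pc_step_out:
  assumes "n \<in> HS" "x \<in> pc n" obtains y where "step_out x n y"
proof -
  have "x \<in> n" using assms(2) pc_def by auto
  then obtain m y where "step_out x m y" "m \<subseteq> n" using first_step_out assms(1) by blast
  moreover have "m = n" using calculation assms(2) unfolding pc_def step_out_def by blast
  ultimately show ?thesis using that by blast
qed

lemma pc_sub: "pc n \<subseteq> n" unfolding pc_def by blast

lemma not_in_smaller: "x \<in> pc n \<Longrightarrow> q \<in> HS \<Longrightarrow> q \<subset> n \<Longrightarrow> x \<notin> q"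
  unfolding pc_def by blast

lemma transverse_sym: "transverse h k \<Longrightarrow> transverse k h"
  unfolding transverse_def by blast

lemma transverse_compl:
  assumes "h \<in> HS" "k \<in> HS" "transverse h k"
  shows "transverse (V - h) k"
proof -
  have "(V - h) \<inter> k = k - h" "V - h - k = V - h - k" "k - (V - h) = h \<inter> k" "V - (V - h) - k = h - k"
    "(V - h) - k = V - h - k"
    using halfspace_sub[OF assms(1)] halfspace_sub[OF assms(2)] by auto
  then show ?thesis using assms(3) unfolding transverse_def by auto
qed

lemma transverse_compl2:
  assumes "h \<in> HS" "k \<in> HS" "transverse h k"
  shows "transverse h (V - k)"
  using assms transverse_compl transverse_sym by blast

text \<open>
  If \<open>x\<close> lies on the positive carrier of \<open>s\<close>, the vertex \<open>y\<close> across the hyperplane of \<open>s\<close> differs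
  from \<open>x\<close> in that hyperplane only. So \<open>y\<close> witnesses the one of the four intersections that the
  assumptions leave open.
\<close>

lemma transverse_if_adjacent:
  assumes "s \<in> HS" "q \<in> HS" "x \<in> pc s" "x \<notin> q" "q \<inter> s \<noteq> {}" "\<not> q \<subseteq> s"
  shows "transverse q s"
proof -
  obtain y where y: "step_out x s y" using pc_step_out[OF assms(1,3)] .
  have a: "x \<in> V" "y \<in> V" "x \<in> s" "y \<notin> s" and u: "\<And>m. m \<in> HS \<Longrightarrow> x \<in> m \<Longrightarrow> y \<notin> m \<Longrightarrow> m = s"
    using y unfolding step_out_def by auto
  have "y \<notin> q"
  proof
    assume "y \<in> q"
    then have "V - q = s" using u[OF compl_halfspace[OF assms(2)]] a assms(4) by auto
    then show False using assms(5) by auto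
  qed
  then show ?thesis using a assms(4-6) unfolding transverse_def by blast
qed

text \<open>
  Walks that only ever enter halfspaces containing \<open>q\<close>, i.e. initial pieces of geodesics to \<open>q\<close>.
  What they preserve is recorded in \<open>toward_stay\<close>: a halfspace meeting \<open>q\<close> is never left.
\<close>

inductive toward :: "'v set \<Rightarrow> 'v \<Rightarrow> 'v \<Rightarrow> bool" for q where
  stay: "toward q y y"
| move: "toward q y x \<Longrightarrow> step_out x (V - n) x' \<Longrightarrow> n \<in> HS \<Longrightarrow> q \<subseteq> n \<Longrightarrow> toward q y x'"

lemma toward_stay:
  assumes "toward q y y'" "t \<in> HS" "y \<in> t" "q \<inter> t \<noteq> {}"
  shows "y' \<in> t"
  using assms(1,3)
proof (induction rule: toward.induct)
  case (move y x n x')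
  show ?case
  proof (rule ccontr)
    assume "x' \<notin> t"
    moreover have "x \<in> t" using move by simp
    ultimately have "t = V - n" using move.hyps(2) assms(2) unfolding step_out_def by blast
    then show False using move.hyps(4) assms(4) by auto
  qed
qed

lemma toward_trans: "toward q y z \<Longrightarrow> toward q x y \<Longrightarrow> toward q x z"
  by (induction rule: toward.induct) (auto intro: toward.intros)

text \<open>
  Walk to \<open>q\<close> and stop one edge before entering it. A positive carrier that contains the starting
  vertex is lost on the way only by entering some \<open>t \<subset> s\<close>; such a \<open>t\<close> contains \<open>q\<close>, and properly
  so because the walk stops before entering \<open>q\<close>, contrary to the assumption on \<open>s\<close>.
\<close>

lemma toward_reach:
  assumes "q \<in> HS" "y \<in> V" "y \<notin> q"
  shows "\<exists>y'\<in>pc (V - q). toward q y y' \<and> y' \<notin> q \<and>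
    (\<forall>s\<in>HS. y \<in> pc s \<and> q \<inter> s \<noteq> {} \<and> \<not> (\<exists>m\<in>HS. q \<subset> m \<and> m \<subset> s) \<longrightarrow> y' \<in> pc s)"
  using assms(2,3)
proof (induction "card {n \<in> HS. q \<subseteq> n \<and> y \<notin> n}" arbitrary: y rule: less_induct)
  case less
  obtain z where z: "z \<in> q" "z \<in> V" using assms(1) halfspace_nonempty halfspace_mem by blast
  have "y \<in> V - q" using less by blast
  then obtain n' y1 where n': "step_out y n' y1" "n' \<subseteq> V - q"
    using first_step_out compl_halfspace[OF assms(1)] by blast
  define n where "n = V - n'"
  have nHS: "n \<in> HS" and n'HS: "n' \<in> HS" using n' compl_halfspace unfolding n_def step_out_def by auto
  have n'n: "n' = V - n" using compl_compl n'HS n_def by simp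
  have qn: "q \<subseteq> n" using n'(2) halfspace_sub[OF assms(1)] unfolding n_def by blast
  show ?case
  proof (cases "n = q")
    case True
    then have "y \<in> pc (V - q)" using n' step_out_pc n'n by blast
    then show ?thesis using less.prems toward.stay by blast
  next
    case False
    have y1: "y1 \<in> V" "y1 \<in> n" "y \<notin> n" using n' unfolding n_def step_out_def by auto
    have tow: "toward q y y1" using toward.move[OF toward.stay _ nHS qn] n' n'n by simp
    have y1q: "y1 \<notin> q"
    proof
      assume "y1 \<in> q"
      then have "V - q = n'" using n' less.prems compl_halfspace[OF assms(1)] unfolding step_out_def by blast
      then show False using False n_def compl_compl assms(1) by blast
    qed
    have fin: "finite {n \<in> HS. q \<subseteq> n \<and> y \<notin> n}"
      by (rule finite_subset[OF _ finite_separating[OF z(2) less.prems(1)]]) (use z in blast)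
    have "{n \<in> HS. q \<subseteq> n \<and> y1 \<notin> n} \<subset> {n \<in> HS. q \<subseteq> n \<and> y \<notin> n}"
    proof -
      have "y \<notin> m" if "m \<in> HS" "q \<subseteq> m" "y1 \<notin> m" for m
        using toward_stay[OF tow, of m] that z by blast
      then show ?thesis using y1 nHS qn by blast
    qed
    from less.hyps[OF psubset_card_mono[OF fin this] y1(1) y1q]
    obtain y' where y': "y' \<in> pc (V - q)" "toward q y1 y'" "y' \<notin> q"
      "\<forall>s\<in>HS. y1 \<in> pc s \<and> q \<inter> s \<noteq> {} \<and> \<not> (\<exists>m\<in>HS. q \<subset> m \<and> m \<subset> s) \<longrightarrow> y' \<in> pc s"
      by (elim bexE conjE) blast
    have "y1 \<in> pc s" if s: "s \<in> HS" "y \<in> pc s" "q \<inter> s \<noteq> {}" "\<not> (\<exists>m\<in>HS. q \<subset> m \<and> m \<subset> s)" for s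
    proof -
      have "y1 \<in> s" using toward_stay[OF tow s(1)] s pc_sub by blast
      moreover have "t = s" if "t \<in> HS" "y1 \<in> t" "t \<subseteq> s" for t
      proof (rule ccontr)
        assume "t \<noteq> s"
        then have ts: "t \<subset> s" using that by blast
        then have "y \<notin> t" using not_in_smaller s that by blast
        moreover have "y \<in> V - t \<and> y1 \<notin> V - t" using calculation that less.prems by blast
        ultimately have "V - t = n'" using n' compl_halfspace[OF that(1)] unfolding step_out_def by blast
        then have "t = n" using compl_compl that n_def by blast
        then show False using s(4) ts qn False nHS by blast
      qed
      ultimately show ?thesis unfolding pc_def by blast
    qed
    then show ?thesis using y' toward_trans[OF y'(2) tow] by blast
  qed
qed

text \<open>
  The version of \<open>toward_reach\<close> for corners: as no halfspace lies strictly between \<open>q\<close> and a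
  member of \<open>S\<close>, the walk to \<open>q\<close> stays at the corner of \<open>S\<close>.
\<close>

lemma approach:
  assumes "q \<in> HS" "S \<subseteq> HS" "y \<in> corner S" "y \<notin> q"
    "\<And>s. s \<in> S \<Longrightarrow> q \<inter> s \<noteq> {} \<and> \<not> (\<exists>m\<in>HS. q \<subset> m \<and> m \<subset> s)"
  obtains y' where "y' \<in> corner S" "y' \<in> pc (V - q)" "toward q y y'"
proof -
  have "y \<in> V" using assms(3) corner_def by auto
  from toward_reach[OF assms(1) this assms(4)] obtain y' where
   y': "y' \<in> pc (V - q)" "toward q y y'" "\<forall>s\<in>HS. y \<in> pc s \<and> q \<inter> s \<noteq> {} \<and> \<not> (\<exists>m\<in>HS. q \<subset> m \<and> m \<subset> s) \<longrightarrow> y' \<in> pc s"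
    by (elim bexE conjE)
  have "y' \<in> pc s" if "s \<in> S" for s
    using y'(3)[rule_format, of s] assms(3) assms(5)[OF that] subsetD[OF assms(2) that] that
    unfolding corner_def by simp
  moreover have "y' \<in> V" using pc_sub[of "V - q"] y'(1) by blast
  ultimately have "y' \<in> corner S" unfolding corner_def by simp
  then show ?thesis using that y'(1,2) by simp
qed

text \<open>
  One step further than \<open>approach\<close>. The last step enters \<open>q\<close> itself, which keeps the vertex on the
  positive carrier of \<open>s\<close> unless \<open>q \<subseteq> s\<close>.
\<close>

lemma enter:
  assumes "q \<in> HS" "S \<subseteq> HS" "y \<in> corner S" "y \<notin> q"
    "\<And>s. s \<in> S \<Longrightarrow> q \<inter> s \<noteq> {} \<and> \<not> q \<subseteq> s"
  obtains y' where "y' \<in> corner S" "y' \<in> pc q" "toward q y y'"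
proof -
  obtain z where z: "z \<in> corner S" "z \<in> pc (V - q)" "toward q y z"
    using approach[OF assms(1-4)] assms(5) by blast
  obtain x where x: "step_out z (V - q) x"
    using pc_step_out[OF compl_halfspace[OF assms(1)] z(2)] by blast
  have xq: "step_out x q z" using step_out_back[OF x] compl_compl assms(1) by simp
  have tow: "toward q z x" using toward.move[OF toward.stay x assms(1)] by blast
  have "x \<in> pc s" if s: "s \<in> S" for s
  proof -
    have sHS: "s \<in> HS" and zs: "z \<in> pc s" using assms z s unfolding corner_def by auto
    have "x \<in> s" using toward_stay[OF tow sHS] assms(5)[OF s] zs pc_sub by blast
    moreover have "t = s" if "t \<in> HS" "x \<in> t" "t \<subseteq> s" for t
    proof (rule ccontr)
      assume "t \<noteq> s"
      then have "z \<notin> t" using not_in_smaller zs that by blast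
      then have "t = q" using xq that unfolding step_out_def by blast
      then show False using assms(5)[OF s] that by blast
    qed
    ultimately show ?thesis unfolding pc_def by blast
  qed
  then have "x \<in> corner S" using xq unfolding corner_def step_out_def by blast
  moreover have "toward q y x" using toward_trans[OF tow z(3)] .
  ultimately show ?thesis using that step_out_pc[OF xq] by blast
qed

text \<open>
  From a vertex of the corner, move to the positive carrier of \<open>m\<close> without leaving the corner:
  enter \<open>m\<close> from outside, or approach its complement from inside.
\<close>

lemma corner_insert_transverse:
  assumes "m \<in> HS" "S \<subseteq> HS" "corner S \<noteq> {}" "\<And>s. s \<in> S \<Longrightarrow> transverse m s"
  shows "corner (insert m S) \<noteq> {}"
proof -
  obtain y where y: "y \<in> corner S" using assms by blast
  have "\<exists>x. x \<in> corner S \<and> x \<in> pc m"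
  proof (cases "y \<in> m")
    case False
    show ?thesis
      by (rule enter[OF assms(1,2) y False]) (use assms(4) in \<open>auto simp: transverse_def\<close>)
  next
    case True
    then have nm: "y \<notin> V - m" by blast
    have tr: "transverse (V - m) s" if "s \<in> S" for s using transverse_compl assms that by blast
    show ?thesis
    proof (rule approach[OF compl_halfspace[OF assms(1)] assms(2) y nm])
      show "(V - m) \<inter> s \<noteq> {} \<and> \<not> (\<exists>ma\<in>HS. V - m \<subset> ma \<and> ma \<subset> s)" if "s \<in> S" for s
        using tr[OF that] unfolding transverse_def by blast
    qed (use compl_compl[OF assms(1)] in auto)
  qed
  then show ?thesis unfolding corner_def by auto
qed

text \<open>
  The form that the flag condition takes here: pairwise crossing hyperplanes meet in a common
  cube.
\<close>

lemma corner_pairwise_transverse: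
  assumes "finite S" "S \<subseteq> HS" "pairwise transverse S"
  shows "corner S \<noteq> {}"
  using assms
proof (induction S rule: finite_induct)
  case empty
  then show ?case using vertex_exists unfolding corner_def by auto
next
  case (insert m S)
  then show ?case using corner_insert_transverse[of m S] by (auto simp: pairwise_insert)
qed

lemma pc_exists:
  assumes "h \<in> HS" shows "\<exists>x\<in>V. x \<in> pc h"
proof -
  obtain y where y: "y \<in> h" "y \<in> V" using halfspace_nonempty halfspace_mem assms by blast
  then have "y \<notin> V - h" by simp
  from toward_reach[OF compl_halfspace[OF assms] y(2) this] show ?thesis
    using compl_compl[OF assms] halfspace_mem[OF assms] pc_sub[of h] by auto
qed

lemma step_out_unique:
  assumes "step_out x m y" "step_out x' m y" shows "x = x'"
proof (rule ccontr)
  assume "x \<noteq> x'"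
  have V: "x \<in> V" "x' \<in> V" "x \<in> m" "x' \<in> m" "y \<in> V" using assms unfolding step_out_def by auto
  obtain h where h: "h \<in> HS" "x \<in> h" "x' \<notin> h" using separated[OF V(1,2) \<open>x \<noteq> x'\<close>] by auto
  show False
  proof (cases "y \<in> h")
    case True
    then have "V - h = m" using assms(2) compl_halfspace[OF h(1)] V h unfolding step_out_def by auto
    then show False using V h by auto
  next
    case False
    then have "h = m" using assms(1) h unfolding step_out_def by auto
    then show False using V h by auto
  qed
qed

lemma finite_above:
  assumes "j \<in> HS" "w \<in> V" shows "finite {n \<in> HS. j \<subseteq> n \<and> w \<notin> n}"
proof -
  obtain u where "u \<in> j" "u \<in> V" using halfspace_nonempty halfspace_mem assms(1) by blast
  then show ?thesis
    by (intro finite_subset[OF _ finite_separating[of u w]]) (use assms in auto)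
qed

section \<open>Ultrafilters of halfspaces\<close>

lemma uf_sub: "\<alpha> \<in> UF \<Longrightarrow> h \<in> \<alpha> \<Longrightarrow> h \<in> HS"
  unfolding UF_def by auto

lemma uf_up: "\<alpha> \<in> UF \<Longrightarrow> h \<in> \<alpha> \<Longrightarrow> k \<in> HS \<Longrightarrow> h \<subseteq> k \<Longrightarrow> k \<in> \<alpha>"
  unfolding UF_def by auto

lemma uf_compl: "\<alpha> \<in> UF \<Longrightarrow> h \<in> HS \<Longrightarrow> V - h \<in> \<alpha> \<longleftrightarrow> h \<notin> \<alpha>"
  unfolding UF_def by auto

lemma uf_meet:
  assumes "\<alpha> \<in> UF" "h \<in> \<alpha>" "k \<in> \<alpha>" shows "h \<inter> k \<noteq> {}"
proof
  assume "h \<inter> k = {}"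
  then have "h \<subseteq> V - k" using halfspace_sub[OF uf_sub[OF assms(1,2)]] by auto
  then have "V - k \<in> \<alpha>" using uf_up[OF assms(1,2)] compl_halfspace uf_sub assms by blast
  then show False using uf_compl[OF assms(1)] uf_sub assms by blast
qed

lemma boundary_uf: "\<alpha> \<in> boundary \<Longrightarrow> \<alpha> \<in> UF"
  unfolding boundary_def by auto

text \<open>
  Walk from \<open>v\<close> into \<open>M\<close>, always crossing into halfspaces that contain some \<open>j \<in> M\<close> and hence
  belong to \<open>\<alpha>\<close>. This is what the second conclusion records.
\<close>

lemma uf_move:
  assumes "\<alpha> \<in> UF" "M \<subseteq> \<alpha>" "finite M" "v \<in> V"
  obtains w where "w \<in> sector M" "\<forall>m\<in>HS. w \<in> m \<and> v \<notin> m \<longrightarrow> m \<in> \<alpha>"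
proof -
  have "\<exists>w. w \<in> sector M \<and> (\<forall>m\<in>HS. w \<in> m \<and> v \<notin> m \<longrightarrow> m \<in> \<alpha>)"
    if "u \<in> V" "\<forall>m\<in>HS. u \<in> m \<and> v \<notin> m \<longrightarrow> m \<in> \<alpha>" for u
    using that
  proof (induction "card {n \<in> \<alpha>. u \<notin> n \<and> (\<exists>j\<in>M. j \<subseteq> n)}" arbitrary: u rule: less_induct)
    case less
    show ?case
    proof (cases "u \<in> sector M")
      case True
      then show ?thesis using less.prems by auto
    next
      case False
      then obtain j where j: "j \<in> M" "u \<notin> j" using less.prems unfolding sector_def by auto
      have jHS: "j \<in> HS" using j assms uf_sub by auto
      obtain n' y where s: "step_out u n' y" "n' \<subseteq> V - j"
        using first_step_out[OF compl_halfspace[OF jHS]] j less.prems by auto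
      define n where "n = V - n'"
      have n'HS: "n' \<in> HS" and nHS: "n \<in> HS" and yV: "y \<in> V" "y \<in> n" "u \<notin> n"
        using s compl_halfspace unfolding step_out_def n_def by auto
      have n'n: "n' = V - n" using compl_compl[OF n'HS] n_def by auto
      have jn: "j \<subseteq> n" using s halfspace_sub[OF jHS] unfolding n_def by auto
      have na: "n \<in> \<alpha>" using uf_up[OF assms(1) _ nHS jn] j assms by auto
      then have n'a: "n' \<notin> \<alpha>" using uf_compl[OF assms(1) nHS] n'n by auto
      have sb: "step_out y n u" using step_out_back[OF s(1)] n_def by auto
      have Py: "\<forall>m\<in>HS. y \<in> m \<and> v \<notin> m \<longrightarrow> m \<in> \<alpha>"
      proof (intro ballI impI)
        fix m assume m: "m \<in> HS" "y \<in> m \<and> v \<notin> m"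
        show "m \<in> \<alpha>"
        proof (cases "u \<in> m")
          case True then show ?thesis using less.prems m by auto
        next
          case False
          then have "m = n" using sb m unfolding step_out_def by auto
          then show ?thesis using na by auto
        qed
      qed
      have "{n \<in> \<alpha>. u \<notin> n \<and> (\<exists>j\<in>M. j \<subseteq> n)} \<subseteq> (\<Union>j\<in>M. {n \<in> HS. j \<subseteq> n \<and> u \<notin> n})"
        using uf_sub[OF assms(1)] by auto
      then have fin: "finite {n \<in> \<alpha>. u \<notin> n \<and> (\<exists>j\<in>M. j \<subseteq> n)}"
        using finite_above uf_sub[OF assms(1)] assms less.prems finite_subset
        by (metis (no_types, lifting) finite_UN_I subsetD)
      have "u \<notin> m" if "m \<in> \<alpha>" "y \<notin> m" for m
      proof
        assume "u \<in> m"
        then have "m = n'" using s that uf_sub[OF assms(1)] unfolding step_out_def by auto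
        then show False using n'a that by auto
      qed
      then have "{n \<in> \<alpha>. y \<notin> n \<and> (\<exists>j\<in>M. j \<subseteq> n)} \<subset> {n \<in> \<alpha>. u \<notin> n \<and> (\<exists>j\<in>M. j \<subseteq> n)}"
        using na yV j jn by auto
      from less.hyps[OF psubset_card_mono[OF fin this] yV(1) Py] show ?thesis .
    qed
  qed
  from this[OF assms(4)] show ?thesis using that by auto
qed

text \<open>
  Otherwise the infinitely many members of the chain all separate \<open>x\<close> from a vertex outside the
  first one.
\<close>

lemma chain_escapes:
  assumes "\<And>n. s n \<in> HS" "\<And>n::nat. s (Suc n) \<subset> s n" "x \<in> V"
  obtains n0 where "\<And>n. n \<ge> n0 \<Longrightarrow> x \<notin> s n"
proof -
  have dec: "s n \<subset> s m" if "m < n" for m n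
    using that assms(2) by (induction n) (auto simp: less_Suc_eq)
  have inj: "inj s"
    by (rule injI) (metis dec nat_neq_iff psubset_imp_subset psubsetE)
  have "\<exists>n0. x \<notin> s n0"
  proof (rule ccontr)
    assume a: "\<not> ?thesis"
    obtain y where y: "y \<in> V" "y \<notin> s 0" using outside_exists assms(1) by blast
    have "y \<notin> s n" for n using y dec[of 0 n] by (cases n) auto
    then have "range s \<subseteq> {h \<in> HS. x \<in> h \<and> y \<notin> h}" using a assms by auto
    then have "finite (range s)" using finite_separating[OF assms(3) y(1)] finite_subset by blast
    then show False using inj finite_imageD by blast
  qed
  then obtain n0 where "x \<notin> s n0" by auto
  then have "x \<notin> s n" if "n \<ge> n0" for n using dec[of n0 n] that by (cases "n = n0") auto
  then show ?thesis using that by auto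
qed

lemma boundary_chain:
  assumes "\<alpha> \<in> boundary"
  obtains s :: "nat \<Rightarrow> 'v set" where "\<And>n. s n \<in> \<alpha>" "\<And>n. s (Suc n) \<subset> s n"
proof -
  obtain s :: "nat \<Rightarrow> 'v set" where s: "\<And>n. s n \<in> \<alpha>" "decseq s" "\<And>m. \<exists>n. \<not> s m \<subseteq> s n"
    using assms unfolding boundary_def descending_chain_condition_def by auto
  have "\<exists>f. \<forall>n::nat. f n \<in> range s \<and> f (Suc n) \<subset> f n"
  proof (rule dependent_nat_choice)
    show "\<exists>x. x \<in> range s" by auto
    fix x assume "x \<in> range s"
    then obtain m where m: "x = s m" by auto
    obtain n where n: "\<not> s m \<subseteq> s n" using s(3)[of m] by blast
    then have "m \<le> n" using s(2) unfolding decseq_def by (meson nat_le_linear)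
    then show "\<exists>y. y \<in> range s \<and> y \<subset> x" using n s(2) m unfolding decseq_def by blast
  qed
  then show ?thesis using that s by (metis rangeE)
qed

lemma chain_boundary:
  assumes "\<alpha> \<in> UF" "\<And>n. s n \<in> \<alpha>" "\<And>n::nat. s (Suc n) \<subset> s n"
  shows "\<alpha> \<in> boundary"
proof -
  have "decseq s" by (rule decseq_SucI) (use assms in auto)
  moreover have "\<exists>n. \<not> s m \<subseteq> s n" for m using assms(3)[of m] by (intro exI[of _ "Suc m"]) auto
  ultimately show ?thesis using assms unfolding boundary_def descending_chain_condition_def by blast
qed

lemma chain_meets_infinite:
  assumes "\<And>n. s n \<in> HS" "\<And>n::nat. s (Suc n) \<subset> s n" "A \<subseteq> V" "\<And>n. n \<ge> n0 \<Longrightarrow> A \<inter> s n \<noteq> {}"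
  shows "infinite A"
proof
  assume fin: "finite A"
  have "\<exists>k. \<forall>n\<ge>k. x \<notin> s n" if xA: "x \<in> A" for x
  proof -
    obtain k where "\<And>n. n \<ge> k \<Longrightarrow> x \<notin> s n"
      by (rule chain_escapes[of s x]) (use assms xA in auto)
    then show ?thesis by blast
  qed
  then obtain f where f: "\<And>x n. x \<in> A \<Longrightarrow> n \<ge> f x \<Longrightarrow> x \<notin> s n" by metis
  define N where "N = Max (insert n0 (f ` A))"
  have "N \<ge> n0" "\<And>x. x \<in> A \<Longrightarrow> N \<ge> f x" using fin unfolding N_def by auto
  then show False using f assms(4)[of N] by blast
qed

text \<open>
  Along a strictly descending chain in \<open>\<alpha>\<close>, each member meets the sector by \<open>uf_move\<close>, while every
  vertex leaves the chain eventually.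
\<close>

lemma sector_infinite:
  assumes "\<alpha> \<in> boundary" "M \<subseteq> \<alpha>" "finite M" shows "infinite (sector M)"
proof -
  obtain s :: "nat \<Rightarrow> 'v set" where s: "\<And>n. s n \<in> \<alpha>" "\<And>n. s (Suc n) \<subset> s n"
    using boundary_chain[OF assms(1)] by blast
  have uf: "\<alpha> \<in> UF" using assms boundary_uf by auto
  show ?thesis
  proof (rule chain_meets_infinite[of s _ 0])
    show "s n \<in> HS" for n using s uf_sub[OF uf] by auto
    show "sector M \<inter> s n \<noteq> {}" for n
    proof -
      obtain v where "v \<in> V" using vertex_exists by auto
      then obtain w where "w \<in> sector (insert (s n) M)"
        by (rule uf_move[OF uf, of "insert (s n) M" v, rotated 2]) (use s assms in auto)
      then show ?thesis unfolding sector_def by auto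
    qed
  qed (use s in \<open>auto simp: sector_def\<close>)
qed

definition vertex_uf :: "'v \<Rightarrow> 'v set set" where
  "vertex_uf v = {h \<in> HS. v \<in> h}"

lemma nonterminating_boundary:
  assumes "\<gamma> \<in> UF" "non_terminating \<gamma>" "\<gamma> \<noteq> {}" shows "\<gamma> \<in> boundary"
proof -
  have "\<exists>f. \<forall>n::nat. f n \<in> \<gamma> \<and> f (Suc n) \<subset> f n"
    by (rule dependent_nat_choice) (use assms in \<open>auto simp: non_terminating_def\<close>)
  then show ?thesis using chain_boundary[OF assms(1)] by metis
qed

end

section \<open>Local finiteness\<close>

locale locally_finite_halfspace_system = halfspace_system V HS for V :: "'v set" and HS +
  assumes finite_adjacent: "x \<in> V \<Longrightarrow> finite (adjacent x)"
begin

text \<open>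
  The cardinality is the distance between \<open>x\<close> and \<open>v0\<close>, counted in separating hyperplanes, so this
  is finiteness of balls; each vertex is reached from one nearer to \<open>v0\<close> by crossing an adjacent
  hyperplane.
\<close>

lemma finite_ball:
  assumes "v0 \<in> V" shows "finite {x \<in> V. card {h \<in> HS. x \<in> h \<and> v0 \<notin> h} \<le> n}"
proof (induction n)
  case 0
  have "x = v0" if "x \<in> V" "card {h \<in> HS. x \<in> h \<and> v0 \<notin> h} \<le> 0" for x
    using separated[OF that(1) assms] finite_separating[OF that(1) assms] that(2) by auto
  then have "{x \<in> V. card {h \<in> HS. x \<in> h \<and> v0 \<notin> h} \<le> 0} \<subseteq> {v0}" by auto
  then show ?case using finite_subset by blast
next
  case (Suc n)
  let ?S = "{x \<in> V. card {h \<in> HS. x \<in> h \<and> v0 \<notin> h} \<le> n}"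
  let ?f = "\<lambda>(y, k). SOME x. step_out x (V - k) y"
  have "{x \<in> V. card {h \<in> HS. x \<in> h \<and> v0 \<notin> h} \<le> Suc n} \<subseteq> insert v0 (?f ` (SIGMA y:?S. adjacent y))"
  proof
    fix x assume x: "x \<in> {x \<in> V. card {h \<in> HS. x \<in> h \<and> v0 \<notin> h} \<le> Suc n}"
    show "x \<in> insert v0 (?f ` (SIGMA y:?S. adjacent y))"
    proof (cases "x = v0")
      case False
      then obtain h where h: "h \<in> HS" "x \<in> h" "v0 \<notin> h" using separated assms x by auto
      obtain m y where m: "step_out x m y" "m \<subseteq> h" using first_step_out[OF h(1,2)] .
      have mm: "m \<in> HS" "x \<in> m" "y \<notin> m" "y \<in> V" "v0 \<notin> m" using m h unfolding step_out_def by auto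
      have sb: "step_out y (V - m) x" using step_out_back m by auto
      have "x \<in> k" if "k \<in> HS" "y \<in> k" "v0 \<notin> k" for k
      proof (rule ccontr)
        assume "x \<notin> k"
        then have "k = V - m" using sb that unfolding step_out_def by auto
        then show False using that mm assms by auto
      qed
      then have "{k \<in> HS. y \<in> k \<and> v0 \<notin> k} \<subset> {k \<in> HS. x \<in> k \<and> v0 \<notin> k}" using mm by auto
      then have "card {k \<in> HS. y \<in> k \<and> v0 \<notin> k} < card {k \<in> HS. x \<in> k \<and> v0 \<notin> k}"
        using psubset_card_mono finite_separating x assms by auto
      then have yS: "y \<in> ?S" using x mm by auto
      have adj: "V - m \<in> adjacent y" using step_out_pc[OF sb] compl_halfspace[OF mm(1)]
        unfolding adjacent_def by auto
      have "?f (y, V - m) = x"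
        using compl_compl[OF mm(1)] step_out_unique[OF _ m(1)] someI[of "\<lambda>x. step_out x m y", OF m(1)] by auto
      then have "x \<in> ?f ` (SIGMA y:?S. adjacent y)"
        using yS adj by (intro image_eqI[of _ _ "(y, V - m)"]) auto
      then show ?thesis by auto
    qed auto
  qed
  moreover have "finite (insert v0 (?f ` (SIGMA y:?S. adjacent y)))"
    using Suc finite_adjacent by (intro finite.insertI finite_imageI finite_SigmaI) auto
  ultimately show ?case using finite_subset by blast
qed

lemma countable_halfspaces: "countable HS"
proof -
  obtain v0 where v0: "v0 \<in> V" using vertex_exists by auto
  have "V = (\<Union>n. {x \<in> V. card {h \<in> HS. x \<in> h \<and> v0 \<notin> h} \<le> n})" by auto
  moreover have "countable (\<Union>n. {x \<in> V. card {h \<in> HS. x \<in> h \<and> v0 \<notin> h} \<le> n})"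
    using finite_ball[OF v0] by (intro countable_UN) (auto intro: countable_finite)
  ultimately have "countable V" by simp
  moreover have "HS \<subseteq> (\<Union>x\<in>V. adjacent x)" using pc_exists unfolding adjacent_def by auto
  ultimately show ?thesis
    using finite_adjacent by (metis (no_types, lifting) countable_UN countable_finite countable_subset)
qed

lemma sector_adjacent:
  assumes "w \<in> V" shows "sector (adjacent w) = {w}"
proof -
  have "y = w" if "y \<in> sector (adjacent w)" for y
  proof (rule ccontr)
    assume "y \<noteq> w"
    have yV: "y \<in> V" using that sector_def by auto
    then obtain h where h: "h \<in> HS" "w \<in> h" "y \<notin> h" using separated assms \<open>y \<noteq> w\<close> by metis
    obtain n z where n: "step_out w n z" "n \<subseteq> h" using first_step_out[OF h(1,2)] .
    have "n \<in> adjacent w" using n step_out_pc unfolding adjacent_def step_out_def by auto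
    then show False using that n h unfolding sector_def by auto
  qed
  moreover have "w \<in> sector (adjacent w)" using assms pc_sub unfolding sector_def adjacent_def by auto
  ultimately show ?thesis by auto
qed

end

section \<open>Automorphisms and cocompactness\<close>

text \<open>
  The common pattern of all statements that a notion is preserved by an automorphism.
\<close>

lemma eq_image_if_mem_iff:
  assumes "\<And>x. x \<in> D \<Longrightarrow> g x \<in> A \<longleftrightarrow> x \<in> B" "A \<subseteq> g ` D" "B \<subseteq> D" shows "A = g ` B"
proof (intro set_eqI iffI)
  fix a assume "a \<in> A"
  then obtain x where "x \<in> D" "a = g x" using assms(2) by auto
  then show "a \<in> g ` B" using assms(1)[of x] \<open>a \<in> A\<close> by auto
next
  fix a assume "a \<in> g ` B"
  then show "a \<in> A" using assms(1,3) by auto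
qed

context halfspace_system
begin

definition automorphism :: "('v \<Rightarrow> 'v) \<Rightarrow> bool" where
  "automorphism g \<longleftrightarrow> bij_betw g V V \<and> (`) g ` HS = HS"

lemma automorphism_image: "automorphism g \<Longrightarrow> g ` V = V"
  unfolding automorphism_def bij_betw_def by auto

lemma automorphism_vertex: "automorphism g \<Longrightarrow> x \<in> V \<Longrightarrow> g x \<in> V"
  using automorphism_image by blast

lemma automorphism_inj: "automorphism g \<Longrightarrow> inj_on g V"
  unfolding automorphism_def bij_betw_def by auto

lemma automorphism_halfspace: "automorphism g \<Longrightarrow> h \<in> HS \<Longrightarrow> g ` h \<in> HS"
  unfolding automorphism_def by blast

lemma automorphism_preimage: "automorphism g \<Longrightarrow> k \<in> HS \<Longrightarrow> \<exists>h\<in>HS. k = g ` h"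
  unfolding automorphism_def by blast

lemma automorphism_mem: "automorphism g \<Longrightarrow> A \<subseteq> V \<Longrightarrow> x \<in> V \<Longrightarrow> g x \<in> g ` A \<longleftrightarrow> x \<in> A"
  using inj_on_image_mem_iff[OF automorphism_inj] by blast

lemma automorphism_subset:
  "automorphism g \<Longrightarrow> A \<subseteq> V \<Longrightarrow> B \<subseteq> V \<Longrightarrow> g ` A \<subseteq> g ` B \<longleftrightarrow> A \<subseteq> B"
  using inj_on_image_subset_iff[OF automorphism_inj] by blast

lemma automorphism_eq:
  "automorphism g \<Longrightarrow> A \<subseteq> V \<Longrightarrow> B \<subseteq> V \<Longrightarrow> g ` A = g ` B \<longleftrightarrow> A = B"
  using automorphism_subset[of g A B] automorphism_subset[of g B A] by auto

lemma automorphism_psubset: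
  "automorphism g \<Longrightarrow> A \<subseteq> V \<Longrightarrow> B \<subseteq> V \<Longrightarrow> g ` A \<subset> g ` B \<longleftrightarrow> A \<subset> B"
  using automorphism_subset[of g A B] automorphism_eq[of g A B] by (simp add: psubset_eq)

lemma automorphism_diff:
  "automorphism g \<Longrightarrow> A \<subseteq> V \<Longrightarrow> B \<subseteq> V \<Longrightarrow> g ` (A - B) = g ` A - g ` B"
  using inj_on_image_set_diff[OF automorphism_inj] by blast

lemma automorphism_compl: "automorphism g \<Longrightarrow> A \<subseteq> V \<Longrightarrow> g ` (V - A) = V - g ` A"
  using automorphism_diff[of g V A] automorphism_image by auto

lemma automorphism_int:
  "automorphism g \<Longrightarrow> A \<subseteq> V \<Longrightarrow> B \<subseteq> V \<Longrightarrow> g ` (A \<inter> B) = g ` A \<inter> g ` B"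
  using inj_on_image_Int[OF automorphism_inj] by blast

lemma automorphism_inverse:
  assumes "automorphism g" shows "automorphism (inv_into V g)"
proof -
  let ?f = "inv_into V g"
  have b: "bij_betw ?f V V" using assms bij_betw_inv_into unfolding automorphism_def by blast
  have i: "?f ` (g ` h) = h" if "h \<in> HS" for h
    using inv_into_image_cancel[OF automorphism_inj[OF assms] halfspace_sub[OF that]] .
  have "(`) ?f ` HS = (`) ?f ` ((`) g ` HS)" using assms unfolding automorphism_def by simp
  also have "\<dots> = (\<lambda>h. h) ` HS" unfolding image_image by (rule image_cong) (use i in \<open>auto simp: image_image\<close>)
  finally show ?thesis using b unfolding automorphism_def by simp
qed

lemma automorphism_pc:
  assumes "automorphism g" "h \<in> HS" shows "pc (g ` h) = g ` pc h"
proof -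
  have hV: "h \<subseteq> V" using halfspace_sub assms by auto
  have "g x \<in> pc (g ` h) \<longleftrightarrow> x \<in> pc h" if x: "x \<in> V" for x
  proof -
    have "(\<forall>q\<in>HS. g x \<in> q \<and> q \<subseteq> g ` h \<longrightarrow> q = g ` h) \<longleftrightarrow> (\<forall>q\<in>HS. x \<in> q \<and> q \<subseteq> h \<longrightarrow> q = h)"
    proof
      assume a: "\<forall>q\<in>HS. g x \<in> q \<and> q \<subseteq> g ` h \<longrightarrow> q = g ` h"
      show "\<forall>q\<in>HS. x \<in> q \<and> q \<subseteq> h \<longrightarrow> q = h"
      proof (intro ballI impI)
        fix q assume q: "q \<in> HS" "x \<in> q \<and> q \<subseteq> h"
        have "g x \<in> g ` q" "g ` q \<subseteq> g ` h" using q by auto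
        then have "g ` q = g ` h" using a[rule_format, OF automorphism_halfspace[OF assms(1) q(1)]] by simp
        then show "q = h" using automorphism_eq[OF assms(1) halfspace_sub[OF q(1)] hV] by simp
      qed
    next
      assume a: "\<forall>q\<in>HS. x \<in> q \<and> q \<subseteq> h \<longrightarrow> q = h"
      show "\<forall>q\<in>HS. g x \<in> q \<and> q \<subseteq> g ` h \<longrightarrow> q = g ` h"
      proof (intro ballI impI)
        fix q assume q: "q \<in> HS" "g x \<in> q \<and> q \<subseteq> g ` h"
        obtain p where p: "p \<in> HS" "q = g ` p" using automorphism_preimage[OF assms(1) q(1)] by auto
        then have "x \<in> p" "p \<subseteq> h"
          using q automorphism_mem[OF assms(1) halfspace_sub[OF p(1)] x]
            automorphism_subset[OF assms(1) halfspace_sub[OF p(1)] hV] by auto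
        then show "q = g ` h" using a p by auto
      qed
    qed
    then show ?thesis using automorphism_mem[OF assms(1) hV x] unfolding pc_def by simp
  qed
  moreover have "pc (g ` h) \<subseteq> g ` V" "pc h \<subseteq> V"
    using pc_sub[of h] pc_sub[of "g ` h"] hV by blast+
  ultimately show ?thesis by (rule eq_image_if_mem_iff)
qed

lemma automorphism_adjacent:
  assumes "automorphism g" "x \<in> V" shows "adjacent (g x) = (`) g ` adjacent x"
proof -
  have "g ` h \<in> adjacent (g x) \<longleftrightarrow> h \<in> adjacent x" if "h \<in> HS" for h
  proof -
    have "pc h \<subseteq> V" using pc_sub[of h] halfspace_sub[OF that] by auto
    then show ?thesis
      using automorphism_mem[OF assms(1) _ assms(2), of "pc h"] automorphism_pc[OF assms(1) that]
        automorphism_halfspace[OF assms(1) that] that unfolding adjacent_def by auto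
  qed
  moreover have "adjacent (g x) \<subseteq> (`) g ` HS" "adjacent x \<subseteq> HS"
    using assms(1) unfolding adjacent_def automorphism_def by auto
  ultimately show ?thesis by (rule eq_image_if_mem_iff)
qed

lemma automorphism_transverse:
  assumes "automorphism g" "h \<in> HS" "k \<in> HS"
  shows "transverse (g ` h) (g ` k) \<longleftrightarrow> transverse h k"
proof -
  have s: "h \<subseteq> V" "k \<subseteq> V" "V - h \<subseteq> V" using halfspace_sub assms by auto
  have "V - g ` h - g ` k = g ` (V - h - k)"
    using automorphism_diff[OF assms(1) s(3,2)] automorphism_compl[OF assms(1) s(1)] by simp
  moreover have "g ` h - g ` k = g ` (h - k)" "g ` k - g ` h = g ` (k - h)" "g ` h \<inter> g ` k = g ` (h \<inter> k)"
    using automorphism_diff[OF assms(1)] automorphism_int[OF assms(1)] s by auto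
  ultimately show ?thesis unfolding transverse_def by simp
qed

lemma automorphism_corner:
  assumes "automorphism g" "K \<subseteq> HS" shows "corner ((`) g ` K) = g ` corner K"
proof -
  have "g x \<in> corner ((`) g ` K) \<longleftrightarrow> x \<in> corner K" if x: "x \<in> V" for x
  proof -
    have "g x \<in> pc (g ` k) \<longleftrightarrow> x \<in> pc k" if "k \<in> K" for k
    proof -
      have k: "k \<in> HS" using assms(2) that by auto
      have "pc k \<subseteq> V" using pc_sub[of k] halfspace_sub[OF k] by auto
      from automorphism_mem[OF assms(1) this x] show ?thesis using automorphism_pc[OF assms(1) k] by simp
    qed
    then show ?thesis using x automorphism_vertex[OF assms(1)] unfolding corner_def by auto
  qed
  moreover have "corner ((`) g ` K) \<subseteq> g ` V" "corner K \<subseteq> V"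
    using automorphism_image[OF assms(1)] unfolding corner_def by auto
  ultimately show ?thesis by (rule eq_image_if_mem_iff)
qed

lemma automorphism_sector:
  assumes "automorphism g" "K \<subseteq> HS" shows "sector ((`) g ` K) = g ` sector K"
proof -
  have "g x \<in> sector ((`) g ` K) \<longleftrightarrow> x \<in> sector K" if x: "x \<in> V" for x
  proof -
    have "g x \<in> g ` k \<longleftrightarrow> x \<in> k" if "k \<in> K" for k
      using automorphism_mem[OF assms(1) halfspace_sub x, of k] assms(2) that by auto
    then show ?thesis using x automorphism_vertex[OF assms(1)] unfolding sector_def by auto
  qed
  moreover have "sector ((`) g ` K) \<subseteq> g ` V" "sector K \<subseteq> V"
    using automorphism_image[OF assms(1)] unfolding sector_def by auto
  ultimately show ?thesis by (rule eq_image_if_mem_iff)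
qed

text \<open>
  The number of hyperplanes between \<open>y\<close> and \<open>m\<close>, that of \<open>m\<close> included; hence it is positive when
  \<open>y\<close> is outside \<open>m\<close>.
\<close>

definition halfspace_distance :: "'v \<Rightarrow> 'v set \<Rightarrow> nat" where
  "halfspace_distance y m = card {n \<in> HS. y \<notin> n \<and> m \<subseteq> n}"

definition near :: "nat \<Rightarrow> 'v \<Rightarrow> 'v set set" where
  "near r y = {m \<in> HS. y \<notin> m \<and> halfspace_distance y m \<le> r}"

lemma automorphism_halfspace_distance:
  assumes "automorphism g" "y \<in> V" "m \<in> HS"
  shows "halfspace_distance (g y) (g ` m) = halfspace_distance y m"
proof -
  have "{n \<in> HS. g y \<notin> n \<and> g ` m \<subseteq> n} = (`) g ` {n \<in> HS. y \<notin> n \<and> m \<subseteq> n}"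
  proof -
    have "g y \<notin> g ` n \<and> g ` m \<subseteq> g ` n \<longleftrightarrow> y \<notin> n \<and> m \<subseteq> n" if "n \<in> HS" for n
      using automorphism_mem[OF assms(1) halfspace_sub[OF that] assms(2)]
        automorphism_subset[OF assms(1) halfspace_sub[OF assms(3)] halfspace_sub[OF that]] by auto
    then show ?thesis
      using assms(1) automorphism_halfspace[OF assms(1)] unfolding automorphism_def
      by (intro eq_image_if_mem_iff[of HS]) auto
  qed
  moreover have "inj_on ((`) g) {n \<in> HS. y \<notin> n \<and> m \<subseteq> n}"
    by (rule inj_onI) (use automorphism_eq[OF assms(1)] halfspace_sub in auto)
  ultimately show ?thesis unfolding halfspace_distance_def by (simp add: card_image)
qed

lemma automorphism_near:
  assumes "automorphism g" "y \<in> V" shows "near r (g y) = (`) g ` near r y"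
proof -
  have "g ` m \<in> near r (g y) \<longleftrightarrow> m \<in> near r y" if "m \<in> HS" for m
    using automorphism_halfspace_distance[OF assms that] that automorphism_halfspace[OF assms(1) that]
      automorphism_mem[OF assms(1) halfspace_sub[OF that] assms(2)] unfolding near_def by simp
  moreover have "near r (g y) \<subseteq> (`) g ` HS" "near r y \<subseteq> HS"
    using assms(1) unfolding near_def automorphism_def by auto
  ultimately show ?thesis by (rule eq_image_if_mem_iff)
qed

text \<open>
  If \<open>q\<close> meets both \<open>m\<close> and its complement, walking towards \<open>q\<close> neither enters \<open>m\<close> nor leaves a
  halfspace containing \<open>m\<close>.
\<close>

lemma toward_halfspace_distance:
  assumes "toward q y y'" "y \<in> V" "m \<in> HS" "y \<notin> m" "q \<inter> m \<noteq> {}" "q - m \<noteq> {}" "q \<subseteq> V"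
  shows "y' \<notin> m" "halfspace_distance y' m \<le> halfspace_distance y m"
proof -
  show "y' \<notin> m"
  proof -
    have "q \<inter> (V - m) \<noteq> {}" using assms(6,7) by auto
    then show ?thesis
      using toward_stay[OF assms(1) compl_halfspace[OF assms(3)]] assms(2,4) by auto
  qed
  have "y \<notin> n" if "n \<in> HS" "y' \<notin> n" "m \<subseteq> n" for n
    using toward_stay[OF assms(1) that(1)] that assms(5) by auto
  then show "halfspace_distance y' m \<le> halfspace_distance y m"
    unfolding halfspace_distance_def
    by (intro card_mono) (use finite_above[OF assms(3,2)] in \<open>auto elim!: rev_finite_subset\<close>)
qed

end

context locally_finite_halfspace_system
begin

text \<open>
  A halfspace \<open>m\<close> at distance at most \<open>Suc r\<close> from \<open>y\<close> is either bounded by a hyperplane adjacent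
  to \<open>y\<close> or at distance at most \<open>r\<close> from one of the finitely many neighbours of \<open>y\<close>.
\<close>

lemma finite_near: "y \<in> V \<Longrightarrow> finite (near r y)"
proof (induction r arbitrary: y)
  case 0
  have "halfspace_distance y m > 0" if "m \<in> HS" "y \<notin> m" for m
  proof -
    have "finite {n \<in> HS. y \<notin> n \<and> m \<subseteq> n}"
      by (rule rev_finite_subset[OF finite_above[OF that(1) 0]]) auto
    then show ?thesis using that unfolding halfspace_distance_def by (auto simp: card_gt_0_iff)
  qed
  then have "near 0 y = {}" unfolding near_def by fastforce
  then show ?case by simp
next
  case (Suc r)
  let ?f = "\<lambda>k. SOME z. step_out y k z"
  have "near (Suc r) y \<subseteq> (\<lambda>k. V - k) ` adjacent y \<union> (\<Union>k\<in>adjacent y. near r (?f k))"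
  proof
    fix m assume m: "m \<in> near (Suc r) y"
    have mHS: "m \<in> HS" "y \<notin> m" "halfspace_distance y m \<le> Suc r" using m unfolding near_def by auto
    obtain n' z where s: "step_out y n' z" "n' \<subseteq> V - m"
      by (rule first_step_out[OF compl_halfspace[OF mHS(1)], of y]) (use mHS(2) Suc.prems in auto)
    have n'HS: "n' \<in> HS" and adj: "n' \<in> adjacent y"
      using s step_out_pc unfolding step_out_def adjacent_def by auto
    define n where "n = V - n'"
    have nHS: "n \<in> HS" and n'n: "n' = V - n" using compl_halfspace[OF n'HS] compl_compl[OF n'HS] n_def by auto
    have mn: "m \<subseteq> n" using s halfspace_sub[OF mHS(1)] n_def by auto
    have fz: "?f n' = z"
    proof -
      have "step_out y n' (?f n')" using s someI by metis
      from step_out_unique[OF step_out_back[OF this] step_out_back[OF s(1)]] show ?thesis .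
    qed
    have zV: "z \<in> V" "z \<in> n" "y \<notin> n" using s unfolding n_def step_out_def by auto
    show "m \<in> (\<lambda>k. V - k) ` adjacent y \<union> (\<Union>k\<in>adjacent y. near r (?f k))"
    proof (cases "n = m")
      case True then show ?thesis using adj n_def by auto
    next
      case False
      have sb: "step_out z n y" using step_out_back[OF s(1)] n_def by simp
      have "z \<notin> m" using sb mHS False unfolding step_out_def by auto
      have tow: "toward m y z" using toward.move[OF toward.stay _ nHS mn, of y z] s n'n by simp
      have "y \<notin> k" if "k \<in> HS" "z \<notin> k" "m \<subseteq> k" for k
        using toward_stay[OF tow that(1)] that halfspace_nonempty[OF mHS(1)] by auto
      then have "{k \<in> HS. z \<notin> k \<and> m \<subseteq> k} \<subset> {k \<in> HS. y \<notin> k \<and> m \<subseteq> k}"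
        using zV nHS mn by auto
      moreover have "finite {k \<in> HS. y \<notin> k \<and> m \<subseteq> k}"
        by (rule rev_finite_subset[OF finite_above[OF mHS(1) Suc.prems]]) auto
      ultimately have "halfspace_distance z m < halfspace_distance y m"
        unfolding halfspace_distance_def by (rule psubset_card_mono[rotated])
      then have "m \<in> near r z" using mHS \<open>z \<notin> m\<close> unfolding near_def by auto
      then show ?thesis using fz adj by auto
    qed
  qed
  moreover have "finite ((\<lambda>k. V - k) ` adjacent y \<union> (\<Union>k\<in>adjacent y. near r (?f k)))"
  proof (intro finite_UnI finite_imageI finite_UN_I)
    fix k assume "k \<in> adjacent y"
    then obtain z where "step_out y k z" using pc_step_out[of k y] unfolding adjacent_def by auto
    then have "step_out y k (?f k)" by (rule someI)
    then have "?f k \<in> V" unfolding step_out_def by auto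
    then show "finite (near r (?f k))" by (rule Suc.IH)
  qed (use finite_adjacent Suc in auto)
  ultimately show ?case using finite_subset by blast
qed

end

locale cocompact_halfspace_system = locally_finite_halfspace_system V HS for V :: "'v set" and HS +
  assumes cocompact: "\<exists>V0. finite V0 \<and> V0 \<subseteq> V \<and> (\<forall>x\<in>V. \<exists>g. automorphism g \<and> g x \<in> V0)"
begin

lemma bounded_if_invariant:
  fixes f :: "'v \<Rightarrow> nat"
  assumes "\<And>g x. automorphism g \<Longrightarrow> x \<in> V \<Longrightarrow> f (g x) = f x"
  shows "\<exists>b. \<forall>x\<in>V. f x \<le> b"
proof -
  obtain V0 where V0: "finite V0" "\<forall>x\<in>V. \<exists>g. automorphism g \<and> g x \<in> V0" using cocompact by auto
  have "f x \<le> Max (f ` V0)" if x: "x \<in> V" for x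
  proof -
    obtain g where "automorphism g" "g x \<in> V0" using V0 x by auto
    then show ?thesis using assms[of g x] x V0(1) by (metis Max_ge finite_imageI imageI)
  qed
  then show ?thesis by auto
qed

lemma card_automorphism_image:
  assumes "automorphism g" "S \<subseteq> HS" shows "card ((`) g ` S) = card S"
proof (rule card_image, rule inj_onI)
  fix A B assume "A \<in> S" "B \<in> S" "g ` A = g ` B"
  then show "A = B" using automorphism_eq[OF assms(1)] halfspace_sub assms(2) by blast
qed

lemma bounded_valence: "\<exists>b. \<forall>x\<in>V. card (adjacent x) \<le> b"
proof (rule bounded_if_invariant[of "\<lambda>x. card (adjacent x)"])
  fix g x assume "automorphism g" "x \<in> V"
  then show "card (adjacent (g x)) = card (adjacent x)"
    using card_automorphism_image[of g "adjacent x"] automorphism_adjacent[of g x]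
    unfolding adjacent_def by auto
qed

lemma bounded_near: "\<exists>b. \<forall>x\<in>V. card (near r x) \<le> b"
proof (rule bounded_if_invariant[of "\<lambda>x. card (near r x)"])
  fix g x assume "automorphism g" "x \<in> V"
  then show "card (near r (g x)) = card (near r x)"
    using card_automorphism_image[of g "near r x"] automorphism_near[of g x]
    unfolding near_def by auto
qed

text \<open>
  Members of \<open>S\<close> are adjacent to any vertex of the corner, and valences are bounded. This bounds
  the dimension.
\<close>

lemma corner_card:
  obtains b where "\<And>S. S \<subseteq> HS \<Longrightarrow> corner S \<noteq> {} \<Longrightarrow> finite S \<and> card S \<le> b"
proof -
  obtain b where b: "\<And>x. x \<in> V \<Longrightarrow> card (adjacent x) \<le> b" using bounded_valence by auto
  have "finite S \<and> card S \<le> b" if S: "S \<subseteq> HS" "corner S \<noteq> {}" for S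
  proof -
    obtain x where x: "x \<in> V" "S \<subseteq> adjacent x" using S unfolding corner_def adjacent_def by auto
    have f: "finite (adjacent x)" using finite_adjacent[OF x(1)] .
    show ?thesis using card_mono[OF f x(2)] finite_subset[OF x(2) f] b[OF x(1)] by simp
  qed
  then show ?thesis using that by blast
qed

text \<open>
  Infinitely many members of \<open>\<alpha>\<close> avoid a fixed vertex \<open>v\<close>, as otherwise \<open>uf_move\<close> would reach a
  vertex inducing \<open>\<alpha>\<close>. By Ramsey's theorem infinitely many of them cross pairwise or infinitely
  many are pairwise nested. The former is excluded because corners have bounded size, and the
  latter gives a descending chain, since only finitely many halfspaces lie between a given one and
  \<open>v\<close>.
\<close>

lemma nonprincipal_boundary:
  assumes "\<alpha> \<in> UF" "\<And>w. w \<in> V \<Longrightarrow> \<alpha> \<noteq> vertex_uf w"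
  shows "\<alpha> \<in> boundary"
proof -
  obtain v where v: "v \<in> V" using vertex_exists by auto
  define D where "D = {m \<in> \<alpha>. v \<notin> m}"
  have DHS: "D \<subseteq> HS" using uf_sub[OF assms(1)] D_def by auto
  have infD: "infinite D"
  proof
    assume fin: "finite D"
    obtain w where w: "w \<in> sector D" "\<forall>m\<in>HS. w \<in> m \<and> v \<notin> m \<longrightarrow> m \<in> \<alpha>"
      by (rule uf_move[OF assms(1) _ fin v]) (auto simp: D_def)
    have wV: "w \<in> V" using w sector_def by auto
    have in1: "w \<in> m" if "m \<in> \<alpha>" for m
    proof (cases "v \<in> m")
      case False then show ?thesis using that w unfolding D_def sector_def by auto
    next
      case True
      have mHS: "m \<in> HS" using that uf_sub assms by auto
      show ?thesis
      proof (rule ccontr)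
        assume "w \<notin> m"
        then have "V - m \<in> \<alpha>" using w(2) compl_halfspace[OF mHS] wV True by auto
        then show False using uf_compl[OF assms(1) mHS] that by auto
      qed
    qed
    have "m \<in> \<alpha>" if "m \<in> HS" "w \<in> m" for m
    proof (rule ccontr)
      assume "m \<notin> \<alpha>"
      then have "V - m \<in> \<alpha>" using uf_compl[OF assms(1) that(1)] by simp
      then show False using in1 that by auto
    qed
    then have "\<alpha> = vertex_uf w" using in1 uf_sub[OF assms(1)] unfolding vertex_uf_def by auto
    then show False using assms(2) wV by auto
  qed
  \<comment> \<open>colour a pair of halfspaces by whether they cross\<close>
  define f where "f P = (if \<exists>a b. P = {a, b} \<and> transverse a b then 0 else 1::nat)" for P :: "'v set set"
  have "\<forall>x\<in>D. \<forall>y\<in>D. x \<noteq> y \<longrightarrow> f {x, y} < 2" unfolding f_def by auto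
  then obtain Y t where Y: "Y \<subseteq> D" "infinite Y" "\<forall>x\<in>Y. \<forall>y\<in>Y. x \<noteq> y \<longrightarrow> f {x, y} = t"
    using Ramsey2[OF infD, of f 2] by auto
  have "t \<noteq> 0"
  proof
    assume "t = 0"
    then have tr: "transverse a b" if "a \<in> Y" "b \<in> Y" "a \<noteq> b" for a b
    proof -
      have "f {a, b} = 0" using Y(3) that \<open>t = 0\<close> by auto
      then show ?thesis unfolding f_def by (auto simp: doubleton_eq_iff transverse_sym split: if_splits)
    qed
    obtain c where c: "\<And>S. S \<subseteq> HS \<Longrightarrow> corner S \<noteq> {} \<Longrightarrow> finite S \<and> card S \<le> c"
      using corner_card by metis
    obtain S where S: "S \<subseteq> Y" "finite S" "card S = Suc c" using infinite_arbitrarily_large Y(2) by blast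
    have pw: "pairwise transverse S" by (rule pairwiseI) (rule tr, use S in auto)
    have SHS: "S \<subseteq> HS" using S Y DHS by auto
    have "corner S \<noteq> {}" by (rule corner_pairwise_transverse[OF S(2) SHS pw])
    then show False using c[OF SHS] S by auto
  qed
  have comp: "a \<subseteq> b \<or> b \<subseteq> a" if "a \<in> Y" "b \<in> Y" for a b
  proof (rule ccontr)
    assume n: "\<not> ?thesis"
    then have "a \<noteq> b" by auto
    then have "f {a, b} \<noteq> 0" using Y(3) that \<open>t \<noteq> 0\<close> by auto
    then have "\<not> transverse a b" unfolding f_def by (metis (full_types))
    moreover have "v \<in> V - a - b" using that Y v unfolding D_def by auto
    moreover have "a \<inter> b \<noteq> {}" using uf_meet[OF assms(1)] that Y unfolding D_def by auto
    ultimately show False using n unfolding transverse_def by auto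
  qed
  have "\<exists>y\<in>Y. y \<subset> x" if x: "x \<in> Y" for x
  proof -
    have xHS: "x \<in> HS" using x Y DHS by auto
    have "{y \<in> Y. x \<subseteq> y} \<subseteq> {n \<in> HS. x \<subseteq> n \<and> v \<notin> n}" using Y DHS unfolding D_def by auto
    then have "finite {y \<in> Y. x \<subseteq> y}" using finite_above[OF xHS v] finite_subset by blast
    then have ne: "{y \<in> Y. x \<subseteq> y} \<noteq> Y" using Y(2) by auto
    have "\<exists>y\<in>Y. \<not> x \<subseteq> y"
    proof (rule ccontr)
      assume "\<not> ?thesis"
      then have "{y \<in> Y. x \<subseteq> y} = Y" by blast
      then show False using ne by simp
    qed
    then obtain y where y: "y \<in> Y" "\<not> x \<subseteq> y" by (elim bexE)
    have "y \<subseteq> x" using comp[OF x y(1)] y(2) by simp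
    then show ?thesis using y by (intro bexI[of _ y]) auto
  qed
  note smaller = this
  have "\<exists>s. \<forall>n::nat. s n \<in> Y \<and> s (Suc n) \<subset> s n"
  proof (rule dependent_nat_choice)
    show "\<exists>x. x \<in> Y" using infinite_imp_nonempty[OF Y(2)] by auto
    show "\<exists>y. y \<in> Y \<and> y \<subset> x" if "x \<in> Y" for x using smaller[OF that] by (auto simp only: Bex_def)
  qed
  then obtain s where s: "\<forall>n::nat. s n \<in> Y \<and> s (Suc n) \<subset> s n" by (elim exE)
  show ?thesis
    by (rule chain_boundary[OF assms(1), of s]) (use s Y in \<open>auto simp: D_def\<close>)
qed

text \<open>
  Compactness: as there are countably many halfspaces, they can be decided one after another so
  that infinitely many points of \<open>Z\<close> remain at each stage. An ultrafilter arising in this way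
  cannot come from a vertex, because the sector of its adjacent halfspaces is a single vertex.
\<close>

lemma accumulation:
  assumes "Z \<subseteq> V" "infinite Z"
  obtains \<beta> where "\<beta> \<in> boundary" "\<And>M. finite M \<Longrightarrow> M \<subseteq> \<beta> \<Longrightarrow> infinite (Z \<inter> sector M)"
proof -
  obtain v where v: "v \<in> Z" using assms by (metis finite.emptyI ex_in_conv)
  obtain v' where v': "v' \<in> Z" "v' \<noteq> v" using assms
    by (metis finite.emptyI finite_insert infinite_imp_nonempty insertI1 insert_Diff_single infinite_remove ex_in_conv Diff_iff)
  have HS0: "HS \<noteq> {}" using separated[of v v'] v v' assms by auto
  define e where "e = from_nat_into HS"
  have e: "range e = HS" unfolding e_def using range_from_nat_into[OF HS0 countable_halfspaces] .
  \<comment> \<open>\<open>Y n\<close>: the points left after deciding the first \<open>n\<close> halfspaces, preferring \<open>e n\<close> to its complement\<close>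
  define Y where "Y = rec_nat Z (\<lambda>n A. if infinite (A \<inter> e n) then A \<inter> e n else A - e n)"
  have Y0: "Y 0 = Z" and YS: "Y (Suc n) = (if infinite (Y n \<inter> e n) then Y n \<inter> e n else Y n - e n)" for n
    unfolding Y_def by auto
  have inf: "infinite (Y n)" for n
  proof (induction n)
    case (Suc n)
    have "Y n = (Y n \<inter> e n) \<union> (Y n - e n)" by auto
    then show ?case using Suc YS by (metis finite_UnI)
  qed (use assms Y0 in auto)
  have dec: "decseq Y" by (rule decseq_SucI) (auto simp: YS)
  then have decD: "n \<ge> m \<Longrightarrow> Y n \<subseteq> Y m" for m n unfolding decseq_def by auto
  have YZ: "Y n \<subseteq> Z" for n using decD[of 0 n] Y0 by auto
  define \<beta> where "\<beta> = {h \<in> HS. \<exists>n. Y n \<subseteq> h}"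
  have "(h \<in> \<beta>) \<noteq> (V - h \<in> \<beta>)" if h: "h \<in> HS" for h
  proof -
    obtain n where n: "h = e n" using e h by auto
    have "h \<in> \<beta> \<or> V - h \<in> \<beta>"
    proof (cases "infinite (Y n \<inter> e n)")
      case True
      then have "Y (Suc n) \<subseteq> h" using YS n by auto
      then show ?thesis using h \<beta>_def by auto
    next
      case False
      then have "Y (Suc n) \<subseteq> V - h" using YS n YZ[of n] assms(1) by auto
      then show ?thesis using compl_halfspace[OF h] \<beta>_def by auto
    qed
    moreover have "\<not> (h \<in> \<beta> \<and> V - h \<in> \<beta>)"
    proof
      assume "h \<in> \<beta> \<and> V - h \<in> \<beta>"
      then obtain i j where ij: "Y i \<subseteq> h" "Y j \<subseteq> V - h" unfolding \<beta>_def by auto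
      have "Y (max i j) \<subseteq> Y i" "Y (max i j) \<subseteq> Y j" by (auto intro!: decD)
      then have "Y (max i j) = {}" using ij by auto
      then show False using inf[of "max i j"] by auto
    qed
    ultimately show ?thesis by auto
  qed
  moreover have "k \<in> \<beta>" if "h \<in> \<beta>" "k \<in> HS" "h \<subseteq> k" for h k
    using that unfolding \<beta>_def by auto
  ultimately have uf: "\<beta> \<in> UF" unfolding UF_def by (auto simp: \<beta>_def)
  have acc: "infinite (Z \<inter> sector M)" if M: "finite M" "M \<subseteq> \<beta>" for M
  proof -
    have "\<exists>n. \<forall>m\<in>M. Y n \<subseteq> m" using M
    proof (induction M rule: finite_induct)
      case (insert m M)
      then obtain n where n: "\<forall>m\<in>M. Y n \<subseteq> m" by auto
      obtain k where k: "Y k \<subseteq> m" using insert \<beta>_def by auto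
      have "\<forall>m'\<in>insert m M. Y (max n k) \<subseteq> m'"
        using n k decD[of n "max n k"] decD[of k "max n k"] by auto
      then show ?case by blast
    qed auto
    then obtain n where "\<forall>m\<in>M. Y n \<subseteq> m" by auto
    then have "Y n \<subseteq> Z \<inter> sector M" using YZ[of n] assms(1) unfolding sector_def by auto
    then show ?thesis using inf[of n] finite_subset by blast
  qed
  have "\<beta> \<in> boundary"
  proof (rule nonprincipal_boundary[OF uf])
    fix w assume w: "w \<in> V"
    show "\<beta> \<noteq> vertex_uf w"
    proof
      assume b: "\<beta> = vertex_uf w"
      have "adjacent w \<subseteq> \<beta>" unfolding b vertex_uf_def adjacent_def using pc_sub by auto
      then have "infinite (Z \<inter> sector (adjacent w))" using acc finite_adjacent[OF w] by auto
      then show False using sector_adjacent[OF w] by (simp add: finite_subset)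
    qed
  qed
  then show ?thesis using that acc by blast
qed

lemma accumulation_mem:
  assumes "\<beta> \<in> UF" "\<And>M. finite M \<Longrightarrow> M \<subseteq> \<beta> \<Longrightarrow> infinite (Z \<inter> sector M)" "h \<in> HS" "Z \<subseteq> h"
  shows "h \<in> \<beta>"
proof (rule ccontr)
  assume "h \<notin> \<beta>"
  then have "{V - h} \<subseteq> \<beta>" using uf_compl[OF assms(1,3)] by simp
  then have "infinite (Z \<inter> sector {V - h})" using assms(2)[of "{V - h}"] by simp
  moreover have "Z \<inter> sector {V - h} = {}" using assms(4) unfolding sector_def by auto
  ultimately show False by auto
qed

text \<open>
  Accumulation inside the positive carrier of \<open>k\<close> makes \<open>k\<close> a minimal element of the ultrafilter.
\<close>

lemma accumulation_minimal:
  assumes "\<And>M. finite M \<Longrightarrow> M \<subseteq> \<beta> \<Longrightarrow> infinite (Z \<inter> sector M)" "q \<in> HS" "Z \<subseteq> pc k" "q \<subset> k"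
  shows "q \<notin> \<beta>"
proof
  assume "q \<in> \<beta>"
  then have "infinite (Z \<inter> sector {q})" using assms(1)[of "{q}"] by simp
  moreover have "Z \<inter> sector {q} = {}"
    using not_in_smaller[OF subsetD[OF assms(3)] assms(2,4)] unfolding sector_def by auto
  ultimately show False by auto
qed

end

section \<open>Bad families of least size\<close>

context halfspace_system
begin

text \<open>
  What violates the caging condition: if a boundary ultrafilter contains a cage \<open>K\<close> with no
  hyperplane inside it, then \<open>K\<close> is bad. Badness no longer mentions the ultrafilter, which allows
  one to choose bad families of least size.
\<close>

definition bad :: "'v set set \<Rightarrow> bool" where
  "bad K \<longleftrightarrow> K \<subseteq> HS \<and> corner K \<noteq> {} \<and> infinite (sector K) \<and> \<not> (\<exists>q\<in>HS. \<forall>k\<in>K. q \<subset> k)"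

lemma bad_no_common_below:
  assumes "bad K" "q \<in> HS" "\<And>k. k \<in> K \<Longrightarrow> q \<subset> k" shows False
  using assms unfolding bad_def by metis

lemma badI:
  assumes "K \<subseteq> HS" "corner K \<noteq> {}" "infinite (sector K)"
    "\<And>q. q \<in> HS \<Longrightarrow> (\<And>k. k \<in> K \<Longrightarrow> q \<subset> k) \<Longrightarrow> False"
  shows "bad K"
  using assms unfolding bad_def by metis

lemma bad_halfspaces: "bad K \<Longrightarrow> K \<subseteq> HS"
  unfolding bad_def by simp

lemma not_transverse_self: "\<not> transverse h h"
  unfolding transverse_def by auto

lemma sector_singleton: "h \<in> HS \<Longrightarrow> sector {h} = h"
  using halfspace_sub unfolding sector_def by auto

lemma corner_sub: "corner S \<subseteq> V" "s \<in> S \<Longrightarrow> corner S \<subseteq> pc s" "S' \<subseteq> S \<Longrightarrow> corner S \<subseteq> corner S'"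
  unfolding corner_def by auto

text \<open>
  Only finitely many halfspaces lie between \<open>q0\<close> and \<open>k\<close>.
\<close>

lemma max_below:
  assumes "\<gamma> \<in> UF" "k \<in> HS" "q0 \<in> \<gamma>" "q0 \<subset> k"
  obtains q where "q \<in> \<gamma>" "q \<subset> k" "q0 \<subseteq> q" "\<not> (\<exists>m\<in>HS. q \<subset> m \<and> m \<subset> k)"
proof -
  define A where "A = {m \<in> HS. q0 \<subseteq> m \<and> m \<subset> k}"
  have q0: "q0 \<in> HS" using uf_sub assms by auto
  obtain w where w: "w \<in> V" "w \<notin> k" using outside_exists[OF assms(2)] by auto
  have "A \<subseteq> {n \<in> HS. q0 \<subseteq> n \<and> w \<notin> n}" using w unfolding A_def by auto
  then have "finite A" using finite_above[OF q0 w(1)] finite_subset by auto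
  moreover have "q0 \<in> A" using q0 assms unfolding A_def by auto
  ultimately obtain q where q: "q \<in> A" "q0 \<subseteq> q" "\<forall>b\<in>A. q \<subseteq> b \<longrightarrow> q = b"
    using finite_has_maximal2[of A q0] by auto
  have "\<not> (\<exists>m\<in>HS. q \<subset> m \<and> m \<subset> k)"
  proof
    assume "\<exists>m\<in>HS. q \<subset> m \<and> m \<subset> k"
    then obtain m where m: "m \<in> HS" "q \<subset> m" "m \<subset> k" by auto
    then have "m \<in> A" using q unfolding A_def by auto
    then show False using q(3) m(2) by auto
  qed
  moreover have "q \<in> \<gamma>" using uf_up[OF assms(1,3)] q unfolding A_def by auto
  ultimately show ?thesis using that q unfolding A_def by auto
qed

end

context cocompact_halfspace_system
begin

text \<open>
  Let \<open>\<beta>\<close> be an accumulation point of the corner of \<open>S\<close> and \<open>s n\<close> a descending chain in \<open>\<beta>\<close>.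
  Eventually \<open>s n\<close> excludes a given vertex of the corner and so crosses all members of \<open>S\<close>, and it
  contains infinitely many vertices of the corner. If all but finitely many were in \<open>s n\<close> for all
  \<open>n\<close>, the number of those left out would tend to infinity. But it takes finitely many values
  only: by cocompactness the pair of \<open>S\<close> and \<open>s n\<close>, both adjacent to a common vertex, has finitely
  many positions up to automorphisms.
\<close>

lemma two_sided:
  assumes "S \<subseteq> HS" "infinite (corner S)"
  obtains h where "h \<in> HS" "\<And>t. t \<in> S \<Longrightarrow> transverse h t"
    "infinite (corner S \<inter> h)" "infinite (corner S - h)"
proof -
  obtain \<beta> where \<beta>: "\<beta> \<in> boundary" "\<And>M. finite M \<Longrightarrow> M \<subseteq> \<beta> \<Longrightarrow> infinite (corner S \<inter> sector M)"
    using accumulation[OF corner_sub(1) assms(2)] by metis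
  have uf: "\<beta> \<in> UF" using \<beta> boundary_uf by auto
  obtain s :: "nat \<Rightarrow> 'v set" where s: "\<And>n. s n \<in> \<beta>" "\<And>n. s (Suc n) \<subset> s n"
    using boundary_chain[OF \<beta>(1)] by metis
  have sHS: "s n \<in> HS" for n using s uf_sub[OF uf] by auto
  obtain x where x: "x \<in> corner S" using assms(2) by (metis finite.emptyI ex_in_conv)
  have xV: "x \<in> V" using x corner_sub by auto
  obtain n0 where n0: "\<And>n. n \<ge> n0 \<Longrightarrow> x \<notin> s n"
    using chain_escapes[of s x, OF sHS s(2) xV] by metis
  have cp: "corner S \<subseteq> pc t" "corner S \<subseteq> t" "x \<in> pc t" "t \<in> HS" if "t \<in> S" for t
    using corner_sub(2)[OF that] pc_sub[of t] x assms(1) that by auto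
  have tr: "transverse (s n) t" if n: "n \<ge> n0" and t: "t \<in> S" for n t
  proof (rule transverse_if_adjacent[OF cp(4)[OF t] sHS cp(3)[OF t] n0[OF n]])
    have "t \<in> \<beta>" using accumulation_mem[OF uf \<beta>(2) cp(4)[OF t] cp(2)[OF t]] .
    then show "s n \<inter> t \<noteq> {}" using uf_meet[OF uf s(1)] by auto
    show "\<not> s n \<subseteq> t"
    proof
      assume "s n \<subseteq> t"
      moreover have "x \<in> t" "x \<notin> s n" using cp[OF t] x n0[OF n] by auto
      ultimately have "s n \<subset> t" by auto
      then show False using accumulation_minimal[OF \<beta>(2) sHS cp(1)[OF t]] s(1) by auto
    qed
  qed
  have inf: "infinite (corner S \<inter> s n)" for n
    using \<beta>(2)[of "{s n}"] s(1) sector_singleton[OF sHS] by auto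
  have "\<exists>n\<ge>n0. infinite (corner S - s n)"
  proof (rule ccontr)
    assume "\<not> ?thesis"
    then have fin: "\<And>n. n \<ge> n0 \<Longrightarrow> finite (corner S - s n)" by auto
    obtain V0 where V0: "finite V0" "V0 \<subseteq> V" "\<forall>x\<in>V. \<exists>g. automorphism g \<and> g x \<in> V0" using cocompact by auto
    \<comment> \<open>the values that \<open>card (corner S - s n)\<close> can take, realised at the representatives in \<open>V0\<close>\<close>
    define val where "val = (\<Union>z\<in>V0. (\<lambda>(S', h'). card (corner S' - h')) ` (Pow (adjacent z) \<times> adjacent z))"
    have "finite val" unfolding val_def using V0 finite_adjacent by (intro finite_UN_I finite_imageI) auto
    have in_val: "card (corner S - s n) \<in> val" if n: "n \<ge> n0" for n
    proof -
      obtain y where y: "y \<in> corner S" "y \<in> pc (s n)"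
        by (rule enter[OF sHS assms(1) x n0[OF n]]) (use tr[OF n] in \<open>auto simp: transverse_def\<close>)
      have yV: "y \<in> V" using y corner_sub by auto
      obtain g where g: "automorphism g" "g y \<in> V0" using V0 yV by auto
      have "S \<subseteq> adjacent y" "s n \<in> adjacent y" using y assms(1) sHS unfolding adjacent_def corner_def by auto
      then have a: "(`) g ` S \<subseteq> adjacent (g y)" "g ` s n \<in> adjacent (g y)"
        using automorphism_adjacent[OF g(1) yV] by auto
      have "corner ((`) g ` S) - g ` s n = g ` (corner S - s n)"
        using automorphism_corner[OF g(1) assms(1)]
          automorphism_diff[OF g(1) corner_sub(1) halfspace_sub[OF sHS]] by simp
      moreover have "inj_on g (corner S - s n)"
        using automorphism_inj[OF g(1)] corner_sub(1) by (meson Diff_subset inj_on_subset order_trans)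
      ultimately have "card (corner S - s n) = card (corner ((`) g ` S) - g ` s n)"
        by (simp add: card_image)
      moreover have "((`) g ` S, g ` s n) \<in> Pow (adjacent (g y)) \<times> adjacent (g y)" using a by auto
      ultimately show ?thesis unfolding val_def using g(2)
        by (intro UN_I[of "g y"]) (auto intro!: image_eqI[of _ _ "((`) g ` S, g ` s n)"])
    qed
    obtain T where T: "T \<subseteq> corner S" "finite T" "card T = Suc (Max val)"
      using infinite_arbitrarily_large[OF assms(2)] by metis
    have "\<exists>n\<ge>n0. T \<inter> s n = {}"
    proof (rule ccontr)
      assume "\<not> ?thesis"
      then have "infinite T"
        using chain_meets_infinite[of s T n0, OF sHS s(2)] T(1) corner_sub(1)[of S] by auto
      then show False using T by auto
    qed
    then obtain n where n: "n \<ge> n0" "T \<inter> s n = {}" by auto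
    then have "T \<subseteq> corner S - s n" using T by auto
    then have "card T \<le> card (corner S - s n)" using fin[OF n(1)] card_mono by auto
    also have "\<dots> \<le> Max val" using in_val[OF n(1)] \<open>finite val\<close> by simp
    finally show False using T by auto
  qed
  then obtain n where "n \<ge> n0" "infinite (corner S - s n)" by auto
  then show ?thesis using that[of "s n"] sHS tr inf by auto
qed

end

locale essential_halfspace_system = cocompact_halfspace_system V HS for V :: "'v set" and HS +
  assumes essential_below: "h \<in> HS \<Longrightarrow> \<exists>k\<in>HS. k \<subset> h"

text \<open>
  The situation to be refuted: non-terminating ultrafilters are dense in the boundary although a
  bad family exists. The number \<open>c\<close> is the least size of a bad family.
\<close>

locale caging_counterexample = essential_halfspace_system V HS for V :: "'v set" and HS +
  fixes c :: nat
  assumes dense: "\<beta> \<in> boundary \<Longrightarrow> finite M \<Longrightarrow> M \<subseteq> \<beta> \<Longrightarrow> \<exists>\<gamma>\<in>UF. non_terminating \<gamma> \<and> M \<subseteq> \<gamma>"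
    and least: "bad K \<Longrightarrow> c \<le> card K"
    and attained: "\<exists>K. bad K \<and> card K = c"
begin

lemma bad_finite: "bad K \<Longrightarrow> finite K"
  using corner_card unfolding bad_def by metis

text \<open>
  A bad family with one member contradicts essentiality, and if the empty family is bad there are
  infinitely many vertices but no halfspaces.
\<close>

lemma bad_card_at_least_two: "c \<ge> 2"
proof -
  obtain K where K: "bad K" "card K = c" using attained by auto
  have KHS: "K \<subseteq> HS" using K bad_def by auto
  have "c \<noteq> 0"
  proof
    assume "c = 0"
    then have K0: "K = {}" using K bad_finite by auto
    then have no: "HS = {}" using K(1) unfolding bad_def by auto
    have "infinite V" using K(1) K0 unfolding bad_def sector_def by auto
    then obtain \<beta> where \<beta>: "\<beta> \<in> boundary" using accumulation[of V] by auto
    obtain s :: "nat \<Rightarrow> 'v set" where "s 0 \<in> \<beta>" using boundary_chain[OF \<beta>] by metis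
    then show False using no uf_sub[OF boundary_uf[OF \<beta>]] by auto
  qed
  moreover have "c \<noteq> 1"
  proof
    assume "c = 1"
    then obtain k where k: "K = {k}" using K card_1_singletonE by metis
    obtain q where "q \<in> HS" "q \<subset> k" using essential_below[of k] KHS k by auto
    then show False using bad_no_common_below[OF K(1)] k by simp
  qed
  ultimately show ?thesis by auto
qed

text \<open>
  If \<open>q\<close> does not cross \<open>j\<close>, it is contained in \<open>j\<close>. Replace in \<open>K\<close> all members containing \<open>q\<close>,
  among which are \<open>k\<close> and \<open>j\<close>, by the single halfspace \<open>q\<close>: the result is again bad, but smaller.
\<close>

lemma below_transverse:
  assumes "bad K" "card K = c" "\<gamma> \<in> boundary" "K \<subseteq> \<gamma>" "k \<in> K" "q \<in> \<gamma>" "q \<subset> k" "j \<in> K" "j \<noteq> k"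
  shows "transverse q j"
proof (rule ccontr)
  assume ntr: "\<not> transverse q j"
  have uf: "\<gamma> \<in> UF" using assms boundary_uf by auto
  have KHS: "K \<subseteq> HS" and finK: "finite K" using assms(1) bad_finite unfolding bad_def by auto
  have qHS: "q \<in> HS" using uf_sub[OF uf] assms by auto
  obtain x where x: "x \<in> corner K" using assms(1) unfolding bad_def by auto
  have xp: "x \<in> pc i" if "i \<in> K" for i using x that unfolding corner_def by auto
  have xq: "x \<notin> q" using not_in_smaller[OF xp[OF assms(5)] qHS assms(7)] .
  define S where "S = {i \<in> K - {k}. transverse q i}"
  have S: "S \<subseteq> HS" "S \<subseteq> K" "S \<subseteq> \<gamma>" using KHS assms(4) unfolding S_def by auto
  have sub: "q \<subseteq> i" if i: "i \<in> K" "i \<notin> S" for i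
  proof (cases "i = k")
    case False
    then have "\<not> transverse q i" using i unfolding S_def by auto
    then show ?thesis
      using transverse_if_adjacent[OF _ qHS xp[OF i(1)] xq uf_meet[OF uf assms(6)]] i(1) KHS assms(4) by auto
  qed (use assms in auto)
  have xS: "x \<in> corner S" using x corner_sub(3)[OF S(2)] by auto
  obtain y where "y \<in> corner S" "y \<in> pc q"
    by (rule enter[OF qHS S(1) xS xq]) (auto simp: S_def transverse_def)
  then have ne: "corner (insert q S) \<noteq> {}" unfolding corner_def by auto
  have finS: "finite S" using finK unfolding S_def by auto
  have inf: "infinite (sector (insert q S))"
    by (rule sector_infinite[OF assms(3)]) (use S finS assms in auto)
  have "bad (insert q S)"
  proof (rule badI[OF _ ne inf])
    show "insert q S \<subseteq> HS" using S qHS by simp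
    fix p assume p: "p \<in> HS" "\<And>i. i \<in> insert q S \<Longrightarrow> p \<subset> i"
    have "p \<subset> i" if i: "i \<in> K" for i
    proof (cases "i \<in> S")
      case False
      show ?thesis using psubset_subset_trans[OF p(2)[of q] sub[OF i False]] by simp
    qed (use p(2) in simp)
    then show False using bad_no_common_below[OF assms(1) p(1)] by simp
  qed
  then have "c \<le> card (insert q S)" by (rule least)
  also have "\<dots> \<le> Suc (card S)" by (simp add: card_insert_if finS)
  also have "card S \<le> card (K - {k} - {j})"
    by (rule card_mono) (use finK ntr in \<open>auto simp: S_def\<close>)
  also have "Suc (card (K - {k} - {j})) < c"
  proof -
    have "card (K - {k} - {j}) = c - 1 - 1" using assms finK by (simp add: card_Diff_singleton)
    then show ?thesis using bad_card_at_least_two by auto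
  qed
  finally show False by auto
qed

lemma nt_boundary: "\<gamma> \<in> UF \<Longrightarrow> non_terminating \<gamma> \<Longrightarrow> k \<in> \<gamma> \<Longrightarrow> \<gamma> \<in> boundary"
  using nonterminating_boundary by (metis empty_iff)

text \<open>
  Suppose the corner is finite. Some \<open>k \<in> K\<close> contains no member of a descending chain running to
  infinity in the sector of \<open>K\<close>, so infinitely many vertices of the sector lie on the positive
  carrier of \<open>k\<close>. They accumulate at some \<open>\<beta>\<close> in which \<open>k\<close> is minimal. By density a
  non-terminating \<open>\<gamma>\<close> agrees with \<open>\<beta>\<close> on all halfspaces adjacent to the finite corner, but has a
  maximal member \<open>q\<close> below \<open>k\<close>. Since \<open>q\<close> crosses the other members of \<open>K\<close>, its complement is
  adjacent to the corner. By minimality of \<open>k\<close> the complement belongs to \<open>\<beta>\<close>, hence also to \<open>\<gamma>\<close>,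
  which contains \<open>q\<close>.
\<close>

lemma bad_corner_infinite:
  assumes "bad K" "card K = c"
  shows "infinite (corner K)"
proof
  assume fin: "finite (corner K)"
  have KHS: "K \<subseteq> HS" and finK: "finite K" and infS: "infinite (sector K)"
    using assms(1) bad_finite unfolding bad_def by auto
  obtain v where v: "v \<in> corner K" using assms(1) unfolding bad_def by auto
  have vV: "v \<in> V" and vp: "\<And>k. k \<in> K \<Longrightarrow> v \<in> pc k" using v unfolding corner_def by auto
  have secV: "sector K \<subseteq> V" unfolding sector_def by auto
  obtain \<alpha> where \<alpha>: "\<alpha> \<in> boundary" "\<And>M. finite M \<Longrightarrow> M \<subseteq> \<alpha> \<Longrightarrow> infinite (sector K \<inter> sector M)"
    using accumulation[OF secV infS] by metis
  have uf: "\<alpha> \<in> UF" using \<alpha> boundary_uf by auto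
  have K\<alpha>: "k \<in> \<alpha>" if "k \<in> K" for k
    by (rule accumulation_mem[OF uf \<alpha>(2)]) (use that KHS in \<open>auto simp: sector_def\<close>)
  obtain s :: "nat \<Rightarrow> 'v set" where s: "\<And>n. s n \<in> \<alpha>" "\<And>n. s (Suc n) \<subset> s n"
    using boundary_chain[OF \<alpha>(1)] by metis
  have sHS: "s n \<in> HS" for n using s uf_sub[OF uf] by auto
  have sdec: "s n \<subseteq> s m" if "m \<le> n" for m n
    using decseq_SucI[of s] s(2) that unfolding decseq_def by (simp add: psubset_imp_subset)
  obtain n0 where n0: "\<And>n. n \<ge> n0 \<Longrightarrow> v \<notin> s n"
    using chain_escapes[of s v, OF sHS s(2) vV] by metis
  have "\<exists>k\<in>K. \<forall>n. \<not> s n \<subseteq> k"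
  proof (rule ccontr)
    assume "\<not> ?thesis"
    then obtain f where f: "\<And>k. k \<in> K \<Longrightarrow> s (f k) \<subseteq> k" by metis
    define N where "N = Max (f ` K)"
    have "s (Suc N) \<subset> k" if k: "k \<in> K" for k
    proof -
      have "f k \<le> N" unfolding N_def using finK k by auto
      then have "s N \<subseteq> k" using sdec f[OF k] by blast
      then show ?thesis using s(2)[of N] by auto
    qed
    from bad_no_common_below[OF assms(1) sHS this] show False .
  qed
  then obtain k where k: "k \<in> K" "\<And>n. \<not> s n \<subseteq> k" by metis
  define Z where "Z = pc k \<inter> sector K"
  have ZV: "Z \<subseteq> V" and Zp: "Z \<subseteq> pc k" using secV unfolding Z_def by auto
  have infZ: "infinite Z"
  proof (rule chain_meets_infinite[of s Z n0, OF sHS s(2) ZV])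
    fix n assume n: "n0 \<le> n"
    have kHS: "{k} \<subseteq> HS" using k KHS by auto
    have vk: "v \<in> corner {k}" using vp[OF k(1)] vV unfolding corner_def by auto
    obtain y where y: "y \<in> corner {k}" "y \<in> pc (s n)" "toward (s n) v y"
      by (rule enter[OF sHS kHS vk n0[OF n]]) (use uf_meet[OF uf s(1) K\<alpha>[OF k(1)]] k(2) in auto)
    have "y \<in> i" if i: "i \<in> K" for i
    proof (rule toward_stay[OF y(3)])
      show "i \<in> HS" using i KHS by auto
      show "v \<in> i" using vp[OF i] pc_sub by auto
      show "s n \<inter> i \<noteq> {}" using uf_meet[OF uf s(1) K\<alpha>[OF i]] .
    qed
    then have "y \<in> Z" using y unfolding Z_def corner_def sector_def by auto
    then show "Z \<inter> s n \<noteq> {}" using y pc_sub by auto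
  qed
  obtain \<beta> where \<beta>: "\<beta> \<in> boundary" "\<And>M. finite M \<Longrightarrow> M \<subseteq> \<beta> \<Longrightarrow> infinite (Z \<inter> sector M)"
    using accumulation[OF ZV infZ] by metis
  have uf\<beta>: "\<beta> \<in> UF" using \<beta> boundary_uf by auto
  have K\<beta>: "i \<in> \<beta>" if "i \<in> K" for i
    by (rule accumulation_mem[OF uf\<beta> \<beta>(2)]) (use that KHS in \<open>auto simp: sector_def Z_def\<close>)
  \<comment> \<open>finite because the corner is assumed to be finite\<close>
  define M where "M = K \<union> {m \<in> \<beta>. \<exists>x\<in>corner K. x \<in> pc m}"
  have "{m \<in> \<beta>. \<exists>x\<in>corner K. x \<in> pc m} \<subseteq> (\<Union>x\<in>corner K. adjacent x)"
    using uf_sub[OF uf\<beta>] unfolding adjacent_def by auto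
  moreover have "finite (\<Union>x\<in>corner K. adjacent x)"
    using fin finite_adjacent corner_sub(1) by (intro finite_UN_I) auto
  ultimately have finM: "finite M" unfolding M_def using finK finite_subset by auto
  have "M \<subseteq> \<beta>" using K\<beta> unfolding M_def by auto
  then obtain \<gamma> where \<gamma>: "\<gamma> \<in> UF" "non_terminating \<gamma>" "M \<subseteq> \<gamma>" using dense[OF \<beta>(1) finM] by auto
  have K\<gamma>: "K \<subseteq> \<gamma>" using \<gamma> unfolding M_def by auto
  have \<gamma>b: "\<gamma> \<in> boundary" using nt_boundary[OF \<gamma>(1,2)] K\<gamma> k by auto
  obtain q0 where q0: "q0 \<in> \<gamma>" "q0 \<subset> k" using \<gamma>(2) K\<gamma> k(1) unfolding non_terminating_def by (metis subsetD)
  have kHS: "k \<in> HS" using k KHS by auto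
  obtain q where q: "q \<in> \<gamma>" "q \<subset> k" "\<not> (\<exists>m\<in>HS. q \<subset> m \<and> m \<subset> k)"
    using max_below[OF \<gamma>(1) kHS q0] by metis
  have qHS: "q \<in> HS" using uf_sub[OF \<gamma>(1) q(1)] .
  have vq: "v \<notin> q" using not_in_smaller[OF vp[OF k(1)] qHS q(2)] .
  obtain y where y: "y \<in> corner K" "y \<in> pc (V - q)"
  proof (rule approach[OF qHS KHS v vq])
    fix i assume i: "i \<in> K"
    show "q \<inter> i \<noteq> {} \<and> \<not> (\<exists>m\<in>HS. q \<subset> m \<and> m \<subset> i)"
    proof (cases "i = k")
      case True
      moreover have "q \<inter> k \<noteq> {}" using uf_meet[OF \<gamma>(1) q(1)] K\<gamma> k(1) by auto
      ultimately show ?thesis using q(3) by simp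
    next
      case False
      then have "transverse q i" using below_transverse[OF assms \<gamma>b K\<gamma> k(1) q(1,2) i] by auto
      then show ?thesis unfolding transverse_def by blast
    qed
  qed
  have "q \<notin> \<beta>" by (rule accumulation_minimal[OF \<beta>(2) qHS Zp q(2)])
  then have "V - q \<in> \<beta>" using uf_compl[OF uf\<beta> qHS] by simp
  then have "V - q \<in> \<gamma>" using y \<gamma>(3) unfolding M_def by auto
  then show False using uf_compl[OF \<gamma>(1) qHS] q(1) by simp
qed

end

context locally_finite_halfspace_system
begin

lemma finite_transverse_all:
  assumes "S \<subseteq> HS" "corner S \<noteq> {}" "finite (corner S)"
  shows "finite {m \<in> HS. \<forall>t\<in>S. transverse m t}"
proof -
  have "{m \<in> HS. \<forall>t\<in>S. transverse m t} \<subseteq> (\<Union>x\<in>corner S. adjacent x)"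
  proof
    fix m assume m: "m \<in> {m \<in> HS. \<forall>t\<in>S. transverse m t}"
    then have "corner (insert m S) \<noteq> {}" using corner_insert_transverse[OF _ assms(1,2)] by auto
    then obtain x where "x \<in> corner (insert m S)" by auto
    then show "m \<in> (\<Union>x\<in>corner S. adjacent x)" using m unfolding corner_def adjacent_def by auto
  qed
  moreover have "finite (\<Union>x\<in>corner S. adjacent x)"
    using assms(3) finite_adjacent corner_sub(1) by (intro finite_UN_I) auto
  ultimately show ?thesis by (rule finite_subset)
qed

end

context cocompact_halfspace_system
begin

text \<open>
  Take \<open>S\<close> of the largest size; sizes are bounded by \<open>corner_card\<close>.
\<close>

lemma terminal_extension:
  assumes "K \<subseteq> HS" "infinite (corner K)"
  obtains S where "K \<subseteq> S" "S \<subseteq> HS" "infinite (corner S)"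
    "\<And>h. h \<in> HS \<Longrightarrow> (\<And>t. t \<in> S \<Longrightarrow> transverse h t) \<Longrightarrow> finite (corner (insert h S))"
proof -
  obtain b where b: "\<And>S. S \<subseteq> HS \<Longrightarrow> corner S \<noteq> {} \<Longrightarrow> finite S \<and> card S \<le> b" using corner_card by metis
  define P where "P n \<longleftrightarrow> (\<exists>S. K \<subseteq> S \<and> S \<subseteq> HS \<and> infinite (corner S) \<and> card S = n)" for n
  have ne: "corner S \<noteq> {}" if "infinite (corner S)" for S using that by auto
  have "P (card K)" unfolding P_def using assms by auto
  moreover have "\<forall>n. P n \<longrightarrow> n < Suc b" unfolding P_def using b ne by (metis less_Suc_eq_le)
  ultimately obtain n where n: "P n" "\<And>m. P m \<Longrightarrow> m \<le> n"
    using ex_has_greatest_nat[of P "card K" "\<lambda>x. x" "Suc b"] by metis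
  obtain S where S: "K \<subseteq> S" "S \<subseteq> HS" "infinite (corner S)" "card S = n" using n(1) unfolding P_def by metis
  have "finite (corner (insert h S))" if h: "h \<in> HS" and tr: "\<And>t. t \<in> S \<Longrightarrow> transverse h t" for h
  proof (rule ccontr)
    assume inf: "infinite (corner (insert h S))"
    have "h \<notin> S" using tr not_transverse_self by auto
    moreover have "finite S" using b[OF S(2) ne[OF S(3)]] by simp
    ultimately have "card (insert h S) = Suc n" using S(4) by simp
    moreover have "K \<subseteq> insert h S" "insert h S \<subseteq> HS" using S h by auto
    ultimately have "P (Suc n)" unfolding P_def using inf by metis
    then show False using n(2) by fastforce
  qed
  then show ?thesis using that[OF S(1-3)] by metis
qed

end

context caging_counterexample
begin

text \<open>
  Let \<open>\<beta>\<close> be an accumulation point of the part of the corner of \<open>S\<close> inside \<open>h\<close>. Only finitely many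
  halfspaces cross all of \<open>S\<close> and \<open>h\<close>, so a vertex \<open>w\<close> can be found on the corner of \<open>S\<close> that lies
  in all of those belonging to \<open>\<beta>\<close>. Now let \<open>\<gamma>\<close> be non-terminating, containing \<open>S\<close> and agreeing
  with \<open>\<beta>\<close> on the hyperplanes adjacent to \<open>w\<close>. If \<open>p \<in> \<gamma>\<close> is below \<open>t \<in> S\<close> but not inside \<open>h\<close>, the
  first hyperplane crossed on the way from \<open>w\<close> to \<open>p\<close> is one that crosses \<open>S\<close> and \<open>h\<close> and has \<open>w\<close>
  on the wrong side.
\<close>

lemma nonterminating_beyond:
  assumes S: "S \<subseteq> HS" and h: "h \<in> HS" and tr: "\<And>t. t \<in> S \<Longrightarrow> transverse h t"
    and fin: "finite (corner (insert h S))" and inf: "infinite (corner S \<inter> h)"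
  obtains \<gamma> where "\<gamma> \<in> UF" "non_terminating \<gamma>" "S \<subseteq> \<gamma>" "\<And>t p. t \<in> S \<Longrightarrow> p \<in> \<gamma> \<Longrightarrow> p \<subset> t \<Longrightarrow> p \<subseteq> h"
proof -
  let ?Z = "corner S \<inter> h"
  have ZV: "?Z \<subseteq> V" using corner_sub(1) by auto
  obtain \<beta> where \<beta>: "\<beta> \<in> boundary" "\<And>M. finite M \<Longrightarrow> M \<subseteq> \<beta> \<Longrightarrow> infinite (?Z \<inter> sector M)"
    using accumulation[OF ZV inf] by metis
  have uf: "\<beta> \<in> UF" using \<beta> boundary_uf by auto
  have cp: "?Z \<subseteq> pc t" "?Z \<subseteq> t" "t \<in> HS" if "t \<in> S" for t
    using corner_sub(2)[OF that] pc_sub[of t] S that by auto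
  have S\<beta>: "t \<in> \<beta>" if "t \<in> S" for t using accumulation_mem[OF uf \<beta>(2) cp(3,2)[OF that]] .
  have h\<beta>: "h \<in> \<beta>" by (rule accumulation_mem[OF uf \<beta>(2) h]) auto
  have cne: "corner S \<noteq> {}" using inf by auto
  have finS: "finite S"
  proof -
    obtain b where "\<And>S. S \<subseteq> HS \<Longrightarrow> corner S \<noteq> {} \<Longrightarrow> finite S \<and> card S \<le> b" using corner_card by metis
    then show ?thesis using S cne by simp
  qed
  have ne: "corner (insert h S) \<noteq> {}" using corner_insert_transverse[OF h S cne tr] .
  have iS: "insert h S \<subseteq> HS" using h S by simp
  \<comment> \<open>the halfspaces that might obstruct the conclusion\<close>
  define E where "E = {m \<in> HS. \<forall>t\<in>insert h S. transverse m t}"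
  have finE: "finite E" unfolding E_def by (rule finite_transverse_all[OF iS ne fin])
  have "corner (insert (V - h) S) \<noteq> {}"
    using corner_insert_transverse[OF compl_halfspace[OF h] S cne] transverse_compl[OF h _ tr] S by auto
  then obtain w0 where "w0 \<in> corner (insert (V - h) S)" by auto
  then have w0: "w0 \<in> corner S" "w0 \<notin> h" "w0 \<in> V" using pc_sub[of "V - h"] unfolding corner_def by auto
  define H where "H = insert h (E \<inter> \<beta>)"
  have H: "H \<subseteq> \<beta>" "finite H" using h\<beta> finE unfolding H_def by auto
  obtain w where w: "w \<in> sector H" "\<forall>m\<in>HS. w \<in> m \<and> w0 \<notin> m \<longrightarrow> m \<in> \<beta>"
    using uf_move[OF uf H w0(3)] by metis
  have wV: "w \<in> V" and wh: "w \<in> h" and wE: "\<And>m. m \<in> E \<Longrightarrow> m \<in> \<beta> \<Longrightarrow> w \<in> m"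
    using w(1) unfolding sector_def H_def by auto
  \<comment> \<open>the walk from \<open>w0\<close> to \<open>w\<close> only entered members of \<open>\<beta>\<close>, so members of \<open>\<beta>\<close> missed at \<open>w\<close> are missed at \<open>w0\<close>\<close>
  have behind: "w0 \<notin> m" if m: "m \<in> \<beta>" "w \<notin> m" for m
  proof
    assume "w0 \<in> m"
    have mHS: "m \<in> HS" using uf_sub[OF uf m(1)] .
    have "V - m \<in> \<beta>" using w(2) compl_halfspace[OF mHS] wV m(2) \<open>w0 \<in> m\<close> by auto
    then show False using uf_compl[OF uf mHS] m(1) by simp
  qed
  have minimal: "q \<notin> \<beta>" if "t \<in> S" "q \<in> HS" "q \<subset> t" for t q
    by (rule accumulation_minimal[OF \<beta>(2) that(2) cp(1)[OF that(1)] that(3)])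
  have wpc: "w \<in> pc t" if t: "t \<in> S" for t
  proof -
    have "w0 \<in> pc t" using w0 t unfolding corner_def by auto
    then have "w0 \<in> t" using pc_sub by auto
    then have "w \<in> t" using behind[OF S\<beta>[OF t]] by auto
    moreover have "q = t" if q: "q \<in> HS" "w \<in> q" "q \<subseteq> t" for q
    proof (rule ccontr)
      assume "q \<noteq> t"
      then have qt: "q \<subset> t" using q by auto
      have "w0 \<notin> q" using not_in_smaller[OF \<open>w0 \<in> pc t\<close> q(1) qt] .
      then have "q \<in> \<beta>" using w(2) q by auto
      then show False using minimal[OF t q(1) qt] by simp
    qed
    ultimately show ?thesis unfolding pc_def by blast
  qed
  define M where "M = S \<union> {n \<in> \<beta>. w \<in> pc n \<or> w \<in> pc (V - n)}"
  have "{n \<in> \<beta>. w \<in> pc n \<or> w \<in> pc (V - n)} \<subseteq> adjacent w \<union> (\<lambda>k. V - k) ` adjacent w"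
  proof
    fix n assume n: "n \<in> {n \<in> \<beta>. w \<in> pc n \<or> w \<in> pc (V - n)}"
    then have nHS: "n \<in> HS" using uf_sub[OF uf] by auto
    show "n \<in> adjacent w \<union> (\<lambda>k. V - k) ` adjacent w"
      using n nHS compl_halfspace[OF nHS] compl_compl[OF nHS] unfolding adjacent_def
      by (metis (mono_tags, lifting) CollectD CollectI UnCI image_eqI)
  qed
  from finite_subset[OF this] have finM: "finite M"
    unfolding M_def using finS finite_adjacent[OF wV] by simp
  have "M \<subseteq> \<beta>" using S\<beta> unfolding M_def by auto
  then obtain \<gamma> where \<gamma>: "\<gamma> \<in> UF" "non_terminating \<gamma>" "M \<subseteq> \<gamma>" using dense[OF \<beta>(1) finM] by metis
  have "p \<subseteq> h" if t: "t \<in> S" and p: "p \<in> \<gamma>" "p \<subset> t" for t p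
  proof (rule ccontr)
    assume ph: "\<not> p \<subseteq> h"
    have pHS: "p \<in> HS" using uf_sub[OF \<gamma>(1) p(1)] .
    have wp: "w \<in> V - p" using not_in_smaller[OF wpc[OF t] pHS p(2)] wV by simp
    obtain n' y where n': "step_out w n' y" "n' \<subseteq> V - p" using first_step_out[OF compl_halfspace[OF pHS] wp] .
    have n'HS: "n' \<in> HS" and wn': "w \<in> n'" using n'(1) unfolding step_out_def by auto
    define n where "n = V - n'"
    have nHS: "n \<in> HS" and nn: "V - n = n'" and wn: "w \<notin> n"
      using compl_halfspace[OF n'HS] compl_compl[OF n'HS] wn' unfolding n_def by auto
    have pn: "p \<subseteq> n" using n'(2) halfspace_sub[OF pHS] unfolding n_def by auto
    have n\<gamma>: "n \<in> \<gamma>" using uf_up[OF \<gamma>(1) p(1) nHS pn] .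
    have n\<beta>: "n \<in> \<beta>"
    proof (rule ccontr)
      assume "n \<notin> \<beta>"
      then have "V - n \<in> \<beta>" using uf_compl[OF uf nHS] by simp
      moreover have "w \<in> pc (V - n)" using step_out_pc[OF n'(1)] nn by simp
      ultimately have "V - n \<in> \<gamma>" using \<gamma>(3) unfolding M_def by auto
      then show False using uf_compl[OF \<gamma>(1) nHS] n\<gamma> by simp
    qed
    have ntr: "transverse n t'" if t': "t' \<in> S" for t'
    proof (rule transverse_if_adjacent[OF cp(3)[OF t'] nHS wpc[OF t'] wn uf_meet[OF uf n\<beta> S\<beta>[OF t']]])
      show "\<not> n \<subseteq> t'"
      proof
        assume "n \<subseteq> t'"
        moreover have "w \<in> t'" using wpc[OF t'] pc_sub by auto
        ultimately have "n \<subset> t'" using wn by auto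
        then show False using minimal[OF t' nHS] n\<beta> by simp
      qed
    qed
    have "\<not> n \<subseteq> h" using pn ph by auto
    then have "transverse n h"
      using uf_meet[OF uf n\<beta> h\<beta>] wn wh w0(2,3) behind[OF n\<beta> wn] unfolding transverse_def by auto
    then have "n \<in> E" using ntr nHS unfolding E_def by auto
    then show False using wE n\<beta> wn by auto
  qed
  moreover have "S \<subseteq> \<gamma>" using \<gamma>(3) unfolding M_def by auto
  ultimately show ?thesis using that[OF \<gamma>(1,2)] by metis
qed

section \<open>Covers of bad families and halfspaces between them\<close>

text \<open>
  Lists rather than sets, so that the members of a family and of its successors can be matched by
  position.
\<close>

definition crossing_list :: "'v set list \<Rightarrow> bool" where
  "crossing_list \<kappa> \<longleftrightarrow> set \<kappa> \<subseteq> HS \<and>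
     (\<forall>i<length \<kappa>. \<forall>j<length \<kappa>. i \<noteq> j \<longrightarrow> transverse (\<kappa> ! i) (\<kappa> ! j))"

definition covers :: "'v set list \<Rightarrow> 'v set list \<Rightarrow> bool" where
  "covers \<kappa> \<kappa>' \<longleftrightarrow> length \<kappa>' = length \<kappa> \<and> crossing_list \<kappa>' \<and>
     (\<forall>i<length \<kappa>. \<kappa>' ! i \<subset> \<kappa> ! i \<and> \<not> (\<exists>m\<in>HS. \<kappa>' ! i \<subset> m \<and> m \<subset> \<kappa> ! i)) \<and>
     (\<forall>i<length \<kappa>. \<forall>j<length \<kappa>. i \<noteq> j \<longrightarrow> transverse (\<kappa>' ! i) (\<kappa> ! j))"

lemma crossing_list_distinct: "crossing_list \<kappa> \<Longrightarrow> distinct \<kappa>"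
  unfolding crossing_list_def distinct_conv_nth using not_transverse_self by metis

lemma crossing_list_corner:
  assumes "crossing_list \<kappa>" "I \<subseteq> {..<length \<kappa>}" shows "corner ((\<lambda>i. \<kappa> ! i) ` I) \<noteq> {}"
proof (rule corner_pairwise_transverse)
  show "finite ((\<lambda>i. \<kappa> ! i) ` I)" using assms(2) finite_subset by auto
  show "(\<lambda>i. \<kappa> ! i) ` I \<subseteq> HS" using assms unfolding crossing_list_def by (auto dest: nth_mem)
  show "pairwise transverse ((\<lambda>i. \<kappa> ! i) ` I)"
  proof (rule pairwiseI)
    fix x y assume "x \<in> (\<lambda>i. \<kappa> ! i) ` I" "y \<in> (\<lambda>i. \<kappa> ! i) ` I" "x \<noteq> y"
    then obtain i j where "i \<in> I" "j \<in> I" "x = \<kappa> ! i" "y = \<kappa> ! j" "i \<noteq> j" by auto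
    then show "transverse x y" using assms unfolding crossing_list_def by auto
  qed
qed

lemma set_nth: "set \<kappa> = (\<lambda>i. \<kappa> ! i) ` {..<length \<kappa>}"
  by (auto simp: set_conv_nth)

text \<open>
  Each member of \<open>\<kappa>\<close> is replaced by a maximal member of \<open>\<gamma>\<close> below it. That the replacements cross
  each other and the other members of \<open>\<kappa>\<close> is due to \<open>below_transverse\<close>.
\<close>

lemma covers_exists:
  assumes \<kappa>: "distinct \<kappa>" "bad (set \<kappa>)" "length \<kappa> = c" and \<gamma>: "\<gamma> \<in> UF" "non_terminating \<gamma>" "set \<kappa> \<subseteq> \<gamma>"
  obtains \<kappa>' where "covers \<kappa> \<kappa>'" "set \<kappa>' \<subseteq> \<gamma>" "bad (set \<kappa>')"
proof -
  have cardc: "card (set \<kappa>) = c" using \<kappa> distinct_card by metis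
  have HS: "set \<kappa> \<subseteq> HS" using bad_halfspaces[OF \<kappa>(2)] .
  have in\<gamma>: "\<kappa> ! i \<in> \<gamma>" "\<kappa> ! i \<in> HS" "\<kappa> ! i \<in> set \<kappa>" if "i < c" for i using that \<kappa>(3) \<gamma>(3) HS by auto
  have \<gamma>b: "\<gamma> \<in> boundary" using nt_boundary[OF \<gamma>(1,2) in\<gamma>(1)[of 0]] bad_card_at_least_two by simp
  have "\<exists>q. q \<in> \<gamma> \<and> q \<subset> \<kappa> ! i \<and> \<not> (\<exists>m\<in>HS. q \<subset> m \<and> m \<subset> \<kappa> ! i)" if i: "i < c" for i
  proof -
    obtain q0 where q0: "q0 \<in> \<gamma>" "q0 \<subset> \<kappa> ! i" using \<gamma>(2) in\<gamma>(1)[OF i] unfolding non_terminating_def by metis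
    show ?thesis using max_below[OF \<gamma>(1) in\<gamma>(2)[OF i] q0] by metis
  qed
  then obtain f where f: "\<And>i. i < c \<Longrightarrow> f i \<in> \<gamma>" "\<And>i. i < c \<Longrightarrow> f i \<subset> \<kappa> ! i"
    "\<And>i. i < c \<Longrightarrow> \<not> (\<exists>m\<in>HS. f i \<subset> m \<and> m \<subset> \<kappa> ! i)" by metis
  have fHS: "f i \<in> HS" if "i < c" for i using uf_sub[OF \<gamma>(1) f(1)[OF that]] .
  have tr: "transverse (f i) (\<kappa> ! j)" if "i < c" "j < c" "i \<noteq> j" for i j
  proof (rule below_transverse[OF \<kappa>(2) cardc \<gamma>b \<gamma>(3) in\<gamma>(3)[OF that(1)] f(1,2)[OF that(1)] in\<gamma>(3)[OF that(2)]])
    show "\<kappa> ! j \<noteq> \<kappa> ! i" using nth_eq_iff_index_eq[OF \<kappa>(1)] that \<kappa>(3) by auto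
  qed
  define \<kappa>' where "\<kappa>' = map f [0..<c]"
  have len: "length \<kappa>' = c" and nth: "\<And>i. i < c \<Longrightarrow> \<kappa>' ! i = f i" unfolding \<kappa>'_def by auto
  have set': "set \<kappa>' = f ` {..<c}" unfolding \<kappa>'_def by auto
  obtain x where x: "x \<in> corner (set \<kappa>)" using \<kappa>(2) unfolding bad_def by auto
  have xf: "x \<notin> f i" if i: "i < c" for i
  proof -
    have "x \<in> pc (\<kappa> ! i)" using x in\<gamma>(3)[OF i] unfolding corner_def by auto
    from not_in_smaller[OF this fHS[OF i] f(2)[OF i]] show ?thesis .
  qed
  have tr2: "transverse (f i) (f j)" if ij: "i < c" "j < c" "i \<noteq> j" for i j
  proof -
    have sub: "\<not> f i \<subseteq> f j" if "i < c" "j < c" "i \<noteq> j" for i j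
      using tr[OF that] f(2)[OF that(2)] unfolding transverse_def by blast
    have "x \<in> V - f i - f j" using x xf ij unfolding corner_def by auto
    then show ?thesis
      using sub[OF ij] sub[of j i] ij uf_meet[OF \<gamma>(1) f(1)[OF ij(1)] f(1)[OF ij(2)]] unfolding transverse_def by auto
  qed
  have cl: "crossing_list \<kappa>'" unfolding crossing_list_def using tr2 len nth set' fHS by auto
  have cov: "covers \<kappa> \<kappa>'" unfolding covers_def using cl len nth f tr \<kappa>(3) by simp
  have sub\<gamma>: "set \<kappa>' \<subseteq> \<gamma>" using set' f(1) by auto
  have "bad (set \<kappa>')"
  proof (rule badI)
    show "set \<kappa>' \<subseteq> HS" using cl unfolding crossing_list_def by simp
    show "corner (set \<kappa>') \<noteq> {}" using crossing_list_corner[OF cl order_refl] set_nth by metis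
    show "infinite (sector (set \<kappa>'))" using sector_infinite[OF \<gamma>b sub\<gamma>] by simp
    fix q assume q: "q \<in> HS" "\<And>k. k \<in> set \<kappa>' \<Longrightarrow> q \<subset> k"
    have "q \<subset> k" if k: "k \<in> set \<kappa>" for k
    proof -
      obtain i where i: "i < c" "k = \<kappa> ! i" using k \<kappa>(3) by (metis in_set_conv_nth)
      have "q \<subset> f i" using q(2) set' i(1) by auto
      then show ?thesis using f(2)[OF i(1)] i(2) by auto
    qed
    from bad_no_common_below[OF \<kappa>(2) q(1) this] show False .
  qed
  then show ?thesis using that cov sub\<gamma> by metis
qed

text \<open>
  The family \<open>\<kappa>\<close> can be shrunk, keeping an infinite sector, so that all members get into \<open>h\<close>. A
  good halfspace is one for which this can be done on both sides.
\<close>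

definition side :: "'v set list \<Rightarrow> 'v set \<Rightarrow> bool" where
  "side \<kappa> h \<longleftrightarrow> (\<exists>\<kappa>'. length \<kappa>' = length \<kappa> \<and> crossing_list \<kappa>' \<and> infinite (sector (set \<kappa>')) \<and>
     (\<forall>i<length \<kappa>. \<kappa>' ! i \<subset> \<kappa> ! i \<and> \<kappa>' ! i \<subseteq> h))"

definition good :: "'v set list \<Rightarrow> 'v set \<Rightarrow> bool" where
  "good \<kappa> h \<longleftrightarrow> h \<in> HS \<and> side \<kappa> h \<and> side \<kappa> (V - h)"

text \<open>
  If \<open>h \<subseteq> \<kappa>'' ! j\<close>, then the shrunk family without its \<open>j\<close>-th member is already bad: a halfspace
  below the others is below \<open>\<kappa>'' ! j\<close> too, since they all lie in \<open>h\<close>. This contradicts the choice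
  of \<open>c\<close>.
\<close>

lemma side_not_sub:
  assumes "side \<kappa> h" "length \<kappa> = c" "bad (set \<kappa>'')" "length \<kappa>'' = c"
    "\<And>i. i < c \<Longrightarrow> \<kappa> ! i \<subseteq> \<kappa>'' ! i" "j < c"
  shows "\<not> h \<subseteq> \<kappa>'' ! j"
proof
  assume hj: "h \<subseteq> \<kappa>'' ! j"
  obtain \<kappa>' where \<kappa>': "length \<kappa>' = c" "crossing_list \<kappa>'" "infinite (sector (set \<kappa>'))"
    "\<And>i. i < c \<Longrightarrow> \<kappa>' ! i \<subset> \<kappa> ! i" "\<And>i. i < c \<Longrightarrow> \<kappa>' ! i \<subseteq> h"
    using assms(1,2) unfolding side_def by metis
  let ?I = "{..<c} - {j}" and ?n = "\<lambda>i. \<kappa>' ! i"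
  have sub: "?n ` ?I \<subseteq> set \<kappa>'" using \<kappa>'(1) by auto
  have "bad (?n ` ?I)"
  proof (rule badI)
    show "?n ` ?I \<subseteq> HS" using sub \<kappa>'(2) unfolding crossing_list_def by auto
    show "corner (?n ` ?I) \<noteq> {}" by (rule crossing_list_corner[OF \<kappa>'(2)]) (use \<kappa>'(1) in auto)
    have "sector (set \<kappa>') \<subseteq> sector (?n ` ?I)" using sub unfolding sector_def by auto
    then show "infinite (sector (?n ` ?I))" using \<kappa>'(3) finite_subset by auto
    fix q assume q: "q \<in> HS" "\<And>k. k \<in> ?n ` ?I \<Longrightarrow> q \<subset> k"
    have "q \<subset> k" if k: "k \<in> set \<kappa>''" for k
    proof -
      obtain i where i: "i < c" "k = \<kappa>'' ! i" using k assms(4) by (metis in_set_conv_nth)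
      show ?thesis
      proof (cases "i = j")
        case True
        obtain i' where i': "i' < c" "i' \<noteq> j"
        proof (cases "j = 0")
          case True then show ?thesis using that[of 1] bad_card_at_least_two by auto
        next
          case False then show ?thesis using that[of 0] bad_card_at_least_two by auto
        qed
        then have "q \<subset> \<kappa>' ! i'" using q(2) by auto
        also have "\<dots> \<subseteq> \<kappa>'' ! j" using \<kappa>'(5)[OF i'(1)] hj by auto
        finally show ?thesis using True i by simp
      next
        case False
        then have "q \<subset> \<kappa>' ! i" using q(2) i by auto
        also have "\<kappa>' ! i \<subseteq> \<kappa>'' ! i" using \<kappa>'(4)[OF i(1)] assms(5)[OF i(1)] by auto
        finally show ?thesis using i by simp
      qed
    qed
    from bad_no_common_below[OF assms(3) q(1) this] show False .
  qed
  then have "c \<le> card (?n ` ?I)" by (rule least)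
  also have "\<dots> \<le> card ?I" by (rule card_image_le) simp
  also have "\<dots> < c" using assms(6) by simp
  finally show False by simp
qed

text \<open>
  Both sides of \<open>h\<close> contain halfspaces below \<open>\<kappa>'' ! j\<close>, and by \<open>side_not_sub\<close> neither side is
  contained in \<open>\<kappa>'' ! j\<close>.
\<close>

lemma good_transverse:
  assumes "good \<kappa> h" "length \<kappa> = c" "bad (set \<kappa>'')" "length \<kappa>'' = c"
    "\<And>i. i < c \<Longrightarrow> \<kappa> ! i \<subseteq> \<kappa>'' ! i" "j < c"
  shows "transverse h (\<kappa>'' ! j)"
proof -
  have h: "h \<in> HS" "side \<kappa> h" "side \<kappa> (V - h)" using assms(1) unfolding good_def by auto
  have kHS: "\<kappa>'' ! j \<in> HS" using bad_halfspaces[OF assms(3)] assms(4,6) by auto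
  have meet: "u \<inter> \<kappa>'' ! j \<noteq> {}" if su: "side \<kappa> u" for u
  proof -
    obtain \<kappa>' where \<kappa>': "length \<kappa>' = c" "crossing_list \<kappa>'" "\<kappa>' ! j \<subset> \<kappa> ! j" "\<kappa>' ! j \<subseteq> u"
    proof -
      obtain \<kappa>' where "length \<kappa>' = length \<kappa>" "crossing_list \<kappa>'"
        "\<forall>i<length \<kappa>. \<kappa>' ! i \<subset> \<kappa> ! i \<and> \<kappa>' ! i \<subseteq> u"
        using su unfolding side_def by metis
      then show ?thesis using that[of \<kappa>'] assms(2,6) by simp
    qed
    have "\<kappa>' ! j \<in> HS" using \<kappa>'(1,2) assms(6) unfolding crossing_list_def by auto
    then show ?thesis using halfspace_nonempty \<kappa>'(3,4) assms(5)[OF assms(6)] by blast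
  qed
  have "h \<inter> \<kappa>'' ! j \<noteq> {}" "(V - h) \<inter> \<kappa>'' ! j \<noteq> {}" "\<not> h \<subseteq> \<kappa>'' ! j" "\<not> V - h \<subseteq> \<kappa>'' ! j"
    using meet[OF h(2)] meet[OF h(3)] side_not_sub[OF h(2) assms(2-6)] side_not_sub[OF h(3) assms(2-6)] by simp_all
  then show ?thesis unfolding transverse_def by blast
qed

text \<open>
  Extend \<open>\<kappa>\<close> to a terminal \<open>S\<close> and divide its infinite corner by \<open>h\<close>. Then \<open>nonterminating_beyond\<close>
  applies to \<open>h\<close> and to its complement.
\<close>

lemma good_covers_exists:
  assumes "distinct \<kappa>" "bad (set \<kappa>)" "length \<kappa> = c"
  obtains \<kappa>' h where "covers \<kappa> \<kappa>'" "bad (set \<kappa>')" "good \<kappa> h" "\<And>i. i < c \<Longrightarrow> \<kappa>' ! i \<subseteq> h"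
proof -
  have cardc: "card (set \<kappa>) = c" using assms distinct_card by metis
  obtain S where S: "set \<kappa> \<subseteq> S" "S \<subseteq> HS" "infinite (corner S)"
    "\<And>h. h \<in> HS \<Longrightarrow> (\<And>t. t \<in> S \<Longrightarrow> transverse h t) \<Longrightarrow> finite (corner (insert h S))"
    using terminal_extension[OF bad_halfspaces[OF assms(2)] bad_corner_infinite[OF assms(2) cardc]] by metis
  obtain h where h: "h \<in> HS" "\<And>t. t \<in> S \<Longrightarrow> transverse h t" "infinite (corner S \<inter> h)" "infinite (corner S - h)"
    using two_sided[OF S(2,3)] by metis
  have one: "\<exists>\<kappa>'. covers \<kappa> \<kappa>' \<and> bad (set \<kappa>') \<and> (\<forall>i<c. \<kappa>' ! i \<subseteq> u)"
    if u: "u \<in> HS" "\<And>t. t \<in> S \<Longrightarrow> transverse u t" "infinite (corner S \<inter> u)" for u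
  proof -
    obtain \<gamma> where \<gamma>: "\<gamma> \<in> UF" "non_terminating \<gamma>" "S \<subseteq> \<gamma>" "\<And>t p. t \<in> S \<Longrightarrow> p \<in> \<gamma> \<Longrightarrow> p \<subset> t \<Longrightarrow> p \<subseteq> u"
      using nonterminating_beyond[OF S(2) u(1,2) S(4)[OF u(1,2)] u(3)] by metis
    have "set \<kappa> \<subseteq> \<gamma>" using S(1) \<gamma>(3) by auto
    then obtain \<kappa>' where \<kappa>': "covers \<kappa> \<kappa>'" "set \<kappa>' \<subseteq> \<gamma>" "bad (set \<kappa>')"
      using covers_exists[OF assms \<gamma>(1,2)] by metis
    have "\<kappa>' ! i \<subseteq> u" if i: "i < c" for i
    proof (rule \<gamma>(4)[of "\<kappa> ! i"])
      show "\<kappa> ! i \<in> S" using S(1) i assms(3) by auto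
      show "\<kappa>' ! i \<in> \<gamma>" "\<kappa>' ! i \<subset> \<kappa> ! i" using \<kappa>'(1,2) i assms(3) unfolding covers_def by auto
    qed
    then show ?thesis using \<kappa>' by metis
  qed
  have sd: "side \<kappa> u" if "covers \<kappa> \<kappa>'" "bad (set \<kappa>')" "\<forall>i<c. \<kappa>' ! i \<subseteq> u" for \<kappa>' u
    unfolding side_def using that assms(3) unfolding covers_def bad_def by metis
  have "corner S - h = corner S \<inter> (V - h)" using corner_sub(1) by auto
  then obtain \<kappa>1 where \<kappa>1: "covers \<kappa> \<kappa>1" "bad (set \<kappa>1)" "\<forall>i<c. \<kappa>1 ! i \<subseteq> V - h"
    using one[OF compl_halfspace[OF h(1)]] h(4) transverse_compl[OF h(1) _ h(2)] S(2)
    by (metis subsetD)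
  obtain \<kappa>2 where \<kappa>2: "covers \<kappa> \<kappa>2" "bad (set \<kappa>2)" "\<forall>i<c. \<kappa>2 ! i \<subseteq> h" using one[OF h(1-3)] by metis
  have "good \<kappa> h" unfolding good_def using h(1) sd[OF \<kappa>1] sd[OF \<kappa>2] by simp
  then show ?thesis using that[OF \<kappa>2(1,2)] \<kappa>2(3) by metis
qed

end

section \<open>Halfspaces that accumulate near a vertex\<close>

context caging_counterexample
begin

text \<open>
  Starting at \<open>y\<close>, leave the members of the cover one by one, each time walking towards the
  complement of the next; this keeps the vertex on the carriers already treated, since the members
  cross. Then walk to the complement of each member of \<open>\<kappa>\<close>, stopping in front of it: as nothing
  lies strictly between \<open>\<kappa>' ! i\<close> and \<open>\<kappa> ! i\<close>, the carriers of the complements of \<open>\<kappa>'\<close> are kept.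
  All these walks move towards halfspaces crossed by \<open>m\<close>, so they do not increase the distance to
  \<open>m\<close>.
\<close>

lemma transport:
  assumes cl: "crossing_list \<kappa>" and cov: "covers \<kappa> \<kappa>'" and y: "y \<in> corner (set \<kappa>')"
  obtains y' where "y' \<in> corner (set \<kappa> \<union> (\<lambda>k. V - k) ` set \<kappa>')"
    "\<And>m. m \<in> HS \<Longrightarrow> y \<notin> m \<Longrightarrow> (\<And>i. i < length \<kappa> \<Longrightarrow> transverse m (\<kappa> ! i)) \<Longrightarrow>
       (\<And>i. i < length \<kappa> \<Longrightarrow> transverse m (\<kappa>' ! i)) \<Longrightarrow>
       y' \<notin> m \<and> halfspace_distance y' m \<le> halfspace_distance y m"
proof -
  let ?n = "length \<kappa>" and ?k = "\<lambda>i. \<kappa> ! i" and ?k' = "\<lambda>i. \<kappa>' ! i" and ?c = "\<lambda>i. V - \<kappa>' ! i"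
  have len: "length \<kappa>' = ?n" and cl': "crossing_list \<kappa>'"
    and sm: "\<And>i. i < ?n \<Longrightarrow> ?k' i \<subset> ?k i"
    and nb: "\<And>i. i < ?n \<Longrightarrow> \<not> (\<exists>m\<in>HS. ?k' i \<subset> m \<and> m \<subset> ?k i)"
    and tr: "\<And>i j. i < ?n \<Longrightarrow> j < ?n \<Longrightarrow> i \<noteq> j \<Longrightarrow> transverse (?k' i) (?k j)"
    using cov unfolding covers_def by auto
  have kHS: "?k i \<in> HS" "?k' i \<in> HS" if "i < ?n" for i
    using cl cl' that len unfolding crossing_list_def by auto
  have trk: "transverse (?k i) (?k j)" "transverse (?k' i) (?k' j)" if "i < ?n" "j < ?n" "i \<noteq> j" for i j
    using cl cl' that len unfolding crossing_list_def by auto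
  define P where "P z \<longleftrightarrow> z \<in> V \<and> (\<forall>m\<in>HS. y \<notin> m \<longrightarrow> (\<forall>i<?n. transverse m (?k i)) \<longrightarrow>
       (\<forall>i<?n. transverse m (?k' i)) \<longrightarrow> z \<notin> m \<and> halfspace_distance z m \<le> halfspace_distance y m)" for z
  have Pstep: "P z'" if Pz: "P z" and tow: "toward (V - k) z z'" and k: "k \<in> HS"
    and kk: "\<exists>i<?n. k = ?k i \<or> k = ?k' i" and z'V: "z' \<in> V" for z z' k
    unfolding P_def
  proof (intro conjI ballI impI z'V)
    fix m assume m: "m \<in> HS" "y \<notin> m" "\<forall>i<?n. transverse m (?k i)" "\<forall>i<?n. transverse m (?k' i)"
    then have tk: "transverse m k" using kk by auto
    have zV: "z \<in> V" and zm: "z \<notin> m" and d: "halfspace_distance z m \<le> halfspace_distance y m"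
      using Pz m unfolding P_def by auto
    have "(V - k) \<inter> m \<noteq> {}" "(V - k) - m \<noteq> {}"
      using tk halfspace_sub[OF m(1)] unfolding transverse_def by auto
    from toward_halfspace_distance[OF tow zV m(1) zm this] d
    show "z' \<notin> m" "halfspace_distance z' m \<le> halfspace_distance y m" by auto
  qed
  have yV: "y \<in> V" using y unfolding corner_def by auto
  \<comment> \<open>the members with index below \<open>a\<close> have been left, the others not yet\<close>
  define A where "A a = ?k' ` {a..<?n} \<union> ?c ` {..<a}" for a
  have AHS: "A a \<subseteq> HS" if "a \<le> ?n" for a unfolding A_def using kHS(2) compl_halfspace that by auto
  have "\<exists>z. z \<in> corner (A a) \<and> (\<forall>i<?n. z \<in> ?k i) \<and> P z" if "a \<le> ?n" for a
    using that
  proof (induction a)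
    case 0
    have "A 0 = set \<kappa>'" unfolding A_def set_nth[of \<kappa>'] len by auto
    moreover have "y \<in> ?k i" if "i < ?n" for i
    proof -
      have "?k' i \<in> set \<kappa>'" using that len by auto
      then have "y \<in> pc (?k' i)" using y unfolding corner_def by auto
      then show ?thesis using pc_sub sm[OF that] by blast
    qed
    ultimately show ?case using y yV unfolding P_def by auto
  next
    case (Suc a)
    then have a: "a < ?n" by simp
    obtain z where z: "z \<in> corner (A a)" "\<forall>i<?n. z \<in> ?k i" "P z" using Suc by auto
    let ?S = "?k' ` {Suc a..<?n} \<union> ?c ` {..<a}"
    have "{a..<?n} = insert a {Suc a..<?n}" using a by auto
    then have Aa: "A a = insert (?k' a) ?S" unfolding A_def by auto
    have ASuc: "A (Suc a) = insert (?c a) ?S" unfolding A_def by (auto simp: lessThan_Suc)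
    have SHS: "?S \<subseteq> HS" using AHS[of a] a Aa by auto
    have zS: "z \<in> corner ?S" using z(1) unfolding Aa corner_def by auto
    have "z \<in> pc (?k' a)" using z(1) unfolding Aa corner_def by auto
    then have zq: "z \<notin> ?c a" using pc_sub by auto
    have cHS: "?c a \<in> HS" using compl_halfspace kHS(2)[OF a] .
    have cond: "?c a \<inter> s \<noteq> {} \<and> \<not> ?c a \<subseteq> s" if s: "s \<in> ?S" for s
    proof -
      have "\<exists>i. i < ?n \<and> i \<noteq> a \<and> (s = ?k' i \<or> s = ?c i)" using s
      proof (elim UnE imageE)
        fix i assume "s = ?k' i" "i \<in> {Suc a..<?n}"
        then show ?thesis by (intro exI[of _ i]) auto
      next
        fix i assume "s = ?c i" "i \<in> {..<a}"
        then show ?thesis using a by (intro exI[of _ i]) auto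
      qed
      then obtain i where i: "i < ?n" "i \<noteq> a" "s = ?k' i \<or> s = ?c i" by (elim exE conjE)
      have "transverse (?c a) (?k' i)"
        using transverse_compl[OF kHS(2)[OF a] kHS(2)[OF i(1)] trk(2)[OF a i(1)]] i(2) by auto
      moreover from this have "transverse (?c a) (?c i)"
        using transverse_compl2[OF cHS kHS(2)[OF i(1)]] by simp
      ultimately show ?thesis using i(3) unfolding transverse_def by blast
    qed
    obtain z' where z': "z' \<in> corner ?S" "z' \<in> pc (?c a)" "toward (?c a) z z'"
      by (rule enter[OF cHS SHS zS zq cond])
    have "z' \<in> corner (A (Suc a))" using z'(1,2) unfolding ASuc corner_def by auto
    moreover have "z' \<in> ?k i" if i: "i < ?n" for i
    proof (rule toward_stay[OF z'(3) kHS(1)[OF i]])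
      show "z \<in> ?k i" using z(2) i by simp
      show "?c a \<inter> ?k i \<noteq> {}"
      proof (cases "i = a")
        case True then show ?thesis using sm[OF a] halfspace_sub[OF kHS(1)[OF a]] by blast
      next
        case False
        then show ?thesis using tr[OF a i] halfspace_sub[OF kHS(1)[OF i]] unfolding transverse_def by blast
      qed
    qed
    moreover have "P z'"
    proof (rule Pstep[OF z(3) z'(3) kHS(2)[OF a]])
      show "\<exists>i<?n. ?k' a = ?k i \<or> ?k' a = ?k' i" using a by auto
      show "z' \<in> V" using z'(1) unfolding corner_def by auto
    qed
    ultimately show ?case by auto
  qed
  from this[of ?n] obtain z0 where z0: "z0 \<in> corner (?c ` {..<?n})" "\<forall>i<?n. z0 \<in> ?k i" "P z0"
    unfolding A_def by auto
  \<comment> \<open>the members of \<open>\<kappa>\<close> with index below \<open>a\<close> have been approached from inside\<close>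
  define B where "B a = ?c ` {..<?n} \<union> ?k ` {..<a}" for a
  have BHS: "B a \<subseteq> HS" if "a \<le> ?n" for a unfolding B_def using kHS compl_halfspace that by auto
  have "\<exists>z. z \<in> corner (B a) \<and> (\<forall>i<?n. z \<in> ?k i) \<and> P z" if "a \<le> ?n" for a
    using that
  proof (induction a)
    case 0
    then show ?case using z0 unfolding B_def by auto
  next
    case (Suc a)
    then have a: "a < ?n" by simp
    obtain z where z: "z \<in> corner (B a)" "\<forall>i<?n. z \<in> ?k i" "P z" using Suc by auto
    have zq: "z \<notin> V - ?k a" using z(2) a by auto
    have qHS: "V - ?k a \<in> HS" using compl_halfspace kHS(1)[OF a] .
    have BaHS: "B a \<subseteq> HS" using BHS a by simp
    have ctr: "transverse (V - ?k a) (?k i)" if "i < ?n" "i \<noteq> a" for i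
      using transverse_compl[OF kHS(1)[OF a] kHS(1)[OF that(1)] trk(1)[OF a that(1)]] that(2) by auto
    have cond: "(V - ?k a) \<inter> s \<noteq> {} \<and> \<not> (\<exists>m\<in>HS. V - ?k a \<subset> m \<and> m \<subset> s)" if s: "s \<in> B a" for s
    proof (cases "s \<in> ?k ` {..<a}")
      case True
      then obtain i where i: "i < a" "s = ?k i" by auto
      then have "transverse (V - ?k a) s" using ctr[of i] a by auto
      then show ?thesis unfolding transverse_def by blast
    next
      case False
      then obtain i where i: "i < ?n" "s = ?c i" using s unfolding B_def by auto
      show ?thesis
      proof (cases "i = a")
        case True
        obtain u where u: "u \<in> V" "u \<notin> ?k a" using outside_exists[OF kHS(1)[OF a]] by auto
        then have "u \<in> (V - ?k a) \<inter> s" using i True sm[OF a] by auto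
        moreover have False if m: "m \<in> HS" "V - ?k a \<subset> m" "m \<subset> s" for m
        proof -
          have mV: "m \<subseteq> V" using halfspace_sub[OF m(1)] .
          have "V - m \<subset> ?k a" using m(2) halfspace_sub[OF kHS(1)[OF a]] mV by blast
          moreover have "?k' a \<subset> V - m" using m(3) i True halfspace_sub[OF kHS(2)[OF a]] mV by blast
          ultimately show False using nb[OF a] compl_halfspace[OF m(1)] by blast
        qed
        ultimately show ?thesis by blast
      next
        case False
        have "transverse (?k' i) (?k a)" using tr[OF i(1) a False] .
        then have "transverse (V - ?k a) s"
          using transverse_compl[OF kHS(2)[OF i(1)] kHS(1)[OF a]] transverse_compl2[OF compl_halfspace[OF kHS(2)[OF i(1)]] kHS(1)[OF a]]
            transverse_sym i(2) by metis
        then show ?thesis unfolding transverse_def by blast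
      qed
    qed
    obtain z' where z': "z' \<in> corner (B a)" "z' \<in> pc (V - (V - ?k a))" "toward (V - ?k a) z z'"
      by (rule approach[OF qHS BaHS z(1) zq cond])
    have z'p: "z' \<in> pc (?k a)" using z'(2) compl_compl[OF kHS(1)[OF a]] by simp
    have "B (Suc a) = insert (?k a) (B a)" unfolding B_def by (auto simp: lessThan_Suc)
    then have "z' \<in> corner (B (Suc a))" using z'(1) z'p unfolding corner_def by auto
    moreover have "z' \<in> ?k i" if i: "i < ?n" for i
    proof (cases "i = a")
      case True then show ?thesis using z'p pc_sub by auto
    next
      case False
      show ?thesis
        by (rule toward_stay[OF z'(3) kHS(1)[OF i]]) (use z(2) i ctr[OF i False] in \<open>auto simp: transverse_def\<close>)
    qed
    moreover have "P z'"
    proof (rule Pstep[OF z(3) z'(3) kHS(1)[OF a]])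
      show "\<exists>i<?n. ?k a = ?k i \<or> ?k a = ?k' i" using a by auto
      show "z' \<in> V" using z'(1) unfolding corner_def by auto
    qed
    ultimately show ?case by auto
  qed
  from this[of ?n] obtain y' where y': "y' \<in> corner (B ?n)" "P y'" by auto
  have "B ?n = set \<kappa> \<union> (\<lambda>k. V - k) ` set \<kappa>'"
    unfolding B_def set_nth[of \<kappa>] set_nth[of \<kappa>'] len by (auto simp: image_image)
  then show ?thesis using that[of y'] y' unfolding P_def by auto
qed

lemma automorphism_crossing_list:
  assumes "automorphism g" "crossing_list \<kappa>" shows "crossing_list (map ((`) g) \<kappa>)"
proof -
  have "transverse (g ` (\<kappa> ! i)) (g ` (\<kappa> ! j))" if "i < length \<kappa>" "j < length \<kappa>" "i \<noteq> j" for i j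
  proof -
    have "\<kappa> ! i \<in> HS" "\<kappa> ! j \<in> HS" "transverse (\<kappa> ! i) (\<kappa> ! j)"
      using assms(2) that unfolding crossing_list_def by auto
    then show ?thesis using automorphism_transverse[OF assms(1)] by simp
  qed
  then show ?thesis using assms(2) automorphism_halfspace[OF assms(1)]
    unfolding crossing_list_def by auto
qed

lemma automorphism_side:
  assumes g: "automorphism g" and \<kappa>: "set \<kappa> \<subseteq> HS" and h: "h \<subseteq> V" and s: "side \<kappa> h"
  shows "side (map ((`) g) \<kappa>) (g ` h)"
proof -
  obtain \<kappa>' where \<kappa>': "length \<kappa>' = length \<kappa>" "crossing_list \<kappa>'" "infinite (sector (set \<kappa>'))"
    "\<And>i. i < length \<kappa> \<Longrightarrow> \<kappa>' ! i \<subset> \<kappa> ! i" "\<And>i. i < length \<kappa> \<Longrightarrow> \<kappa>' ! i \<subseteq> h"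
    using s unfolding side_def by metis
  have HS': "set \<kappa>' \<subseteq> HS" using \<kappa>'(2) unfolding crossing_list_def by simp
  have "sector (set (map ((`) g) \<kappa>')) = g ` sector (set \<kappa>')"
    using automorphism_sector[OF g HS'] by simp
  moreover have "inj_on g (sector (set \<kappa>'))"
    using automorphism_inj[OF g] unfolding sector_def by (auto intro: inj_on_subset)
  ultimately have "infinite (sector (set (map ((`) g) \<kappa>')))" using \<kappa>'(3) finite_imageD by fastforce
  moreover have "map ((`) g) \<kappa>' ! i \<subset> map ((`) g) \<kappa> ! i \<and> map ((`) g) \<kappa>' ! i \<subseteq> g ` h"
    if i: "i < length \<kappa>" for i
  proof -
    have "\<kappa> ! i \<subseteq> V" "\<kappa>' ! i \<subseteq> V" using \<kappa> HS' i \<kappa>'(1) halfspace_sub by (metis nth_mem subsetD)+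
    then show ?thesis
      using automorphism_psubset[OF g, of "\<kappa>' ! i" "\<kappa> ! i"] \<kappa>'(4,5)[OF i] i \<kappa>'(1) by auto
  qed
  ultimately show ?thesis
    unfolding side_def using automorphism_crossing_list[OF g \<kappa>'(2)] \<kappa>'(1)
    by (intro exI[of _ "map ((`) g) \<kappa>'"]) simp
qed

text \<open>
  A good halfspace at distance at most \<open>r\<close> from \<open>y\<close> has the whole family \<open>\<kappa>'\<close> on one side and so
  is not crossed by its members. Either side may occur, since members of \<open>near r y\<close> do not contain
  \<open>y\<close>.
\<close>

definition detects :: "nat \<Rightarrow> 'v \<Rightarrow> 'v set list \<Rightarrow> 'v set list \<Rightarrow> bool" where
  "detects r y \<kappa> \<kappa>' \<longleftrightarrow> (\<exists>h. good \<kappa> h \<and> h \<in> near r y \<and>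
     ((\<forall>i<length \<kappa>. \<kappa>' ! i \<subseteq> h) \<or> (\<forall>i<length \<kappa>. \<kappa>' ! i \<subseteq> V - h)))"

lemma automorphism_detects:
  assumes g: "automorphism g" and y: "y \<in> V" and \<kappa>: "set \<kappa> \<subseteq> HS" "length \<kappa>' = length \<kappa>"
    and d: "detects r y \<kappa> \<kappa>'"
  shows "detects r (g y) (map ((`) g) \<kappa>) (map ((`) g) \<kappa>')"
proof -
  obtain h where h: "good \<kappa> h" "h \<in> near r y"
    "(\<forall>i<length \<kappa>. \<kappa>' ! i \<subseteq> h) \<or> (\<forall>i<length \<kappa>. \<kappa>' ! i \<subseteq> V - h)"
    using d unfolding detects_def by metis
  have hHS: "h \<in> HS" and sh: "side \<kappa> h" "side \<kappa> (V - h)" using h(1) unfolding good_def by auto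
  have hV: "h \<subseteq> V" using halfspace_sub[OF hHS] .
  have c: "g ` (V - h) = V - g ` h" using automorphism_compl[OF g hV] .
  have "good (map ((`) g) \<kappa>) (g ` h)"
    unfolding good_def c[symmetric]
    using automorphism_side[OF g \<kappa>(1) hV sh(1)] automorphism_side[OF g \<kappa>(1) _ sh(2)]
      automorphism_halfspace[OF g hHS] by auto
  moreover have "g ` h \<in> near r (g y)" using automorphism_near[OF g y] h(2) by auto
  moreover have "(\<forall>i<length \<kappa>. g ` (\<kappa>' ! i) \<subseteq> g ` h) \<or> (\<forall>i<length \<kappa>. g ` (\<kappa>' ! i) \<subseteq> V - g ` h)"
    using h(3) unfolding c[symmetric] by (metis image_mono)
  ultimately show ?thesis unfolding detects_def using \<kappa>(2) by (intro exI[of _ "g ` h"]) simp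
qed

text \<open>
  The families are adjacent to \<open>y\<close>, so up to automorphisms there are finitely many configurations.
  For each of them that is detected at all, take the least radius.
\<close>

lemma uniform_detection:
  obtains r where "\<And>y \<kappa> \<kappa>' r0. y \<in> V \<Longrightarrow> length \<kappa> = c \<Longrightarrow> length \<kappa>' = c \<Longrightarrow> set \<kappa> \<subseteq> adjacent y \<Longrightarrow>
    (\<lambda>k. V - k) ` set \<kappa>' \<subseteq> adjacent y \<Longrightarrow> set \<kappa>' \<subseteq> HS \<Longrightarrow> detects r0 y \<kappa> \<kappa>' \<Longrightarrow> detects r y \<kappa> \<kappa>'"
proof -
  obtain V0 where V0: "finite V0" "V0 \<subseteq> V" "\<forall>x\<in>V. \<exists>g. automorphism g \<and> g x \<in> V0" using cocompact by auto
  define T where "T = (\<Union>x\<in>V0. {x} \<times> {\<kappa>. set \<kappa> \<subseteq> adjacent x \<and> length \<kappa> = c} \<times>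
      {\<kappa>. set \<kappa> \<subseteq> (\<lambda>k. V - k) ` adjacent x \<and> length \<kappa> = c})"
  have finT: "finite T" unfolding T_def
    using V0 finite_adjacent by (intro finite_UN_I finite_cartesian_product finite_lists_length_eq) auto
  \<comment> \<open>arbitrary for configurations that are never detected\<close>
  define R where "R = (\<lambda>(x, \<kappa>, \<kappa>'). LEAST r. detects r x \<kappa> \<kappa>')"
  define r where "r = Max (insert 0 (R ` T))"
  have mono: "detects r' x \<kappa> \<kappa>'" if "detects r1 x \<kappa> \<kappa>'" "r1 \<le> r'" for r1 r' x \<kappa> \<kappa>'
    using that unfolding detects_def near_def by fastforce
  have "detects r y \<kappa> \<kappa>'" if y: "y \<in> V" and len: "length \<kappa> = c" "length \<kappa>' = c"
    and adj: "set \<kappa> \<subseteq> adjacent y" "(\<lambda>k. V - k) ` set \<kappa>' \<subseteq> adjacent y" and HS': "set \<kappa>' \<subseteq> HS"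
    and d: "detects r0 y \<kappa> \<kappa>'" for y \<kappa> \<kappa>' r0
  proof -
    obtain g where g: "automorphism g" "g y \<in> V0" using V0 y by auto
    let ?g = "\<lambda>\<kappa>. map ((`) g) \<kappa>"
    have \<kappa>HS: "set \<kappa> \<subseteq> HS" using adj(1) unfolding adjacent_def by auto
    have len': "length \<kappa>' = length \<kappa>" using len by simp
    have d1: "detects r0 (g y) (?g \<kappa>) (?g \<kappa>')" using automorphism_detects[OF g(1) y \<kappa>HS len' d] .
    have "set (?g \<kappa>) \<subseteq> adjacent (g y)" using adj(1) automorphism_adjacent[OF g(1) y] by auto
    moreover have "set (?g \<kappa>') \<subseteq> (\<lambda>k. V - k) ` adjacent (g y)"
    proof
      fix k assume "k \<in> set (?g \<kappa>')"
      then obtain k0 where k0: "k0 \<in> set \<kappa>'" "k = g ` k0" by auto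
      have k0HS: "k0 \<in> HS" using k0 HS' by auto
      have "V - k = g ` (V - k0)" using automorphism_compl[OF g(1) halfspace_sub[OF k0HS]] k0(2) by simp
      moreover have "V - k0 \<in> adjacent y" using adj(2) k0(1) by blast
      ultimately have "V - k \<in> adjacent (g y)" using automorphism_adjacent[OF g(1) y] by simp
      moreover have "k = V - (V - k)"
        using compl_compl[OF automorphism_halfspace[OF g(1) k0HS]] k0(2) by simp
      ultimately show "k \<in> (\<lambda>k. V - k) ` adjacent (g y)" by blast
    qed
    ultimately have inT: "(g y, ?g \<kappa>, ?g \<kappa>') \<in> T" unfolding T_def using g(2) len by auto
    have "detects (R (g y, ?g \<kappa>, ?g \<kappa>')) (g y) (?g \<kappa>) (?g \<kappa>')"
      unfolding R_def using LeastI[of "\<lambda>r. detects r (g y) (?g \<kappa>) (?g \<kappa>')", OF d1] by simp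
    moreover have "R (g y, ?g \<kappa>, ?g \<kappa>') \<le> r" unfolding r_def using finT inT by (intro Max_ge) auto
    ultimately have d2: "detects r (g y) (?g \<kappa>) (?g \<kappa>')" using mono by metis
    let ?f = "inv_into V g"
    have f: "automorphism ?f" using automorphism_inverse[OF g(1)] .
    have gHS: "set (?g \<kappa>) \<subseteq> HS" using \<kappa>HS automorphism_halfspace[OF g(1)] by auto
    have "detects r (?f (g y)) (map ((`) ?f) (?g \<kappa>)) (map ((`) ?f) (?g \<kappa>'))"
      by (rule automorphism_detects[OF f automorphism_vertex[OF g(1) y] gHS _ d2]) (simp add: len)
    moreover have "?f (g y) = y" using automorphism_inj[OF g(1)] y by simp
    moreover have inv: "map ((`) ?f) (?g l) = l" if "set l \<subseteq> HS" for l
    proof -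
      have "?f ` (g ` k) = k" if "k \<in> set l" for k
        by (rule inv_into_image_cancel[OF automorphism_inj[OF g(1)] halfspace_sub]) (use \<open>set l \<subseteq> HS\<close> that in auto)
      then show ?thesis by (auto intro: map_idI)
    qed
    ultimately show ?thesis using inv[OF \<kappa>HS] inv[OF HS'] by simp
  qed
  then show ?thesis using that by blast
qed

text \<open>
  The quantity that leads to the contradiction is the number of halfspaces within distance \<open>r\<close> of
  a vertex that cross all families up to stage \<open>n\<close>. When \<open>transport\<close> leads from the corner of
  family \<open>n + 1\<close> to the corner of family \<open>n\<close>, it increases by one at least, because of a halfspace
  crossing family \<open>n\<close> but not the next. Starting far out, it exceeds the bound on the number of
  halfspaces near a vertex.
\<close>

lemma no_counterexample: False
proof -
  define step where "step \<kappa> \<kappa>' \<longleftrightarrow> covers \<kappa> \<kappa>' \<and> (\<exists>h. good \<kappa> h \<and> (\<forall>i<c. \<kappa>' ! i \<subseteq> h))" for \<kappa> \<kappa>'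
  have start: "\<exists>\<kappa>. crossing_list \<kappa> \<and> bad (set \<kappa>) \<and> length \<kappa> = c"
  proof -
    obtain K where K: "bad K" "card K = c" using attained by auto
    obtain \<kappa>0 where "set \<kappa>0 = K" "distinct \<kappa>0" using finite_distinct_list[OF bad_finite[OF K(1)]] by auto
    then have k0: "distinct \<kappa>0" "bad (set \<kappa>0)" "length \<kappa>0 = c" using K distinct_card[of \<kappa>0] by simp_all
    show ?thesis using good_covers_exists[OF k0] k0(3) unfolding covers_def by metis
  qed
  have "\<exists>f. \<forall>n. (crossing_list (f n) \<and> bad (set (f n)) \<and> length (f n) = c) \<and> step (f n) (f (Suc n))"
  proof (rule dependent_nat_choice)
    show "\<exists>\<kappa>. crossing_list \<kappa> \<and> bad (set \<kappa>) \<and> length \<kappa> = c" by (rule start)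
    fix \<kappa> and n :: nat assume k: "crossing_list \<kappa> \<and> bad (set \<kappa>) \<and> length \<kappa> = c"
    then obtain \<kappa>' h where "covers \<kappa> \<kappa>'" "bad (set \<kappa>')" "good \<kappa> h" "\<And>i. i < c \<Longrightarrow> \<kappa>' ! i \<subseteq> h"
      using good_covers_exists[OF crossing_list_distinct] by metis
    then show "\<exists>\<kappa>'. (crossing_list \<kappa>' \<and> bad (set \<kappa>') \<and> length \<kappa>' = c) \<and> step \<kappa> \<kappa>'"
      using k unfolding step_def covers_def by metis
  qed
  then obtain f where cl: "\<And>n. crossing_list (f n)" and bad: "\<And>n. bad (set (f n))"
    and len: "\<And>n. length (f n) = c" and st: "\<And>n. step (f n) (f (Suc n))" by metis
  have cov: "covers (f n) (f (Suc n))" for n using st unfolding step_def by metis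
  have fHS: "set (f n) \<subseteq> HS" for n using bad_halfspaces[OF bad] .
  have dec: "f n ! a \<subseteq> f m ! a" if "m \<le> n" "a < c" for m n a
    using that(1)
  proof (induction n rule: dec_induct)
    case (step n)
    have "f (Suc n) ! a \<subset> f n ! a" using cov[of n] that(2) len unfolding covers_def by simp
    then show ?case using step by auto
  qed simp
  obtain r where r: "\<And>y \<kappa> \<kappa>' r0. y \<in> V \<Longrightarrow> length \<kappa> = c \<Longrightarrow> length \<kappa>' = c \<Longrightarrow> set \<kappa> \<subseteq> adjacent y \<Longrightarrow>
    (\<lambda>k. V - k) ` set \<kappa>' \<subseteq> adjacent y \<Longrightarrow> set \<kappa>' \<subseteq> HS \<Longrightarrow> detects r0 y \<kappa> \<kappa>' \<Longrightarrow> detects r y \<kappa> \<kappa>'"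
    using uniform_detection by metis
  obtain b where b: "\<And>x. x \<in> V \<Longrightarrow> card (near r x) \<le> b" using bounded_near[of r] by metis
  \<comment> \<open>the halfspaces near \<open>y\<close> that cross all families up to stage \<open>n\<close>\<close>
  define N where "N n y = {m \<in> near r y. \<forall>l\<le>n. \<forall>a<c. transverse m (f l ! a)}" for n y
  \<comment> \<open>the gain of one halfspace per stage, in terms of the vertices matched by \<open>transport\<close>\<close>
  have drop: "\<exists>y'\<in>corner (set (f n)). card (N (Suc n) y) < card (N n y')"
    if y: "y \<in> corner (set (f (Suc n)))" for n y
  proof -
    obtain y' where y': "y' \<in> corner (set (f n) \<union> (\<lambda>k. V - k) ` set (f (Suc n)))"
      and carry: "\<And>m. m \<in> HS \<Longrightarrow> y \<notin> m \<Longrightarrow> (\<And>i. i < length (f n) \<Longrightarrow> transverse m (f n ! i)) \<Longrightarrow>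
       (\<And>i. i < length (f n) \<Longrightarrow> transverse m (f (Suc n) ! i)) \<Longrightarrow>
       y' \<notin> m \<and> halfspace_distance y' m \<le> halfspace_distance y m"
      using transport[OF cl cov y] by metis
    have y'V: "y' \<in> V" and y'c: "y' \<in> corner (set (f n))" using y' unfolding corner_def by auto
    have "N (Suc n) y \<subseteq> N n y'"
    proof
      fix m assume m: "m \<in> N (Suc n) y"
      then have m': "m \<in> HS" "y \<notin> m" "halfspace_distance y m \<le> r"
        and t: "\<And>l a. l \<le> Suc n \<Longrightarrow> a < c \<Longrightarrow> transverse m (f l ! a)" unfolding N_def near_def by auto
      have "y' \<notin> m \<and> halfspace_distance y' m \<le> halfspace_distance y m"
        by (rule carry[OF m'(1,2)]) (use t len in auto)
      then show "m \<in> N n y'" using m' t unfolding N_def near_def by auto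
    qed
    moreover obtain h where h: "h \<in> N n y'" "h \<notin> N (Suc n) y"
    proof -
      obtain h0 where h0: "good (f n) h0" "\<forall>i<c. f (Suc n) ! i \<subseteq> h0" using st unfolding step_def by metis
      have "\<exists>r0. detects r0 y' (f n) (f (Suc n))"
      proof (cases "y' \<in> h0")
        case False
        then have "h0 \<in> near (halfspace_distance y' h0) y'" using h0(1) unfolding near_def good_def by simp
        then show ?thesis unfolding detects_def using h0 len by metis
      next
        case True
        have h0HS: "h0 \<in> HS" using h0(1) unfolding good_def by simp
        have "V - h0 \<in> near (halfspace_distance y' (V - h0)) y'"
          using True compl_halfspace[OF h0HS] unfolding near_def by simp
        moreover have "good (f n) (V - h0)"
          using h0(1) compl_halfspace[OF h0HS] compl_compl[OF h0HS] unfolding good_def by simp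
        ultimately show ?thesis unfolding detects_def using h0(2) len compl_compl[OF h0HS] by metis
      qed
      then obtain r0 where r0: "detects r0 y' (f n) (f (Suc n))" by auto
      have "set (f n) \<subseteq> adjacent y'" using y' fHS[of n] unfolding corner_def adjacent_def by auto
      moreover have "(\<lambda>k. V - k) ` set (f (Suc n)) \<subseteq> adjacent y'"
        using y' fHS[of "Suc n"] compl_halfspace unfolding corner_def adjacent_def by auto
      ultimately have "detects r y' (f n) (f (Suc n))" using r[OF y'V len len _ _ fHS r0] by simp
      then obtain h where h: "good (f n) h" "h \<in> near r y'"
        "(\<forall>i<c. f (Suc n) ! i \<subseteq> h) \<or> (\<forall>i<c. f (Suc n) ! i \<subseteq> V - h)" unfolding detects_def len by metis
      have "transverse h (f l ! a)" if "l \<le> n" "a < c" for l a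
        by (rule good_transverse[OF h(1) len bad len _ that(2)]) (rule dec[OF that(1)])
      then have "h \<in> N n y'" using h(2) unfolding N_def by simp
      moreover have "\<not> transverse h (f (Suc n) ! 0)"
      proof -
        have "0 < c" using bad_card_at_least_two by simp
        then have "f (Suc n) ! 0 \<subseteq> h \<or> f (Suc n) ! 0 \<subseteq> V - h" using h(3) by blast
        then show ?thesis unfolding transverse_def by blast
      qed
      then have "h \<notin> N (Suc n) y" unfolding N_def using bad_card_at_least_two by fastforce
      ultimately show ?thesis using that by simp
    qed
    ultimately have "N (Suc n) y \<subset> N n y'" by auto
    moreover have "finite (N n y')" using finite_near[OF y'V] unfolding N_def by simp
    ultimately show ?thesis using psubset_card_mono y'c by metis
  qed
  have "\<exists>x\<in>V. card (N n y) + n \<le> card (near r x)" if "y \<in> corner (set (f n))" for n y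
    using that
  proof (induction n arbitrary: y)
    case 0
    have yV: "y \<in> V" using 0 unfolding corner_def by auto
    have "card (N 0 y) \<le> card (near r y)" by (rule card_mono[OF finite_near[OF yV]]) (auto simp: N_def)
    then show ?case using yV by auto
  next
    case (Suc n)
    obtain y' where "y' \<in> corner (set (f n))" "card (N (Suc n) y) < card (N n y')" using drop[OF Suc.prems] by auto
    moreover from this obtain x where "x \<in> V" "card (N n y') + n \<le> card (near r x)" using Suc.IH[of y'] by auto
    ultimately show ?case by (intro bexI[of _ x]) auto
  qed
  moreover obtain y where "y \<in> corner (set (f (Suc b)))" using bad[of "Suc b"] unfolding bad_def by auto
  ultimately obtain x where "x \<in> V" "card (N (Suc b) y) + Suc b \<le> card (near r x)" by blast
  then show False using b[of x] by simp
qed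

end

section \<open>The three conditions for halfspace systems\<close>

context halfspace_system
begin

lemma vertex_uf_not_boundary:
  assumes "w \<in> V" shows "vertex_uf w \<notin> boundary"
proof
  assume "vertex_uf w \<in> boundary"
  then obtain s :: "nat \<Rightarrow> 'v set" where s: "\<And>n. s n \<in> vertex_uf w" "\<And>n. s (Suc n) \<subset> s n"
    using boundary_chain by metis
  have "s n \<in> HS" "w \<in> s n" for n using s(1)[of n] unfolding vertex_uf_def by auto
  then show False using chain_escapes[of s w] s(2) assms by (metis order_refl)
qed

text \<open>
  Hence the ultrafilter of a vertex is an isolated point when there are finitely many adjacent
  halfspaces.
\<close>

lemma uf_containing_adjacent:
  assumes "\<alpha> \<in> UF" "w \<in> V" "adjacent w \<subseteq> \<alpha>" shows "\<alpha> = vertex_uf w"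
proof -
  have mem: "h \<in> \<alpha>" if h: "h \<in> HS" "w \<in> h" for h
  proof -
    obtain n y where n: "step_out w n y" "n \<subseteq> h" using first_step_out[OF h] .
    then have "n \<in> adjacent w" using step_out_pc[OF n(1)] unfolding adjacent_def step_out_def by simp
    then show ?thesis using uf_up[OF assms(1) _ h(1) n(2)] assms(3) by auto
  qed
  have "w \<in> h" if h: "h \<in> \<alpha>" for h
  proof (rule ccontr)
    assume "w \<notin> h"
    have hHS: "h \<in> HS" using uf_sub[OF assms(1) h] .
    then have "V - h \<in> \<alpha>" using mem[OF compl_halfspace[OF hHS]] assms(2) \<open>w \<notin> h\<close> by simp
    then show False using uf_compl[OF assms(1) hHS] h by simp
  qed
  then show ?thesis using mem uf_sub[OF assms(1)] unfolding vertex_uf_def by auto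
qed

text \<open>
  Condition (1): the elements of \<open>boundary\<close> are limits of non-terminating ultrafilters.
\<close>

definition nonterminating_dense :: bool where
  "nonterminating_dense \<longleftrightarrow>
     (\<forall>\<beta>\<in>boundary. \<forall>M. finite M \<and> M \<subseteq> \<beta> \<longrightarrow> (\<exists>\<gamma>\<in>UF. non_terminating \<gamma> \<and> M \<subseteq> \<gamma>))"

text \<open>
  The hyperplane is given by one of its halfspaces, \<open>q\<close>. It is contained in \<open>m\<close> iff \<open>m\<close> contains
  one of its sides properly.
\<close>

definition hyperplane_inside :: "'v set \<Rightarrow> 'v set set \<Rightarrow> bool" where
  "hyperplane_inside q M \<longleftrightarrow> (\<forall>m\<in>M. q \<subset> m \<or> V - q \<subset> m)"

definition cages_filled :: bool where
  "cages_filled \<longleftrightarrow>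
     (\<forall>\<alpha>\<in>boundary. \<forall>K. K \<subseteq> \<alpha> \<and> corner K \<noteq> {} \<longrightarrow> (\<exists>q\<in>HS. hyperplane_inside q K))"

definition neighbourhoods_filled :: bool where
  "neighbourhoods_filled \<longleftrightarrow>
     (\<forall>\<alpha>\<in>boundary. \<forall>M. finite M \<and> M \<subseteq> \<alpha> \<longrightarrow> (\<exists>q\<in>HS. hyperplane_inside q M))"

text \<open>
  If some adjacent \<open>n \<subseteq> j\<close> is not in \<open>\<alpha>\<close>, cross its hyperplane. This does not leave the sector, as
  \<open>n\<close> is not in \<open>M\<close>, and decreases the number of halfspaces below \<open>M\<close> that contain the vertex but
  do not belong to \<open>\<alpha>\<close>.
\<close>

lemma uf_move_adjacent:
  assumes "\<alpha> \<in> UF" "finite M" "M \<subseteq> \<alpha>"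
  obtains w where "w \<in> sector M" "\<And>n. n \<in> adjacent w \<Longrightarrow> (\<exists>j\<in>M. n \<subseteq> j) \<Longrightarrow> n \<in> \<alpha>"
proof -
  obtain v where v: "v \<in> V" using vertex_exists by auto
  obtain w0 where w0: "w0 \<in> sector M" using uf_move[OF assms(1,3,2) v] by metis
  have "\<exists>w. w \<in> sector M \<and> (\<forall>n\<in>adjacent w. (\<exists>j\<in>M. n \<subseteq> j) \<longrightarrow> n \<in> \<alpha>)" if "u \<in> sector M" for u
    using that
  proof (induction "card {n \<in> HS. n \<notin> \<alpha> \<and> u \<in> n \<and> (\<exists>j\<in>M. n \<subseteq> j)}" arbitrary: u rule: less_induct)
    case less
    have uV: "u \<in> V" and uM: "\<And>j. j \<in> M \<Longrightarrow> u \<in> j" using less.prems unfolding sector_def by auto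
    show ?case
    proof (cases "\<forall>n\<in>adjacent u. (\<exists>j\<in>M. n \<subseteq> j) \<longrightarrow> n \<in> \<alpha>")
      case True then show ?thesis using less.prems by blast
    next
      case False
      then obtain n j where n: "n \<in> adjacent u" "j \<in> M" "n \<subseteq> j" "n \<notin> \<alpha>" by blast
      have nHS: "n \<in> HS" using n unfolding adjacent_def by simp
      obtain y where y: "step_out u n y" using pc_step_out[OF nHS] n(1) unfolding adjacent_def by auto
      have yV: "y \<in> V" "y \<notin> n" "u \<in> n" using y unfolding step_out_def by auto
      have yM: "y \<in> sector M"
      proof -
        have "y \<in> i" if i: "i \<in> M" for i
        proof (rule ccontr)
          assume "y \<notin> i"
          then have "i = n" using y uM[OF i] i assms uf_sub unfolding step_out_def by blast
          then show False using n(4) i assms(3) by auto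
        qed
        then show ?thesis using yV unfolding sector_def by auto
      qed
      have compl: "V - n \<in> \<alpha>" using uf_compl[OF assms(1) nHS] n(4) by simp
      have sb: "step_out y (V - n) u" using step_out_back[OF y] .
      have inu: "u \<in> m" if "m \<in> HS" "m \<notin> \<alpha>" "y \<in> m" for m
      proof (rule ccontr)
        assume "u \<notin> m"
        then have "m = V - n" using sb that unfolding step_out_def by blast
        then show False using compl that by simp
      qed
      let ?A = "\<lambda>u. {n \<in> HS. n \<notin> \<alpha> \<and> u \<in> n \<and> (\<exists>j\<in>M. n \<subseteq> j)}"
      have "?A y \<subset> ?A u"
      proof
        show "?A y \<subseteq> ?A u" using inu by auto
        have "n \<in> ?A u" "n \<notin> ?A y" using n nHS yV by auto
        then show "?A y \<noteq> ?A u" by metis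
      qed
      note smaller = this
      have fin: "finite (?A u)"
      proof (rule finite_subset)
        show "?A u \<subseteq> (\<Union>j\<in>M. {n \<in> HS. u \<in> n \<and> n \<subseteq> j})" by auto
        have "finite {n \<in> HS. u \<in> n \<and> n \<subseteq> j}" if j: "j \<in> M" for j
        proof -
          have jHS: "j \<in> HS" using j assms(3) uf_sub[OF assms(1)] by auto
          obtain x where x: "x \<in> V" "x \<notin> j" using outside_exists[OF jHS] by auto
          show ?thesis by (rule finite_subset[OF _ finite_separating[OF uV x(1)]]) (use x in auto)
        qed
        then show "finite (\<Union>j\<in>M. {n \<in> HS. u \<in> n \<and> n \<subseteq> j})" using assms(2) by auto
      qed
      from less.hyps[OF psubset_card_mono[OF fin smaller] yM] show ?thesis .
    qed
  qed
  from this[OF w0] show ?thesis using that by blast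
qed

text \<open>
  The cage consists of all members of \<open>\<alpha>\<close> adjacent to the vertex found by \<open>uf_move_adjacent\<close>; each
  \<open>j \<in> M\<close> contains a member of this cage.
\<close>

lemma neighbourhoods_filled_if_cages_filled:
  assumes cages_filled shows neighbourhoods_filled
  unfolding neighbourhoods_filled_def
proof (intro ballI allI impI)
  fix \<alpha> M assume a: "\<alpha> \<in> boundary" "finite M \<and> M \<subseteq> \<alpha>"
  have uf: "\<alpha> \<in> UF" using boundary_uf[OF a(1)] .
  obtain w where w: "w \<in> sector M" "\<And>n. n \<in> adjacent w \<Longrightarrow> (\<exists>j\<in>M. n \<subseteq> j) \<Longrightarrow> n \<in> \<alpha>"
    using uf_move_adjacent[OF uf] a(2) by metis
  define K where "K = adjacent w \<inter> \<alpha>"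
  have "w \<in> corner K" using w(1) unfolding K_def corner_def adjacent_def sector_def by auto
  then obtain q where q: "q \<in> HS" "hyperplane_inside q K"
    using assms a(1) unfolding cages_filled_def K_def by (metis Int_lower2 empty_iff)
  have "q \<subset> j \<or> V - q \<subset> j" if j: "j \<in> M" for j
  proof -
    have jHS: "j \<in> HS" and wj: "w \<in> j" using j a(2) uf_sub[OF uf] w(1) unfolding sector_def by auto
    obtain n y where n: "step_out w n y" "n \<subseteq> j" using first_step_out[OF jHS wj] .
    have "n \<in> adjacent w" using step_out_pc[OF n(1)] n(1) unfolding adjacent_def step_out_def by simp
    then have "n \<in> K" using w(2) j n(2) unfolding K_def by auto
    then have "q \<subset> n \<or> V - q \<subset> n" using q(2) unfolding hyperplane_inside_def by simp
    then show ?thesis using n(2) by (elim disjE) (auto dest: psubset_subset_trans)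
  qed
  then have "hyperplane_inside q M" unfolding hyperplane_inside_def by simp
  then show "\<exists>q\<in>HS. hyperplane_inside q M" using q(1) by (rule bexI)
qed

end

context essential_halfspace_system
begin

lemma cages_filled_if_neighbourhoods_filled:
  assumes neighbourhoods_filled shows cages_filled
  unfolding cages_filled_def
proof (intro ballI allI impI)
  fix \<alpha> K assume a: "\<alpha> \<in> boundary" "K \<subseteq> \<alpha> \<and> corner K \<noteq> {}"
  obtain b where "\<And>S. S \<subseteq> HS \<Longrightarrow> corner S \<noteq> {} \<Longrightarrow> finite S \<and> card S \<le> b" using corner_card by metis
  moreover have "K \<subseteq> HS" using a uf_sub[OF boundary_uf] by auto
  ultimately have "finite K" using a by simp
  then show "\<exists>q\<in>HS. hyperplane_inside q K" using assms a unfolding neighbourhoods_filled_def by metis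
qed

text \<open>
  A cage without a hyperplane inside is bad, since its sector is infinite. So a bad family of
  least size gives a counterexample in the sense of \<open>caging_counterexample\<close>.
\<close>

lemma cages_filled_if_nonterminating_dense:
  assumes nonterminating_dense shows cages_filled
proof (rule ccontr)
  assume "\<not> cages_filled"
  then obtain \<alpha> K where K: "\<alpha> \<in> boundary" "K \<subseteq> \<alpha>" "corner K \<noteq> {}" "\<And>q. q \<in> HS \<Longrightarrow> \<not> hyperplane_inside q K"
    unfolding cages_filled_def by metis
  have KHS: "K \<subseteq> HS" using K uf_sub[OF boundary_uf] by auto
  obtain b where "\<And>S. S \<subseteq> HS \<Longrightarrow> corner S \<noteq> {} \<Longrightarrow> finite S \<and> card S \<le> b" using corner_card by metis
  then have "finite K" using KHS K(3) by simp
  then have "infinite (sector K)" using sector_infinite[OF K(1,2)] by simp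
  moreover have False if "q \<in> HS" "\<And>k. k \<in> K \<Longrightarrow> q \<subset> k" for q
    using K(4)[OF that(1)] that(2) unfolding hyperplane_inside_def by metis
  ultimately have badK: "bad K" using badI[OF KHS K(3)] by metis
  define c where "c = (LEAST n. \<exists>K. bad K \<and> card K = n)"
  have ex: "\<exists>n. \<exists>K. bad K \<and> card K = n" using badK by metis
  interpret caging_counterexample V HS c
  proof
    show "\<exists>\<gamma>\<in>UF. non_terminating \<gamma> \<and> M \<subseteq> \<gamma>" if "\<beta> \<in> boundary" "finite M" "M \<subseteq> \<beta>" for \<beta> M
      using assms that unfolding nonterminating_dense_def by metis
    show "c \<le> card K" if "bad K" for K unfolding c_def using that by (intro Least_le) auto
    show "\<exists>K. bad K \<and> card K = c" unfolding c_def using ex by (rule LeastI_ex)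
  qed
  show False using no_counterexample .
qed

text \<open>
  Suppose that no halfspace below \<open>h\<close> is contained in \<open>e\<close> or in its complement. Then a descending
  chain below \<open>h\<close> has an accumulation point containing \<open>e\<close> and a member \<open>s 0\<close> of the chain; a
  hyperplane inside both has a side below \<open>s 0\<close>, which either lies in \<open>e\<close> or contains the
  complement of \<open>e\<close>. In the latter case this complement is itself below \<open>h\<close>.
\<close>

lemma deciding_halfspace:
  assumes nf: neighbourhoods_filled and h: "h \<in> HS" and e: "e \<in> HS"
  shows "\<exists>k\<in>HS. k \<subset> h \<and> (k \<subseteq> e \<or> k \<subseteq> V - e)"
proof (rule ccontr)
  assume no: "\<not> ?thesis"
  have meet: "k \<inter> e \<noteq> {}" if k: "k \<in> HS" "k \<subset> h" for k
  proof
    assume "k \<inter> e = {}"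
    then have "k \<subseteq> V - e" using halfspace_sub[OF k(1)] by auto
    then show False using no k by blast
  qed
  have "\<exists>s. \<forall>n::nat. (s n \<in> HS \<and> s n \<subset> h) \<and> s (Suc n) \<subset> s n"
  proof (rule dependent_nat_choice)
    show "\<exists>x. x \<in> HS \<and> x \<subset> h" using essential_below[OF h] by metis
    fix x and n :: nat assume x: "x \<in> HS \<and> x \<subset> h"
    then show "\<exists>y. (y \<in> HS \<and> y \<subset> h) \<and> y \<subset> x" using essential_below[of x] by (metis psubset_trans)
  qed
  then obtain s where s: "\<And>n::nat. s n \<in> HS" "\<And>n. s n \<subset> h" "\<And>n. s (Suc n) \<subset> s n" by metis
  have sdec: "s n \<subseteq> s 0" for n
    using decseq_SucI[of s] s(3) unfolding decseq_def by (simp add: psubset_imp_subset)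
  define Z where "Z = s 0 \<inter> e"
  have ZV: "Z \<subseteq> V" using halfspace_sub[OF e] unfolding Z_def by auto
  have infZ: "infinite Z"
  proof (rule chain_meets_infinite[of s Z 0, OF s(1,3) ZV])
    fix n show "Z \<inter> s n \<noteq> {}" using meet[OF s(1,2), of n] sdec[of n] unfolding Z_def by auto
  qed
  obtain \<beta> where \<beta>: "\<beta> \<in> boundary" "\<And>M. finite M \<Longrightarrow> M \<subseteq> \<beta> \<Longrightarrow> infinite (Z \<inter> sector M)"
    using accumulation[OF ZV infZ] by metis
  have "s 0 \<in> \<beta>" "e \<in> \<beta>"
    using accumulation_mem[OF boundary_uf[OF \<beta>(1)] \<beta>(2)] s(1) e unfolding Z_def by auto
  then have "finite {s 0, e} \<and> {s 0, e} \<subseteq> \<beta>" by simp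
  then obtain q where q: "q \<in> HS" "hyperplane_inside q {s 0, e}"
    using nf \<beta>(1) unfolding neighbourhoods_filled_def by metis
  have "\<exists>p\<in>HS. p \<subset> s 0 \<and> (p \<subset> e \<or> V - p \<subset> e)"
  proof (cases "q \<subset> s 0")
    case True then show ?thesis using q unfolding hyperplane_inside_def by auto
  next
    case False
    then show ?thesis using q compl_halfspace[OF q(1)] compl_compl[OF q(1)]
      unfolding hyperplane_inside_def by (intro bexI[of _ "V - q"]) auto
  qed
  then obtain p where p: "p \<in> HS" "p \<subset> s 0" "p \<subset> e \<or> V - p \<subset> e" by metis
  have ph: "p \<subset> h" using p(2) s(2)[of 0] by (rule psubset_trans)
  then have "\<not> p \<subseteq> e" using no p(1) by blast
  then have "V - p \<subset> e" using p(3) by auto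
  then have "V - e \<subset> p" using halfspace_sub[OF p(1)] halfspace_sub[OF e] by blast
  then have "V - e \<subset> h" using ph by (rule psubset_trans)
  then show False using no compl_halfspace[OF e] by blast
qed

text \<open>
  The halfspaces containing some member of a strictly descending chain form an ultrafilter if the
  chain decides all of them, and it is non-terminating because the chain is cofinal in it.
\<close>

lemma nonterminating_in_halfspace:
  assumes nf: neighbourhoods_filled and h: "h \<in> HS"
  shows "\<exists>\<gamma>\<in>UF. non_terminating \<gamma> \<and> h \<in> \<gamma>"
proof -
  define e where "e = from_nat_into HS"
  have e: "range e = HS" unfolding e_def using range_from_nat_into[OF _ countable_halfspaces] h by auto
  then have eHS: "e n \<in> HS" for n by auto
  have "\<exists>s. \<forall>n. (s n \<in> HS \<and> s n \<subseteq> h) \<and> (s (Suc n) \<subset> s n \<and> (s (Suc n) \<subseteq> e n \<or> s (Suc n) \<subseteq> V - e n))"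
  proof (rule dependent_nat_choice)
    show "\<exists>x. x \<in> HS \<and> x \<subseteq> h" using h by auto
    fix x n assume x: "x \<in> HS \<and> x \<subseteq> h"
    then obtain k where "k \<in> HS" "k \<subset> x" "k \<subseteq> e n \<or> k \<subseteq> V - e n"
      using deciding_halfspace[OF nf _ eHS] by metis
    then show "\<exists>y. (y \<in> HS \<and> y \<subseteq> h) \<and> y \<subset> x \<and> (y \<subseteq> e n \<or> y \<subseteq> V - e n)" using x by (metis psubset_imp_subset subset_trans)
  qed
  then obtain s where s: "\<And>n. s n \<in> HS" "\<And>n. s n \<subseteq> h" "\<And>n. s (Suc n) \<subset> s n"
    "\<And>n. s (Suc n) \<subseteq> e n \<or> s (Suc n) \<subseteq> V - e n" by metis
  have sdec: "s n \<subseteq> s m" if "m \<le> n" for m n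
    using decseq_SucI[of s] s(3) that unfolding decseq_def by (simp add: psubset_imp_subset)
  define \<gamma> where "\<gamma> = {k \<in> HS. \<exists>n. s n \<subseteq> k}"
  have "(k \<in> \<gamma>) \<noteq> (V - k \<in> \<gamma>)" if k: "k \<in> HS" for k
  proof -
    obtain n where "k = e n" using e k by (metis rangeE)
    then have "k \<in> \<gamma> \<or> V - k \<in> \<gamma>" using s(4)[of n] k compl_halfspace[OF k] unfolding \<gamma>_def by auto
    moreover have "\<not> (k \<in> \<gamma> \<and> V - k \<in> \<gamma>)"
    proof
      assume "k \<in> \<gamma> \<and> V - k \<in> \<gamma>"
      then obtain i j where "s i \<subseteq> k" "s j \<subseteq> V - k" unfolding \<gamma>_def by auto
      then have "s (max i j) \<subseteq> k" "s (max i j) \<subseteq> V - k" using sdec[of i "max i j"] sdec[of j "max i j"] by auto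
      then have "s (max i j) = {}" by auto
      then show False using halfspace_nonempty[OF s(1)] by auto
    qed
    ultimately show ?thesis by auto
  qed
  moreover have "k' \<in> \<gamma>" if "k \<in> \<gamma>" "k' \<in> HS" "k \<subseteq> k'" for k k' using that unfolding \<gamma>_def by auto
  ultimately have uf: "\<gamma> \<in> UF" unfolding UF_def by (auto simp: \<gamma>_def)
  have "\<exists>k'\<in>\<gamma>. k' \<subset> k" if k: "k \<in> \<gamma>" for k
  proof -
    obtain n where "s n \<subseteq> k" using k unfolding \<gamma>_def by auto
    then have "s (Suc n) \<subset> k" using s(3)[of n] by auto
    moreover have "s (Suc n) \<in> \<gamma>" using s(1) unfolding \<gamma>_def by auto
    ultimately show ?thesis by blast
  qed
  moreover have "h \<in> \<gamma>" using h s(2) unfolding \<gamma>_def by auto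
  ultimately show ?thesis using uf unfolding non_terminating_def by blast
qed

text \<open>
  A hyperplane inside \<open>M\<close> need not have a side contained in all members of \<open>M\<close>. Adding to \<open>M\<close> a
  member \<open>s N\<close> of a descending chain in \<open>\<alpha>\<close>, so deep that it contains no complement of a member of
  \<open>M\<close>, ensures that the side \<open>q \<subset> s N\<close> is.
\<close>

lemma nonterminating_dense_if_neighbourhoods_filled:
  assumes nf: neighbourhoods_filled shows nonterminating_dense
  unfolding nonterminating_dense_def
proof (intro ballI allI impI)
  fix \<alpha> M assume a: "\<alpha> \<in> boundary" "finite M \<and> M \<subseteq> \<alpha>"
  have uf: "\<alpha> \<in> UF" using boundary_uf[OF a(1)] .
  have MHS: "m \<in> HS" if "m \<in> M" for m using a that uf_sub[OF uf] by auto
  obtain s :: "nat \<Rightarrow> 'v set" where s: "\<And>n. s n \<in> \<alpha>" "\<And>n. s (Suc n) \<subset> s n"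
    using boundary_chain[OF a(1)] by metis
  have sHS: "s n \<in> HS" for n using uf_sub[OF uf s(1)] .
  have "\<exists>n0. \<forall>n\<ge>n0. \<not> V - m \<subseteq> s n" if m: "m \<in> M" for m
  proof -
    obtain u where u: "u \<in> V" "u \<notin> m" using outside_exists[OF MHS[OF m]] by auto
    obtain n0 where "\<And>n. n \<ge> n0 \<Longrightarrow> u \<notin> s n" using chain_escapes[of s u, OF sHS s(2) u(1)] by metis
    then show ?thesis using u by blast
  qed
  then obtain f where f: "\<And>m n. m \<in> M \<Longrightarrow> n \<ge> f m \<Longrightarrow> \<not> V - m \<subseteq> s n" by metis
  define N where "N = Max (insert 0 (f ` M))"
  have N: "\<not> V - m \<subseteq> s N" if "m \<in> M" for m
    by (rule f[OF that]) (use that a in \<open>auto simp: N_def\<close>)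
  have "finite (insert (s N) M) \<and> insert (s N) M \<subseteq> \<alpha>" using a s by auto
  then obtain q0 where q0: "q0 \<in> HS" "hyperplane_inside q0 (insert (s N) M)"
    using nf a(1) unfolding neighbourhoods_filled_def by metis
  have "\<exists>q\<in>HS. q \<subset> s N \<and> hyperplane_inside q M"
  proof (cases "q0 \<subset> s N")
    case True then show ?thesis using q0 unfolding hyperplane_inside_def by auto
  next
    case False
    have "V - q0 \<subset> s N" using False q0(2) unfolding hyperplane_inside_def by simp
    moreover have "hyperplane_inside (V - q0) M"
      using q0(2) compl_compl[OF q0(1)] unfolding hyperplane_inside_def by auto
    ultimately show ?thesis using compl_halfspace[OF q0(1)] by blast
  qed
  then obtain q where q: "q \<in> HS" "q \<subset> s N" "hyperplane_inside q M" by metis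
  have qm: "q \<subseteq> m" if m: "m \<in> M" for m
  proof (rule ccontr)
    assume nq: "\<not> q \<subseteq> m"
    have "q \<subset> m \<or> V - q \<subset> m" using q(3) m unfolding hyperplane_inside_def by simp
    then have "V - q \<subseteq> m" using nq by auto
    then have "V - m \<subseteq> q" by auto
    then have "V - m \<subseteq> s N" using q(2) by auto
    then show False using N[OF m] by simp
  qed
  obtain \<gamma> where \<gamma>: "\<gamma> \<in> UF" "non_terminating \<gamma>" "q \<in> \<gamma>" using nonterminating_in_halfspace[OF nf q(1)] by metis
  have "M \<subseteq> \<gamma>" using uf_up[OF \<gamma>(1,3) MHS qm] by auto
  then show "\<exists>\<gamma>\<in>UF. non_terminating \<gamma> \<and> M \<subseteq> \<gamma>" using \<gamma> by metis
qed

end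

section \<open>Cubes, edges and squares\<close>

text \<open>
  In the coordinates of a cube, \<open>switch W i\<close> is the other end of the edge at \<open>W\<close> in direction \<open>i\<close>.
\<close>

definition switch :: "nat set \<Rightarrow> nat \<Rightarrow> nat set" where
  "switch W i = (if i \<in> W then W - {i} else insert i W)"

lemma switch_switch: "switch (switch W i) j = switch (switch W j) i"
  unfolding switch_def by auto

lemma switch_twice [simp]: "switch (switch W i) i = W"
  unfolding switch_def by auto

lemma switch_neq [simp]: "switch W i \<noteq> W" "W \<noteq> switch W i"
  unfolding switch_def by auto

lemma switch_eq_iff: "switch W i = switch W j \<longleftrightarrow> i = j"
  unfolding switch_def by auto

lemma switch_sub: "W \<subseteq> {..<n} \<Longrightarrow> i < n \<Longrightarrow> switch W i \<subseteq> {..<n}"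
  unfolding switch_def by auto

lemma mem_switch: "x \<in> switch W i \<longleftrightarrow> (if x = i then x \<notin> W else x \<in> W)"
  unfolding switch_def by auto

lemma switch_interval:
  assumes "i \<noteq> j"
  shows "{W - {i, j}..W \<union> {i, j}} = {W, switch W i, switch (switch W i) j, switch W j}"
proof
  show "{W - {i, j}..W \<union> {i, j}} \<subseteq> {W, switch W i, switch (switch W i) j, switch W j}"
  proof
    fix D assume "D \<in> {W - {i, j}..W \<union> {i, j}}"
    then have D: "\<And>x. x \<noteq> i \<Longrightarrow> x \<noteq> j \<Longrightarrow> x \<in> D \<longleftrightarrow> x \<in> W" by auto
    have "D = (if i \<in> D \<longleftrightarrow> i \<in> W then (if j \<in> D \<longleftrightarrow> j \<in> W then W else switch W j)
       else (if j \<in> D \<longleftrightarrow> j \<in> W then switch W i else switch (switch W i) j))"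
    proof (rule set_eqI)
      fix x
      consider "x = i" | "x = j" | "x \<noteq> i" "x \<noteq> j" by auto
      then show "x \<in> D \<longleftrightarrow> x \<in> (if i \<in> D \<longleftrightarrow> i \<in> W then (if j \<in> D \<longleftrightarrow> j \<in> W then W else switch W j)
       else (if j \<in> D \<longleftrightarrow> j \<in> W then switch W i else switch (switch W i) j))"
        using assms D[of x] by cases (simp_all add: mem_switch)
    qed
    then show "D \<in> {W, switch W i, switch (switch W i) j, switch W j}" by (metis insertCI)
  qed
  show "{W, switch W i, switch (switch W i) j, switch W j} \<subseteq> {W - {i, j}..W \<union> {i, j}}"
    unfolding switch_def by auto
qed

locale cubical =
  fixes X :: "'v set set"
  assumes cube_complex: "cube_complex X"
begin

definition adj :: "'v \<Rightarrow> 'v \<Rightarrow> bool" where "adj a b \<longleftrightarrow> {a, b} \<in> edges X"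

text \<open>
  The 4-cycle through the vertices of a square, so that \<open>a, c\<close> and \<open>b, d\<close> are opposite.
\<close>

definition sq :: "'v \<Rightarrow> 'v \<Rightarrow> 'v \<Rightarrow> 'v \<Rightarrow> bool" where
  "sq a b c d \<longleftrightarrow> {a, b, c, d} \<in> squares X \<and> adj a b \<and> adj b c \<and> adj c d \<and> adj d a"

lemma adj_sym: "adj a b \<Longrightarrow> adj b a"
  unfolding adj_def by (simp add: insert_commute)

lemma adj_neq: "adj a b \<Longrightarrow> a \<noteq> b"
  unfolding adj_def edges_def by auto

lemma adj_vertices: "adj a b \<Longrightarrow> a \<in> vertices X \<and> b \<in> vertices X"
  unfolding adj_def edges_def vertices_def by blast

lemma sq_rotate: "sq a b c d \<Longrightarrow> sq b c d a"
  unfolding sq_def by (simp add: insert_commute)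

lemma sq_flip: "sq a b c d \<Longrightarrow> sq c b a d"
proof -
  assume a: "sq a b c d"
  have "{c, b, a, d} = {a, b, c, d}" by auto
  then show ?thesis using a adj_sym[of a b] adj_sym[of b c] adj_sym[of c d] adj_sym[of d a]
    unfolding sq_def by simp
qed

lemma sq_distinct: "sq a b c d \<Longrightarrow> distinct [a, b, c, d]"
proof -
  assume "sq a b c d"
  then have "card {a, b, c, d} = 4" unfolding sq_def squares_def by auto
  then show ?thesis by (auto simp: card_insert_if split: if_splits)
qed

lemma chart_exists: "C \<in> X \<Longrightarrow> \<exists>n \<phi>. cube_chart X C n \<phi>"
  using cube_complex unfolding cube_complex_def by (elim conjE) (rule bspec)

lemma chart_bij: "cube_chart X C n \<phi> \<Longrightarrow> bij_betw \<phi> C (Pow {..<n})"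
  unfolding cube_chart_def by (rule conjunct1)

lemma chart_inv:
  assumes "cube_chart X C n \<phi>" "W \<subseteq> {..<n}"
  shows "inv_into C \<phi> W \<in> C" "\<phi> (inv_into C \<phi> W) = W"
proof -
  have "bij_betw \<phi> C (Pow {..<n})" using chart_bij[OF assms(1)] .
  then have "W \<in> \<phi> ` C" using assms(2) unfolding bij_betw_def by auto
  then show "inv_into C \<phi> W \<in> C" "\<phi> (inv_into C \<phi> W) = W" by (rule inv_into_into, rule f_inv_into_f)
qed

lemma chart_mem:
  assumes "cube_chart X C n \<phi>" "x \<in> C"
  shows "\<phi> x \<subseteq> {..<n}" "inv_into C \<phi> (\<phi> x) = x"
proof -
  have "inj_on \<phi> C" "\<phi> ` C = Pow {..<n}" using chart_bij[OF assms(1)] unfolding bij_betw_def by simp_all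
  then show "\<phi> x \<subseteq> {..<n}" "inv_into C \<phi> (\<phi> x) = x" using assms(2) by (blast, simp)
qed

lemma chart_inj: "cube_chart X C n \<phi> \<Longrightarrow> inj_on \<phi> C"
  using chart_bij unfolding bij_betw_def by metis

lemma chart_card: "cube_chart X C n \<phi> \<Longrightarrow> card C = 2 ^ n"
  using bij_betw_same_card[OF chart_bij] by (simp add: card_Pow)

lemma chart_face:
  assumes "cube_chart X C n \<phi>" "A \<subseteq> B" "B \<subseteq> {..<n}"
  shows "inv_into C \<phi> ` {A..B} \<in> X"
proof -
  have sub: "W \<subseteq> {..<n}" if "W \<in> {A..B}" for W using that assms(3) by auto
  have "inv_into C \<phi> ` {A..B} \<subseteq> C" using chart_inv(1)[OF assms(1) sub] by auto
  moreover have "\<phi> ` (inv_into C \<phi> ` {A..B}) = {A..B}"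
    unfolding image_image using chart_inv(2)[OF assms(1) sub] by simp
  ultimately show ?thesis using assms unfolding cube_chart_def by blast
qed

lemma chart_inv_inj:
  assumes "cube_chart X C n \<phi>" "W \<subseteq> {..<n}" "W' \<subseteq> {..<n}" "inv_into C \<phi> W = inv_into C \<phi> W'"
  shows "W = W'"
proof -
  have "W = \<phi> (inv_into C \<phi> W')" using chart_inv(2)[OF assms(1,2)] unfolding assms(4) by (rule sym)
  also have "\<dots> = W'" by (rule chart_inv(2)[OF assms(1,3)])
  finally show ?thesis .
qed

lemma chart_edge:
  assumes "cube_chart X C n \<phi>" "W \<subseteq> {..<n}" "i < n"
  shows "adj (inv_into C \<phi> W) (inv_into C \<phi> (switch W i))"
proof -
  let ?\<psi> = "inv_into C \<phi>"
  have "{W - {i}..W \<union> {i}} = {W, switch W i}" unfolding switch_def by auto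
  then have img: "{?\<psi> W, ?\<psi> (switch W i)} = ?\<psi> ` {W - {i}..W \<union> {i}}" by simp
  have "?\<psi> ` {W - {i}..W \<union> {i}} \<in> X" using assms by (intro chart_face) auto
  then have "{?\<psi> W, ?\<psi> (switch W i)} \<in> X" unfolding img .
  moreover have "?\<psi> W \<noteq> ?\<psi> (switch W i)"
    using chart_inv_inj[OF assms(1,2) switch_sub[OF assms(2,3)]] switch_neq(2)[of W i] by blast
  then have "card {?\<psi> W, ?\<psi> (switch W i)} = 2" by simp
  ultimately show ?thesis unfolding adj_def edges_def by simp
qed

lemma chart_adj:
  assumes "cube_chart X C n \<phi>" "x \<in> C" "y \<in> C" "adj x y"
  obtains i where "i < n" "\<phi> y = switch (\<phi> x) i"
proof -
  have xy: "{x, y} \<in> X" "x \<noteq> y" using assms(4) adj_neq[OF assms(4)] unfolding adj_def edges_def by simp_all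
  then have "\<exists>A B. A \<subseteq> B \<and> B \<subseteq> {..<n} \<and> \<phi> ` {x, y} = {A..B}"
    using assms(1-3) unfolding cube_chart_def by (metis empty_subsetI insert_subset)
  then obtain A B where AB: "A \<subseteq> B" "B \<subseteq> {..<n}" "{\<phi> x, \<phi> y} = {A..B}" by auto
  have ne: "\<phi> x \<noteq> \<phi> y" using inj_onD[OF chart_inj[OF assms(1)]] assms(2,3) xy(2) by metis
  have "A \<noteq> B"
  proof
    assume "A = B"
    then have "{\<phi> x, \<phi> y} = {A}" using AB(3) by auto
    then show False using ne by auto
  qed
  then obtain i where i: "i \<in> B" "i \<notin> A" using AB(1) by auto
  have mem: "A \<in> {\<phi> x, \<phi> y}" "B \<in> {\<phi> x, \<phi> y}" "insert i A \<in> {\<phi> x, \<phi> y}" unfolding AB(3) using AB(1) i by auto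
  have "insert i A \<noteq> A" using i by auto
  then have "B = insert i A" using mem \<open>A \<noteq> B\<close> by auto
  then have "\<phi> y = switch (\<phi> x) i" using mem ne i(2) unfolding switch_def by auto
  moreover have "i < n" using i AB(2) by auto
  ultimately show ?thesis using that by simp
qed

lemma chart_square:
  assumes "cube_chart X C n \<phi>" "W \<subseteq> {..<n}" "i < n" "j < n" "i \<noteq> j"
  shows "sq (inv_into C \<phi> W) (inv_into C \<phi> (switch W i)) (inv_into C \<phi> (switch (switch W i) j)) (inv_into C \<phi> (switch W j))"
proof -
  let ?\<psi> = "inv_into C \<phi>"
  have sub: "switch W i \<subseteq> {..<n}" "switch W j \<subseteq> {..<n}" "switch (switch W i) j \<subseteq> {..<n}"
    using assms switch_sub by auto
  have img: "{?\<psi> W, ?\<psi> (switch W i), ?\<psi> (switch (switch W i) j), ?\<psi> (switch W j)} = ?\<psi> ` {W - {i, j}..W \<union> {i, j}}"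
    unfolding switch_interval[OF assms(5)] by simp
  moreover have "?\<psi> ` {W - {i, j}..W \<union> {i, j}} \<in> X" using assms by (intro chart_face) auto
  moreover have "card (?\<psi> ` {W - {i, j}..W \<union> {i, j}}) = 4"
  proof -
    have "inj_on ?\<psi> {W - {i, j}..W \<union> {i, j}}"
    proof (rule inj_onI)
      fix x y assume "x \<in> {W - {i, j}..W \<union> {i, j}}" "y \<in> {W - {i, j}..W \<union> {i, j}}" and eq: "?\<psi> x = ?\<psi> y"
      then have "x \<subseteq> {..<n}" "y \<subseteq> {..<n}" using assms(2-4) by auto
      then show "x = y" using chart_inv_inj[OF assms(1) _ _ eq] by simp
    qed
    then have "card (?\<psi> ` {W - {i, j}..W \<union> {i, j}}) = card {W - {i, j}..W \<union> {i, j}}" by (rule card_image)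
    also have "\<dots> = 4"
    proof -
      have "switch (switch W i) j \<noteq> W" using assms(5) unfolding switch_def by auto
      moreover have "switch W i \<noteq> switch W j" using assms(5) switch_eq_iff by simp
      moreover have "switch (switch W i) j \<noteq> switch W i" "switch (switch W i) j \<noteq> switch W j"
        using switch_switch[of W i j] switch_neq by metis+
      ultimately show ?thesis unfolding switch_interval[OF assms(5)] by (simp add: card_insert_if)
    qed
    finally show ?thesis .
  qed
  ultimately have "{?\<psi> W, ?\<psi> (switch W i), ?\<psi> (switch (switch W i) j), ?\<psi> (switch W j)} \<in> squares X"
    unfolding squares_def by simp
  moreover have "adj (?\<psi> (switch (switch W i) j)) (?\<psi> (switch W j))"
    using adj_sym[OF chart_edge[OF assms(1) sub(2) assms(3)]] unfolding switch_switch[of W j i] .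
  ultimately show ?thesis
    unfolding sq_def using chart_edge[OF assms(1,2,3)] chart_edge[OF assms(1) sub(1) assms(4)]
      adj_sym[OF chart_edge[OF assms(1,2,4)]] by simp
qed

lemma singleton_cube: "v \<in> vertices X \<Longrightarrow> {v} \<in> X"
proof -
  assume "v \<in> vertices X"
  then obtain C where C: "C \<in> X" "v \<in> C" unfolding vertices_def by auto
  obtain n \<phi> where c: "cube_chart X C n \<phi>" using chart_exists[OF C(1)] by auto
  have "inv_into C \<phi> ` {\<phi> v..\<phi> v} \<in> X" by (rule chart_face[OF c order_refl chart_mem(1)[OF c C(2)]])
  then show ?thesis using chart_mem(2)[OF c C(2)] by simp
qed

text \<open>
  Two squares sharing three vertices would intersect in a cube with three vertices.
\<close>

lemma sq_unique:
  assumes "sq a b c d" "sq a b c d'" shows "d = d'"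
proof -
  let ?Q = "{a, b, c, d}" and ?Q' = "{a, b, c, d'}"
  have Q: "?Q \<in> X" "?Q' \<in> X" "card ?Q = 4" using assms unfolding sq_def squares_def by auto
  have d: "distinct [a, b, c, d]" "distinct [a, b, c, d']" using assms sq_distinct by auto
  have "?Q \<inter> ?Q' \<noteq> {}" by auto
  then have "?Q \<inter> ?Q' \<in> X" using Q cube_complex unfolding cube_complex_def by metis
  then obtain n \<phi> where "cube_chart X (?Q \<inter> ?Q') n \<phi>" using chart_exists by metis
  then have pow: "card (?Q \<inter> ?Q') = 2 ^ n" by (rule chart_card)
  show ?thesis
  proof (rule ccontr)
    assume "d \<noteq> d'"
    then have "?Q \<inter> ?Q' = {a, b, c}" using d by auto
    then have "2 ^ n = (3::nat)" using pow d by (simp add: card_insert_if)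
    then show False by (cases n) (auto, presburger)
  qed
qed

lemma sq_diagonal:
  assumes "sq a v b p" shows "\<not> adj v p"
proof
  assume vp: "adj v p"
  let ?Q = "{a, v, b, p}"
  have Q: "?Q \<in> X" "card ?Q = 4" and e: "adj v a" "adj v b"
    using assms adj_sym unfolding sq_def squares_def by auto
  obtain n \<phi> where c: "cube_chart X ?Q n \<phi>" using chart_exists[OF Q(1)] by auto
  have "2 ^ n = (2::nat) ^ 2" using chart_card[OF c] Q(2) by simp
  then have n: "n = 2" using power_inject_exp[of "2::nat" n 2] by simp
  obtain i where i: "i < n" "\<phi> a = switch (\<phi> v) i" by (rule chart_adj[OF c _ _ e(1)]) auto
  obtain j where j: "j < n" "\<phi> b = switch (\<phi> v) j" by (rule chart_adj[OF c _ _ e(2)]) auto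
  obtain k where k: "k < n" "\<phi> p = switch (\<phi> v) k" by (rule chart_adj[OF c _ _ vp]) auto
  have "i = j \<or> i = k \<or> j = k" using i j k n by auto
  then have "\<phi> a = \<phi> b \<or> \<phi> a = \<phi> p \<or> \<phi> b = \<phi> p" using i j k by auto
  then have "a = b \<or> a = p \<or> b = p" using inj_onD[OF chart_inj[OF c]] by (metis insertCI)
  then show False using sq_distinct[OF assms] by auto
qed

lemma sq_link:
  assumes "sq a v b p" shows "{a, b} \<in> link_simplices X v"
proof -
  have "{a, v, b, p} \<in> X" using assms unfolding sq_def squares_def by auto
  moreover have "{a, b} = {a, v, b, p} \<inter> neighbours X v"
  proof -
    have "adj v a" "adj v b" "\<not> adj v v" "\<not> adj v p"
      using assms sq_diagonal adj_neq adj_sym unfolding sq_def by blast+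
    then show ?thesis unfolding neighbours_def adj_def[symmetric] by auto
  qed
  ultimately show ?thesis unfolding link_simplices_def by blast
qed

end

locale flag_cubical = cubical X for X :: "'v set set" +
  assumes flag_links: "flag_links X"
begin

text \<open>
  The flag condition in dimension three: three squares that pairwise share an edge at \<open>v\<close> lie in a
  common 3-cube, and \<open>t\<close> is its vertex opposite to \<open>v\<close>.
\<close>

lemma cube_completion:
  assumes ab: "sq a v b p" and bc: "sq b v c q" and ac: "sq a v c r"
  obtains t where "sq p a r t" "sq p b q t" "sq q c r t"
proof -
  have e: "adj v a" "adj v b" "adj v c" using ab bc adj_sym unfolding sq_def by auto
  have ne: "a \<noteq> b" "b \<noteq> c" "a \<noteq> c" using sq_distinct[OF ab] sq_distinct[OF bc] sq_distinct[OF ac] by auto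
  have v: "v \<in> vertices X" using adj_vertices[OF e(1)] by simp
  have pairs: "\<forall>x\<in>{a, b, c}. \<forall>y\<in>{a, b, c}. x \<noteq> y \<longrightarrow> {x, y} \<in> link_simplices X v"
    using sq_link[OF ab] sq_link[OF bc] sq_link[OF ac] by (auto simp: insert_commute)
  have "{a, b, c} \<subseteq> neighbours X v" using e unfolding neighbours_def adj_def by auto
  then have "{a, b, c} \<in> link_simplices X v"
    using flag_links pairs v unfolding flag_links_def by (metis finite.simps)
  then obtain C where C: "C \<in> X" "v \<in> C" "{a, b, c} = C \<inter> neighbours X v" unfolding link_simplices_def by blast
  then have mem: "a \<in> C" "b \<in> C" "c \<in> C" by auto
  obtain n \<phi> where ch: "cube_chart X C n \<phi>" using chart_exists[OF C(1)] by auto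
  let ?\<psi> = "inv_into C \<phi>" and ?V = "\<phi> v"
  obtain i where i: "i < n" "\<phi> a = switch ?V i" using chart_adj[OF ch C(2) mem(1) e(1)] .
  obtain j where j: "j < n" "\<phi> b = switch ?V j" using chart_adj[OF ch C(2) mem(2) e(2)] .
  obtain k where k: "k < n" "\<phi> c = switch ?V k" using chart_adj[OF ch C(2) mem(3) e(3)] .
  have inj: "x = y" if "x \<in> C" "y \<in> C" "\<phi> x = \<phi> y" for x y using inj_onD[OF chart_inj[OF ch] that(3,1,2)] .
  have ijk: "i \<noteq> j" "j \<noteq> k" "i \<noteq> k" using inj mem ne i j k by metis+
  have V: "?V \<subseteq> {..<n}" using chart_mem(1)[OF ch C(2)] .
  have \<psi>: "?\<psi> ?V = v" "?\<psi> (switch ?V i) = a" "?\<psi> (switch ?V j) = b" "?\<psi> (switch ?V k) = c"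
    using chart_mem(2)[OF ch C(2)] chart_mem(2)[OF ch mem(1)] chart_mem(2)[OF ch mem(2)] chart_mem(2)[OF ch mem(3)] i j k by auto
  have opposite: "z = ?\<psi> (switch (switch ?V l) m)"
    if "l < n" "m < n" "l \<noteq> m" "sq (?\<psi> (switch ?V l)) v (?\<psi> (switch ?V m)) z" for l m z
  proof -
    have "sq v (?\<psi> (switch ?V l)) (?\<psi> (switch (switch ?V l) m)) (?\<psi> (switch ?V m))"
      using chart_square[OF ch V that(1-3)] \<psi>(1) by simp
    from sq_flip[OF sq_rotate[OF sq_rotate[OF sq_rotate[OF this]]]]
    have "sq (?\<psi> (switch ?V l)) v (?\<psi> (switch ?V m)) (?\<psi> (switch (switch ?V l) m))" .
    from sq_unique[OF that(4) this] show ?thesis .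
  qed
  have p: "p = ?\<psi> (switch (switch ?V i) j)" using opposite[OF i(1) j(1) ijk(1)] ab \<psi> by simp
  have q: "q = ?\<psi> (switch (switch ?V j) k)" using opposite[OF j(1) k(1) ijk(2)] bc \<psi> by simp
  have r: "r = ?\<psi> (switch (switch ?V i) k)" using opposite[OF i(1) k(1) ijk(3)] ac \<psi> by simp
  define t where "t = ?\<psi> (switch (switch (switch ?V i) j) k)"
  have s3: "switch (switch (switch ?V j) i) k = switch (switch (switch ?V i) j) k"
    "switch (switch (switch ?V k) i) j = switch (switch (switch ?V i) j) k"
    by (metis switch_switch)+
  have "sq a p t r"
    using chart_square[OF ch switch_sub[OF V i(1)] j(1) k(1) ijk(2)] \<psi> p r t_def by simp
  then have 1: "sq p a r t" using sq_flip[OF sq_rotate[OF sq_rotate[OF sq_rotate]]] by blast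
  have "sq b p t q"
    using chart_square[OF ch switch_sub[OF V j(1)] i(1) k(1) ijk(3)] unfolding \<psi>(3) s3(1) q t_def
    unfolding switch_switch[of ?V j i] p .
  then have 2: "sq p b q t" using sq_flip[OF sq_rotate[OF sq_rotate[OF sq_rotate]]] by blast
  have "sq c r t q"
    using chart_square[OF ch switch_sub[OF V k(1)] i(1) j(1) ijk(1)] unfolding \<psi>(4) s3(2) r t_def
    unfolding switch_switch[of ?V k i] switch_switch[of ?V k j] q .
  then have 3: "sq q c r t" using sq_rotate[OF sq_rotate[OF sq_rotate]] by blast
  show ?thesis using that[OF 1 2 3] .
qed

end

section \<open>Edge paths up to pushing across squares\<close>

context flag_cubical
begin

text \<open>
  Equality of edge paths up to pushing across squares, defined by recursion on the length so that
  it can be inverted: paths starting in \<open>v\<close> with different first edges are equivalent iff the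
  edges span a square and both paths may be rerouted through its fourth vertex. Paths are written
  with their end vertex first, as all vertices are reached from a fixed base vertex.
\<close>

inductive feq :: "'v list \<Rightarrow> 'v list \<Rightarrow> bool" where
  single: "feq [v] [v]"
| same: "feq (w # p) (w # q) \<Longrightarrow> feq (v # w # p) (v # w # q)"
| square: "sq w1 v w2 z \<Longrightarrow> feq (w1 # p) (w1 # z # t) \<Longrightarrow> feq (w2 # q) (w2 # z # t) \<Longrightarrow>
    feq (v # w1 # p) (v # w2 # q)"

lemma feq_basic: "feq p q \<Longrightarrow> length p = length q \<and> p \<noteq> [] \<and> q \<noteq> [] \<and> hd p = hd q \<and> last p = last q"
proof (induction rule: feq.induct)
  case (square w1 v w2 z p t q)
  have l: "last (a # x # l) = last (x # l)" for a x :: 'v and l by simp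
  have "last (w1 # z # t) = last (w2 # z # t)" by (simp only: l)
  then have "last (w1 # p) = last (w2 # q)" using square.IH by metis
  then have "last (v # w1 # p) = last (v # w2 # q)" by (simp only: l)
  moreover have "length p = length q" using square.IH by simp
  ultimately show ?case by (simp del: last.simps)
qed auto

lemma feq_refl: "p \<noteq> [] \<Longrightarrow> feq p p"
proof (induction p)
  case (Cons v p)
  note IH = Cons.IH
  show ?case
  proof (cases p)
    case Nil
    then show ?thesis using feq.single by simp
  next
    case (Cons w p')
    then show ?thesis using IH feq.same by simp
  qed
qed simp

lemma feq_sym: "feq p q \<Longrightarrow> feq q p"
proof (induction rule: feq.induct)
  case (single v)
  show ?case by (rule feq.single)
next
  case (same w p q v)
  show ?case by (rule feq.same[OF same.IH])
next
  case (square w1 v w2 z p t q)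
  show ?case by (rule feq.square[OF sq_flip[OF square.hyps(1)] square.hyps(3,2)])
qed

lemma feq_cons: "feq p q \<Longrightarrow> feq (x # p) (x # q)"
proof -
  assume pq: "feq p q"
  obtain a p' where p: "p = a # p'" using feq_basic[OF pq] by (cases p) simp_all
  obtain b q' where q: "q = b # q'" using feq_basic[OF pq] by (cases q) simp_all
  have "a = b" using feq_basic[OF pq] p q by simp
  then show ?thesis using pq p q feq.same by simp
qed

lemma feq_decompose:
  assumes "feq (v # w1 # p) (v # w2 # q)"
  shows "w1 = w2 \<and> feq (w1 # p) (w2 # q) \<or>
    (\<exists>z t. sq w1 v w2 z \<and> feq (w1 # p) (w1 # z # t) \<and> feq (w2 # q) (w2 # z # t))"
  using assms
proof (cases rule: feq.cases)
  case same
  then show ?thesis by simp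
next
  case (square z t)
  then show ?thesis by (intro disjI2 exI conjI)
qed

text \<open>
  The interesting case has three different first edges \<open>w1\<close>, \<open>w2\<close>, \<open>w3\<close> at \<open>v\<close>, with squares
  between the first and the last two. The continuations after \<open>w2\<close> differ by a third square, so
  the three squares are completed to a 3-cube, and both outer paths can be rerouted through its
  vertex opposite to \<open>w2\<close>.
\<close>

lemma feq_trans: "feq p q \<Longrightarrow> feq q r \<Longrightarrow> feq p r"
proof (induction "length p" arbitrary: p q r rule: less_induct)
  case less
  note IH = less.hyps
  have len: "length q = length p" "length r = length p" "p \<noteq> []" "q \<noteq> []" "r \<noteq> []"
    "hd q = hd p" "hd r = hd p" using feq_basic[OF less.prems(1)] feq_basic[OF less.prems(2)] by auto
  then obtain v p' q' r' where s: "p = v # p'" "q = v # q'" "r = v # r'"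
    by (metis list.collapse)
  show ?case
  proof (cases p')
    case Nil
    then show ?thesis using len s by (auto intro: feq.single)
  next
    case (Cons w1 p1)
    then obtain w2 q1 w3 r1 where s2: "q' = w2 # q1" "r' = w3 # r1" using len s by (cases q'; cases r') auto
    have small: "feq a c" if "feq a b" "feq b c" "length a < length p" for a b c
      using IH[OF that(3,1,2)] .
    have l1: "length (w1 # p1) < length p" "length (w2 # q1) < length p" "length (w3 # r1) < length p"
      using s Cons s2 len by auto
    have pq: "feq (v # w1 # p1) (v # w2 # q1)" and qr: "feq (v # w2 # q1) (v # w3 # r1)"
      using less.prems s Cons s2 by auto
    have "feq (v # w1 # p1) (v # w3 # r1)"
      using feq_decompose[OF pq] feq_decompose[OF qr]
    proof (elim disjE conjE exE)
      assume "w1 = w2" "feq (w1 # p1) (w2 # q1)" "w2 = w3" "feq (w2 # q1) (w3 # r1)"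
      then show ?thesis using small l1 by (metis feq.same)
    next
      fix z t assume a: "w1 = w2" "feq (w1 # p1) (w2 # q1)" "sq w2 v w3 z" "feq (w2 # q1) (w2 # z # t)" "feq (w3 # r1) (w3 # z # t)"
      have "feq (w1 # p1) (w1 # z # t)" using small[OF a(2,4) l1(1)] a(1) by simp
      then show ?thesis using feq.square a by metis
    next
      fix z t assume a: "sq w1 v w2 z" "feq (w1 # p1) (w1 # z # t)" "feq (w2 # q1) (w2 # z # t)" "w2 = w3" "feq (w2 # q1) (w3 # r1)"
      have "feq (w3 # r1) (w3 # z # t)" using small[OF feq_sym[OF a(5)] a(3) l1(3)] a(4) by simp
      then show ?thesis using feq.square a by metis
    next
      fix z t z' t' assume a: "sq w1 v w2 z" "feq (w1 # p1) (w1 # z # t)" "feq (w2 # q1) (w2 # z # t)"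
        and b: "sq w2 v w3 z'" "feq (w2 # q1) (w2 # z' # t')" "feq (w3 # r1) (w3 # z' # t')"
      have zz: "feq (w2 # z # t) (w2 # z' # t')"
        by (rule small[OF feq_sym[OF a(3)] b(2)]) (use feq_basic[OF a(3)] l1(2) in simp)
      have lz: "length (z # t) < length p" "length (z' # t') < length p"
        using feq_basic[OF a(3)] feq_basic[OF b(2)] l1(2) by auto
      have l2: "length (w1 # z # t) < length p" "length (w3 # z' # t') < length p"
        using feq_basic[OF a(2)] feq_basic[OF b(3)] l1 by auto
      show ?thesis using feq_decompose[OF zz]
      proof (elim disjE conjE exE)
        assume c: "z = z'" "feq (z # t) (z' # t')"
        have "sq v w2 z w1" using a(1) sq_rotate by metis
        then have s1: "sq z w2 v w1" using sq_flip by metis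
        have "sq z w2 v w3" using sq_rotate[OF sq_flip[OF sq_rotate[OF sq_rotate[OF sq_rotate[OF sq_flip[OF b(1)]]]]]] c(1)
          b(1) sq_rotate sq_flip by metis
        then have w: "w1 = w3" using sq_unique[OF s1] by simp
        have "feq (w1 # z # t) (w1 # z' # t')" using c feq_cons by metis
        then have "feq (w1 # p1) (w1 # z' # t')" using small[OF a(2) _ l1(1)] by simp
        then have "feq (w1 # p1) (w3 # r1)" using small[OF _ feq_sym[OF b(3)] l1(1)] w by simp
        then show ?thesis using w by (simp add: feq.same)
      next
        fix y u assume c: "sq z w2 z' y" "feq (z # t) (z # y # u)" "feq (z' # t') (z' # y # u)"
        have e1: "sq v w2 z w1" using a(1) sq_rotate by metis
        have e2: "sq v w2 z' w3" using b(1) sq_rotate sq_flip by metis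
        obtain x where x: "sq w1 v w3 x" "sq w1 z y x" "sq y z' w3 x"
          using cube_completion[OF e1 c(1) e2] by metis
        have x3: "sq w3 z' y x" using x(3) sq_flip by metis
        have "sq z w1 x y" using x(2) sq_flip sq_rotate by metis
        then have "sq z w1 x y" .
        have "feq (w1 # z # y # u) (w1 # x # y # u)"
        proof (rule feq.square[where z = y and t = u])
          show "sq z w1 x y" using x(2) sq_flip sq_rotate by metis
        qed (auto intro: feq_refl)
        moreover have "feq (w1 # z # t) (w1 # z # y # u)" using c(2) feq_cons by metis
        ultimately have "feq (w1 # z # t) (w1 # x # y # u)" using small l2(1) by metis
        then have A: "feq (w1 # p1) (w1 # x # y # u)" using small[OF a(2) _ l1(1)] by simp
        have "feq (w3 # z' # y # u) (w3 # x # y # u)"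
        proof (rule feq.square[where z = y and t = u])
          show "sq z' w3 x y" using x3 sq_flip sq_rotate by metis
        qed (auto intro: feq_refl)
        moreover have "feq (w3 # z' # t') (w3 # z' # y # u)" using c(3) feq_cons by metis
        ultimately have "feq (w3 # z' # t') (w3 # x # y # u)" using small l2(2) by metis
        then have B: "feq (w3 # r1) (w3 # x # y # u)" using small[OF b(3) _ l1(3)] by simp
        show ?thesis by (rule feq.square[OF x(1) A B])
      qed
    qed
    then show ?thesis using s s2 Cons by simp
  qed
qed

text \<open>
  No edge, say from \<open>v\<close> to \<open>x\<close>, is one along which the path to \<open>v\<close> has just come, up to pushing
  across squares. Such paths turn out to be the geodesics.
\<close>

fun reduced :: "'v list \<Rightarrow> bool" where
  "reduced [] = False"
| "reduced [v] = True"
| "reduced (x # v # p) = (adj x v \<and> reduced (v # p) \<and> \<not> (\<exists>q. feq (v # p) (v # x # q)))"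

lemma reduced_nonempty: "reduced p \<Longrightarrow> p \<noteq> []"
  by (cases p) auto

lemma sq_descent_swap:
  assumes "sq w1 x w2 z" shows "sq x w1 z w2" "sq x w2 z w1" "sq z w1 x w2" "sq z w2 x w1"
proof -
  have a: "sq x w2 z w1" using sq_rotate[OF assms] .
  show "sq x w2 z w1" by (rule a)
  show b: "sq z w2 x w1" using sq_flip[OF a] .
  have c: "sq w2 x w1 z" using sq_flip[OF assms] .
  show d: "sq x w1 z w2" using sq_rotate[OF c] .
  show "sq z w1 x w2" using sq_flip[OF d] .
qed

lemma feq_square_step: "sq w1 x w2 z \<Longrightarrow> feq (x # w1 # z # t) (x # w2 # z # t)"
  using feq.square[of w1 x w2 z "z # t" t "z # t"] feq_refl by simp

text \<open>
  If the path with \<open>w2\<close> were not reduced, the square would move its backtrack to the path with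
  \<open>w1\<close>.
\<close>

lemma feq_reduced: "feq p q \<Longrightarrow> reduced p \<Longrightarrow> reduced q"
proof (induction "length p" arbitrary: p q rule: less_induct)
  case less
  note IH = less.hyps
  from less.prems(1) show ?case
  proof (cases rule: feq.cases)
    case (same w p' q' v)
    have "reduced (w # p')" and av: "adj v w" and nd: "\<not> (\<exists>q. feq (w # p') (w # v # q))" using less.prems(2) same by auto
    have "reduced (w # q')" by (rule IH[OF _ same(3)]) (use same \<open>reduced (w # p')\<close> in auto)
    moreover have "\<not> (\<exists>q. feq (w # q') (w # v # q))" using nd feq_trans[OF same(3)] by metis
    ultimately show ?thesis using same av by simp
  next
    case (square w1 v w2 z p' t q')
    have r1: "reduced (w1 # p')" and nd: "\<not> (\<exists>q. feq (w1 # p') (w1 # v # q))" using less.prems(2) square by auto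
    have len: "length (w1 # z # t) = length (w1 # p')" "length (w2 # z # t) = length (w2 # q')"
      "length p = length q"
      using feq_basic[OF square(4)] feq_basic[OF square(5)] feq_basic[OF less.prems(1)] by auto
    have r2: "reduced (w1 # z # t)" by (rule IH[OF _ square(4) r1]) (use square in simp)
    have rzt: "reduced (z # t)" and w1z: "\<not> (\<exists>q. feq (z # t) (z # w1 # q))" using r2 by auto
    have a2: "adj w2 z" using square(3) unfolding sq_def by auto
    have w2z: "\<not> (\<exists>s. feq (z # t) (z # w2 # s))"
    proof
      assume "\<exists>s. feq (z # t) (z # w2 # s)"
      then obtain s where "feq (z # t) (z # w2 # s)" by auto
      then have "feq (w1 # z # t) (w1 # z # w2 # s)" by (rule feq_cons)
      moreover have "feq (w1 # z # w2 # s) (w1 # v # w2 # s)"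
        by (rule feq_square_step[OF sq_descent_swap(3)[OF square(3)]])
      ultimately have "feq (w1 # p') (w1 # v # w2 # s)" using feq_trans square(4) by metis
      then show False using nd by metis
    qed
    have r3: "reduced (w2 # z # t)" using rzt a2 w2z by simp
    have r4: "reduced (w2 # q')" by (rule IH[OF _ feq_sym[OF square(5)] r3]) (use square len in simp)
    have "\<not> (\<exists>s. feq (w2 # q') (w2 # v # s))"
    proof
      assume "\<exists>s. feq (w2 # q') (w2 # v # s)"
      then obtain s where "feq (w2 # z # t) (w2 # v # s)" using feq_trans feq_sym[OF square(5)] by metis
      from feq_decompose[OF this] show False
      proof (elim disjE conjE exE)
        assume "z = v"
        then show False using sq_distinct[OF square(3)] by simp
      next
        fix y u assume y: "sq z w2 v y" "feq (z # t) (z # y # u)"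
        have "y = w1" using sq_unique[OF y(1) sq_descent_swap(4)[OF square(3)]] .
        then show False using y(2) w1z by metis
      qed
    qed
    moreover have "adj v w2" using square(3) unfolding sq_def by auto
    ultimately show ?thesis using r4 square(2) by simp
  qed (use less.prems in auto)
qed

text \<open>
  Extend a reduced path by the edge to \<open>x\<close>, cancelling if the path can be pushed so that its last
  edge comes from \<open>x\<close>. A remainder is chosen arbitrarily; all are equivalent by \<open>feq_cancel\<close>.
\<close>

definition act :: "'v \<Rightarrow> 'v list \<Rightarrow> 'v list" where
  "act x r = (if \<exists>q. feq r (hd r # x # q) then x # (SOME q. feq r (hd r # x # q)) else x # r)"

lemma feq_cancel: "feq (v # x # p) (v # x # q) \<Longrightarrow> feq (x # p) (x # q)"
proof -
  assume "feq (v # x # p) (v # x # q)"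
  from feq_decompose[OF this] show ?thesis
  proof (elim disjE conjE exE)
    fix z assume "sq x v x z"
    from sq_distinct[OF this] show ?thesis by simp
  qed
qed

lemma act_descent: "feq (v # p) (v # x # q) \<Longrightarrow> feq (act x (v # p)) (x # q)"
proof -
  assume a: "feq (v # p) (v # x # q)"
  then have ex: "\<exists>q. feq (v # p) (v # x # q)" by auto
  then have "feq (v # p) (v # x # (SOME q. feq (v # p) (v # x # q)))" by (rule someI_ex)
  then have "feq (x # (SOME q. feq (v # p) (v # x # q))) (x # q)"
    using a feq_trans feq_sym feq_cancel by metis
  then show ?thesis unfolding act_def using ex by simp
qed

lemma act_ascent: "\<not> (\<exists>q. feq (v # p) (v # x # q)) \<Longrightarrow> act x (v # p) = x # v # p"
  unfolding act_def by simp

lemma act_basic: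
  assumes "reduced (v # p)" "adj x v"
  shows "reduced (act x (v # p))" "hd (act x (v # p)) = x" "last (act x (v # p)) = last (v # p)"
    "length (act x (v # p)) = Suc (length (v # p)) \<or> Suc (length (act x (v # p))) = length (v # p)"
proof -
  have "reduced (act x (v # p)) \<and> hd (act x (v # p)) = x \<and> last (act x (v # p)) = last (v # p) \<and>
    (length (act x (v # p)) = Suc (length (v # p)) \<or> Suc (length (act x (v # p))) = length (v # p))"
  proof (cases "\<exists>q. feq (v # p) (v # x # q)")
    case True
    then obtain q where q: "feq (v # p) (v # x # q)" by auto
    have "feq (act x (v # p)) (x # q)" using act_descent[OF q] .
    note b = feq_basic[OF this] and b2 = feq_basic[OF q]
    have "reduced (v # x # q)" using feq_reduced[OF q assms(1)] .
    then have "reduced (x # q)" by simp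
    then have "reduced (act x (v # p))" using feq_reduced[OF feq_sym[OF act_descent[OF q]]] by simp
    then show ?thesis using b b2 by simp
  next
    case False
    then show ?thesis using act_ascent[OF False] assms by simp
  qed
  then show "reduced (act x (v # p))" "hd (act x (v # p)) = x" "last (act x (v # p)) = last (v # p)"
    "length (act x (v # p)) = Suc (length (v # p)) \<or> Suc (length (act x (v # p))) = length (v # p)" by auto
qed

lemma act_cong:
  assumes "feq r r'" shows "feq (act x r) (act x r')"
proof -
  obtain v p where r: "r = v # p" using feq_basic[OF assms] by (cases r) auto
  obtain p' where r': "r' = v # p'" using feq_basic[OF assms] r by (cases r') auto
  show ?thesis
  proof (cases "\<exists>q. feq (v # p) (v # x # q)")
    case True
    then obtain q where q: "feq (v # p) (v # x # q)" by auto
    have q': "feq (v # p') (v # x # q)" using feq_trans[OF feq_sym[OF assms, unfolded r r'] q] .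
    show ?thesis unfolding r r' using feq_trans[OF act_descent[OF q] feq_sym[OF act_descent[OF q']]] .
  next
    case False
    have "\<not> (\<exists>q. feq (v # p') (v # x # q))"
    proof
      assume "\<exists>q. feq (v # p') (v # x # q)"
      then obtain q where "feq (v # p') (v # x # q)" by auto
      then show False using False feq_trans[OF assms[unfolded r r']] by auto
    qed
    from act_ascent[OF False] act_ascent[OF this] show ?thesis using feq_cons[OF assms] unfolding r r' by simp
  qed
qed

lemma act_back:
  assumes "reduced (v # p)" "adj x v" shows "feq (act v (act x (v # p))) (v # p)"
proof (cases "\<exists>q. feq (v # p) (v # x # q)")
  case True
  then obtain q where q: "feq (v # p) (v # x # q)" by auto
  have a: "feq (act v (act x (v # p))) (act v (x # q))" by (rule act_cong[OF act_descent[OF q]])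
  have "reduced (v # x # q)" using feq_reduced[OF q assms(1)] .
  then have "act v (x # q) = v # x # q" by (intro act_ascent) simp
  then show ?thesis using feq_trans[OF a] feq_sym[OF q] by simp
next
  case False
  then have "act x (v # p) = x # v # p" by (rule act_ascent)
  then show ?thesis using act_descent[of x "v # p" v p] feq_refl by simp
qed

text \<open>
  Together with \<open>act_back\<close> this shows that \<open>act\<close> respects elementary homotopies. The cases are
  whether the path can be pushed so as to come from \<open>w1\<close> or from \<open>w2\<close>.
\<close>

lemma act_square:
  assumes r: "reduced (v # p)" and s: "sq v w1 z w2"
  shows "feq (act z (act w1 (v # p))) (act z (act w2 (v # p)))"
proof -
  have s1: "sq w1 v w2 z" using sq_rotate[OF sq_rotate[OF sq_flip[OF sq_rotate[OF s]]]] .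
  let ?D = "\<lambda>w. \<exists>q. feq (v # p) (v # w # q)"
  have mixed: "feq (act z (act w1 (v # p))) (act z (act w2 (v # p)))"
    if s1: "sq w1 v w2 z" and D: "?D w1" "\<not> ?D w2" for w1 w2
  proof -
    obtain q where q: "feq (v # p) (v # w1 # q)" using D(1) by auto
    have nz: "\<not> (\<exists>u. feq (w1 # q) (w1 # z # u))"
    proof
      assume "\<exists>u. feq (w1 # q) (w1 # z # u)"
      then obtain u where "feq (w1 # q) (w1 # z # u)" by auto
      then have "feq (v # w1 # q) (v # w1 # z # u)" by (rule feq_cons)
      from feq_trans[OF feq_trans[OF q this] feq_square_step[OF s1]] have "feq (v # p) (v # w2 # z # u)" .
      then show False using D(2) by metis
    qed
    have A: "feq (act z (act w1 (v # p))) (z # w1 # q)"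
      using act_cong[OF act_descent[OF q], of z] act_ascent[OF nz] by simp
    have "feq (w2 # v # p) (w2 # v # w1 # q)" using q by (rule feq_cons)
    moreover have "feq (w2 # v # w1 # q) (w2 # z # w1 # q)"
      by (rule feq_square_step[OF sq_rotate[OF s1]])
    ultimately have "feq (w2 # v # p) (w2 # z # w1 # q)" by (rule feq_trans)
    from act_descent[OF this] have "feq (act z (act w2 (v # p))) (z # w1 # q)" using act_ascent[OF D(2)] by simp
    from feq_trans[OF A feq_sym[OF this]] show ?thesis .
  qed
  consider "?D w1" "?D w2" | "?D w1" "\<not> ?D w2" | "\<not> ?D w1" "?D w2" | "\<not> ?D w1" "\<not> ?D w2" by metis
  then show ?thesis
  proof cases
    case 1
    then obtain q1 q2 where q: "feq (v # p) (v # w1 # q1)" "feq (v # p) (v # w2 # q2)" by auto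
    have "feq (v # w1 # q1) (v # w2 # q2)" using feq_trans[OF feq_sym[OF q(1)] q(2)] .
    from feq_decompose[OF this] show ?thesis
    proof (elim disjE conjE exE)
      assume "w1 = w2"
      then show ?thesis using sq_distinct[OF s] by simp
    next
      fix z' t assume t: "sq w1 v w2 z'" "feq (w1 # q1) (w1 # z' # t)" "feq (w2 # q2) (w2 # z' # t)"
      have zz: "z' = z" using sq_unique[OF t(1) s1] .
      have a: "feq (act w1 (v # p)) (w1 # z # t)" "feq (act w2 (v # p)) (w2 # z # t)"
        using feq_trans[OF act_descent[OF q(1)] t(2)] feq_trans[OF act_descent[OF q(2)] t(3)] unfolding zz .
      have d: "feq (act z (w # z # t)) (z # t)" for w by (rule act_descent[OF feq_refl]) simp
      from feq_trans[OF feq_trans[OF act_cong[OF a(1)] d] feq_sym[OF feq_trans[OF act_cong[OF a(2)] d]]]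
      show ?thesis .
    qed
  next
    case 2
    then show ?thesis using mixed[OF s1] by simp
  next
    case 3
    then show ?thesis using mixed[OF sq_flip[OF s1]] feq_sym by simp
  next
    case 4
    have step: "\<not> (\<exists>q. feq (w1 # v # p) (w1 # z # q))" if "sq w1 v w2 z" "\<not> ?D w2" for w1 w2
    proof
      assume "\<exists>q. feq (w1 # v # p) (w1 # z # q)"
      then obtain q where "feq (w1 # v # p) (w1 # z # q)" by auto
      from feq_decompose[OF this] show False
      proof (elim disjE conjE exE)
        assume "v = z" then show False using sq_distinct[OF that(1)] by simp
      next
        fix y t assume y: "sq v w1 z y" "feq (v # p) (v # y # t)"
        have "y = w2" using sq_unique[OF y(1) sq_descent_swap(1)[OF that(1)]] .
        then show False using y(2) that(2) by metis
      qed
    qed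
    have "act z (act w1 (v # p)) = z # w1 # v # p" "act z (act w2 (v # p)) = z # w2 # v # p"
      using act_ascent[OF 4(1)] act_ascent[OF 4(2)] act_ascent[OF step[OF s1 4(2)]]
        act_ascent[OF step[OF sq_flip[OF s1] 4(1)]] by simp_all
    moreover have "feq (z # w1 # v # p) (z # w2 # v # p)"
      by (rule feq_square_step[OF sq_rotate[OF s]])
    ultimately show ?thesis by simp
  qed
qed

end

section \<open>Simple connectivity and the edge metric\<close>

locale cat0_cubical =
  fixes X :: "'v set set"
  assumes CAT0: "CAT0_cube_complex X"

sublocale cat0_cubical \<subseteq> flag_cubical X
  using CAT0 by unfold_locales (auto simp: CAT0_cube_complex_def)

context cat0_cubical
begin

definition normal_form :: "'v list \<Rightarrow> 'v list" where
  "normal_form p = fold act (tl p) [hd p]"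

lemma edge_path_iff: "edge_path X p \<longleftrightarrow> p \<noteq> [] \<and> set p \<subseteq> vertices X \<and> successively adj p"
  unfolding edge_path_def adj_def ..

lemma successively_adj_rev: "successively adj p \<Longrightarrow> successively adj (rev p)"
proof -
  assume "successively adj p"
  then have "successively (\<lambda>x y. adj y x) p" by (rule successively_mono) (erule adj_sym)
  then show ?thesis by (simp only: successively_rev)
qed

lemma fold_act:
  assumes "reduced r" "successively adj (hd r # t)"
  shows "reduced (fold act t r) \<and> hd (fold act t r) = last (hd r # t) \<and> last (fold act t r) = last r \<and>
    length (fold act t r) \<le> length r + length t"
  using assms
proof (induction t arbitrary: r)
  case (Cons x t)
  obtain v p where r: "r = v # p" using reduced_nonempty[OF Cons.prems(1)] by (cases r) auto
  have ax: "adj x v" and st: "successively adj (x # t)" using Cons.prems(2) r adj_sym by auto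
  note b = act_basic[OF Cons.prems(1)[unfolded r] ax]
  have "reduced (fold act t (act x r)) \<and> hd (fold act t (act x r)) = last (hd (act x r) # t) \<and>
    last (fold act t (act x r)) = last (act x r) \<and> length (fold act t (act x r)) \<le> length (act x r) + length t"
    by (rule Cons.IH) (use b r st in auto)
  then show ?case using b r by auto
qed simp

lemma fold_act_cong: "feq r r' \<Longrightarrow> feq (fold act t r) (fold act t r')"
  by (induction t arbitrary: r r') (auto intro: act_cong)

lemma retrace:
  assumes "reduced r" "successively adj (hd r # t)"
  shows "feq (fold act (tl (rev (hd r # t))) (fold act t r)) r"
  using assms
proof (induction t arbitrary: r)
  case Nil
  then show ?case using feq_refl reduced_nonempty by simp
next
  case (Cons x t)
  obtain v p where r: "r = v # p" using reduced_nonempty[OF Cons.prems(1)] by (cases r) auto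
  have ax: "adj x v" and st: "successively adj (x # t)" using Cons.prems(2) r adj_sym by auto
  note b = act_basic[OF Cons.prems(1)[unfolded r] ax]
  have IH: "feq (fold act (tl (rev (x # t))) (fold act t (act x r))) (act x r)"
    using Cons.IH[of "act x r"] b r st by simp
  have "tl (rev (hd r # x # t)) = tl (rev (x # t)) @ [v]" using r by (simp add: tl_append split: list.splits)
  then have "fold act (tl (rev (hd r # x # t))) (fold act (x # t) r) =
      act v (fold act (tl (rev (x # t))) (fold act t (act x r)))" by simp
  then show ?case using feq_trans[OF act_cong[OF IH] act_back[OF Cons.prems(1)[unfolded r] ax, folded r]] r by simp
qed

lemma normal_form_append: "a \<noteq> [] \<Longrightarrow> normal_form (a @ t) = fold act t (normal_form a)"
  unfolding normal_form_def by simp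

lemma normal_form_path:
  assumes "edge_path X p"
  shows "reduced (normal_form p)" "hd (normal_form p) = last p" "last (normal_form p) = hd p"
    "length (normal_form p) \<le> length p"
proof -
  obtain u t where p: "p = u # t" using assms unfolding edge_path_def by (cases p) auto
  have "successively adj (u # t)" using assms p edge_path_iff by simp
  then show "reduced (normal_form p)" "hd (normal_form p) = last p" "last (normal_form p) = hd p"
    "length (normal_form p) \<le> length p"
    using fold_act[of "[u]" t] p unfolding normal_form_def by auto
qed

lemma path_replace:
  assumes "\<And>R. reduced R \<Longrightarrow> hd R = u \<Longrightarrow> feq (fold act m R) (fold act m' R)"
    and path: "edge_path X (r @ [u] @ m @ s)"
  shows "feq (normal_form (r @ [u] @ m @ s)) (normal_form (r @ [u] @ m' @ s))"
proof -
  have "edge_path X (r @ [u])" using path unfolding edge_path_iff by (auto simp: successively_append_iff)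
  then have "reduced (normal_form (r @ [u]))" "hd (normal_form (r @ [u])) = u"
    using normal_form_path[of "r @ [u]"] by auto
  from fold_act_cong[OF assms(1)[OF this], of s] show ?thesis
    using normal_form_append[of "r @ [u]" "m @ s"] normal_form_append[of "r @ [u]" "m' @ s"] by simp
qed

lemma homotopy_step:
  assumes "elementary_homotopy X p q"
  shows "(edge_path X p \<longleftrightarrow> edge_path X q) \<and> hd p = hd q \<and> last p = last q \<and>
    (edge_path X p \<longrightarrow> feq (normal_form p) (normal_form q))"
  using assms
proof cases
  case (backtrack u w r s)
  have e: "adj u w" "adj w u" using backtrack adj_sym unfolding adj_def by auto
  have v: "u \<in> vertices X" "w \<in> vertices X" using adj_vertices[OF e(1)] by auto
  have ep: "edge_path X p \<longleftrightarrow> edge_path X q"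
    unfolding backtrack edge_path_iff using e v by (auto simp: successively_append_iff)
  have "feq (fold act [w, u] R) (fold act [] R)" if R: "reduced R" "hd R = u" for R
  proof -
    obtain R' where R': "R = u # R'" using reduced_nonempty[OF R(1)] R(2) by (cases R) auto
    show ?thesis using act_back[OF R(1)[unfolded R'] e(2)] unfolding R' by simp
  qed
  from path_replace[of u "[w, u]" "[]" r s, OF this] have "edge_path X p \<longrightarrow> feq (normal_form p) (normal_form q)"
    unfolding backtrack by simp
  then show ?thesis using ep unfolding backtrack by (cases r; cases s) auto
next
  case (square a b c d r s)
  have sq: "sq a b c d" using square unfolding sq_def adj_def by simp
  have e: "adj a b" "adj b c" "adj a d" "adj d c" using sq adj_sym unfolding sq_def by auto
  have v: "b \<in> vertices X" "d \<in> vertices X" using adj_vertices[OF e(1)] adj_vertices[OF e(3)] by auto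
  have ep: "edge_path X p \<longleftrightarrow> edge_path X q"
    unfolding square edge_path_iff using e v by (auto simp: successively_append_iff)
  have "feq (fold act [b, c] R) (fold act [d, c] R)" if R: "reduced R" "hd R = a" for R
  proof -
    obtain R' where R': "R = a # R'" using reduced_nonempty[OF R(1)] R(2) by (cases R) auto
    show ?thesis using act_square[OF R(1)[unfolded R'] sq] unfolding R' by simp
  qed
  from path_replace[of a "[b, c]" "[d, c]" r s, OF this] have "edge_path X p \<longrightarrow> feq (normal_form p) (normal_form q)"
    unfolding square by simp
  then show ?thesis using ep unfolding square by (cases r; cases s) auto
qed

lemma homotopic_normal_form:
  assumes "equivclp (elementary_homotopy X) p q" "edge_path X p"
  shows "edge_path X q \<and> feq (normal_form p) (normal_form q)"
  using assms(1)
proof (induction rule: equivclp_induct)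
  case base
  show ?case using assms(2) feq_refl reduced_nonempty[OF normal_form_path(1)[OF assms(2)]] by simp
next
  case (step y z)
  have yz: "elementary_homotopy X y z \<or> elementary_homotopy X z y" using step by simp
  have y: "edge_path X y" "feq (normal_form p) (normal_form y)" using step by auto
  have "edge_path X z \<and> feq (normal_form y) (normal_form z)"
    using yz homotopy_step[of y z] homotopy_step[of z y] y(1) feq_sym by metis
  then show ?case using feq_trans[OF y(2)] by simp
qed

text \<open>
  Composing \<open>p\<close> with the reverse of \<open>q\<close> gives a closed path, which is homotopic to a constant one.
  So acting on the normal form of \<open>p\<close> with the reverse of \<open>q\<close>, and then with \<open>q\<close>, gives the normal
  form of \<open>q\<close>; but acting back and forth changes nothing.
\<close>

lemma normal_form_unique:
  assumes p: "edge_path X p" and q: "edge_path X q" and ends: "hd p = hd q" "last p = last q"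
  shows "feq (normal_form p) (normal_form q)"
proof -
  obtain u t where qt: "q = u # t" using q unfolding edge_path_def by (cases q) auto
  have pne: "p \<noteq> []" using p unfolding edge_path_def by simp
  define r where "r = tl (rev q)"
  have rq: "rev q = last q # r" unfolding r_def by (metis hd_rev list.collapse qt rev_is_Nil_conv list.distinct(1))
  have sr: "successively adj (last q # r)" using successively_adj_rev q rq unfolding edge_path_iff by metis
  have "set (rev q) = set (last q # r)" by (simp only: rq)
  then have "set r \<subseteq> vertices X" using q unfolding edge_path_iff by auto
  moreover have "successively adj r" "r = [] \<or> adj (last p) (hd r)" using sr ends(2) by (cases r; simp)+
  ultimately have closed: "edge_path X (p @ r)"
    using p unfolding edge_path_iff by (simp add: successively_append_iff)
  have "hd (p @ r) = last (p @ r)"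
  proof (cases "r = []")
    case True
    have "length (rev q) = length (last q # r)" by (simp only: rq)
    then have "t = []" using qt True by simp
    then show ?thesis using True ends qt by simp
  next
    case False
    have "last r = last (rev q)" unfolding rq using False by simp
    also have "\<dots> = hd q" using qt by (simp add: last_rev)
    finally show ?thesis using False ends pne by simp
  qed
  then have "equivclp (elementary_homotopy X) (p @ r) [hd (p @ r)]"
    using CAT0 closed unfolding CAT0_cube_complex_def simply_connected_complex_def by blast
  then have "feq (normal_form (p @ r)) (normal_form [hd (p @ r)])" using homotopic_normal_form closed by blast
  then have A: "feq (fold act r (normal_form p)) [u]"
    using normal_form_append[OF pne] ends(1) qt pne unfolding normal_form_def by simp
  have "hd (normal_form p) = last q" using normal_form_path(2)[OF p] ends(2) by simp
  then have "feq (fold act (tl (rev (last q # r))) (fold act r (normal_form p))) (normal_form p)"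
    using retrace[OF normal_form_path(1)[OF p], of r] sr by simp
  moreover have "tl (rev (last q # r)) = t" using rq qt by (metis list.sel(3) rev_rev_ident)
  ultimately have B: "feq (fold act t (fold act r (normal_form p))) (normal_form p)" by simp
  have "normal_form q = fold act t [u]" unfolding normal_form_def qt by simp
  then show ?thesis using feq_trans[OF feq_sym[OF B] fold_act_cong[OF A, of t]] by simp
qed

lemma reduced_successively: "reduced r \<Longrightarrow> successively adj r"
  by (induction r rule: reduced.induct) auto

lemma successively_vertices:
  "successively adj l \<Longrightarrow> l \<noteq> [] \<Longrightarrow> hd l \<in> vertices X \<Longrightarrow> set l \<subseteq> vertices X"
proof (induction l)
  case (Cons a l)
  then show ?case using adj_vertices by (cases l) auto
qed simp

lemma path_exists:
  assumes "u \<in> vertices X" "v \<in> vertices X"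
  obtains p where "edge_path X p" "hd p = u" "last p = v"
  using CAT0 assms unfolding CAT0_cube_complex_def simply_connected_complex_def connected_complex_def by metis

abbreviation "cdist \<equiv> comb_dist X"

text \<open>
  All paths with the given ends have the same normal form, and passing to the normal form does not
  increase the length.
\<close>

lemma dist_normal_form:
  assumes p: "edge_path X p" shows "Suc (cdist (hd p) (last p)) = length (normal_form p)"
proof -
  note nf = normal_form_path[OF p]
  let ?r = "normal_form p"
  have ne: "?r \<noteq> []" using reduced_nonempty[OF nf(1)] .
  have lastv: "last p \<in> vertices X" using p unfolding edge_path_def by (metis last_in_set subsetD)
  have "cdist (hd p) (last p) = length ?r - 1"
    unfolding comb_dist_def
  proof (rule Least_equality)
    have "edge_path X (rev ?r)"
      using successively_adj_rev[OF reduced_successively[OF nf(1)]]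
        successively_vertices[OF reduced_successively[OF nf(1)] ne] nf(2) lastv ne
      unfolding edge_path_iff by simp
    moreover have "hd (rev ?r) = hd p" "last (rev ?r) = last p" using nf ne by (simp_all add: hd_rev last_rev)
    ultimately show "\<exists>q. edge_path X q \<and> hd q = hd p \<and> last q = last p \<and> length q = Suc (length ?r - 1)"
      using ne by (intro exI[of _ "rev ?r"]) simp
    fix n assume "\<exists>q. edge_path X q \<and> hd q = hd p \<and> last q = last p \<and> length q = Suc n"
    then obtain q where q: "edge_path X q" "hd q = hd p" "last q = last p" "length q = Suc n" by auto
    have "length (normal_form q) = length ?r" using feq_basic[OF normal_form_unique[OF q(1) p q(2,3)]] by simp
    then show "length ?r - 1 \<le> n" using normal_form_path(4)[OF q(1)] q(4) by simp
  qed
  then show ?thesis using ne by (cases ?r) auto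
qed

lemma path_extend:
  assumes "edge_path X p" "adj w (last p)"
  shows "edge_path X (p @ [w])" "normal_form (p @ [w]) = act w (normal_form p)"
proof -
  show "edge_path X (p @ [w])"
    using assms adj_sym adj_vertices unfolding edge_path_iff by (auto simp: successively_append_iff)
  show "normal_form (p @ [w]) = act w (normal_form p)"
    using normal_form_append[of p "[w]"] assms unfolding edge_path_def by simp
qed

lemma dist_act:
  assumes "v0 \<in> vertices X" "v \<in> vertices X"
  shows "\<exists>p. reduced (v # p) \<and> Suc (cdist v0 v) = length (v # p) \<and> last (v # p) = v0 \<and>
    (\<forall>w. adj w v \<longrightarrow> Suc (cdist v0 w) = length (act w (v # p))) \<and>
    (\<forall>w z. adj w v \<longrightarrow> adj z w \<longrightarrow> Suc (cdist v0 z) = length (act z (act w (v # p))))"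
proof -
  obtain q where q: "edge_path X q" "hd q = v0" "last q = v" using path_exists[OF assms] .
  note nf = normal_form_path[OF q(1)]
  obtain p where p: "normal_form q = v # p"
    using reduced_nonempty[OF nf(1)] nf(2) q(3) by (cases "normal_form q") auto
  have hq: "hd (q @ l) = v0" for l using q unfolding edge_path_def by simp
  show ?thesis
  proof (intro exI[of _ p] conjI allI impI)
    show "reduced (v # p)" "last (v # p) = v0" using nf p q by auto
    show "Suc (cdist v0 v) = length (v # p)" using dist_normal_form[OF q(1)] q p by simp
    fix w assume w: "adj w v"
    note ext = path_extend[OF q(1), of w, unfolded q(3), OF w]
    show "Suc (cdist v0 w) = length (act w (v # p))"
      using dist_normal_form[OF ext(1)] unfolding ext(2) hq p by simp
  next
    fix w z assume w: "adj w v" and z: "adj z w"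
    note ext = path_extend[OF q(1), of w, unfolded q(3), OF w]
    have "adj z (last (q @ [w]))" using z by simp
    note ext2 = path_extend[OF ext(1) this]
    show "Suc (cdist v0 z) = length (act z (act w (v # p)))"
      using dist_normal_form[OF ext2(1)] hq[of "[w, z]"] unfolding ext2(2) ext(2) p by simp
  qed
qed

lemma dist_self: "v \<in> vertices X \<Longrightarrow> cdist v v = 0"
  using dist_normal_form[of "[v]"] unfolding edge_path_def normal_form_def by simp

lemma dist_zero:
  assumes "u \<in> vertices X" "v \<in> vertices X" "cdist u v = 0" shows "u = v"
proof -
  obtain p where p: "Suc (cdist u v) = length (v # p)" "last (v # p) = u"
    using dist_act[OF assms(1,2)] by blast
  then show ?thesis using assms(3) by simp
qed

lemma dist_sym:
  assumes "u \<in> vertices X" "v \<in> vertices X" shows "cdist u v = cdist v u"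
proof -
  have "cdist a b \<le> cdist b a" if ab: "a \<in> vertices X" "b \<in> vertices X" for a b
  proof -
    obtain p where p: "reduced (a # p)" "Suc (cdist b a) = length (a # p)" "last (a # p) = b"
      using dist_act[OF ab(2,1)] by blast
    have "edge_path X (a # p)"
      using reduced_successively[OF p(1)] successively_vertices[of "a # p"] ab(1) unfolding edge_path_iff by simp
    from dist_normal_form[OF this] normal_form_path(4)[OF this] show ?thesis using p(2,3) by simp
  qed
  then show ?thesis using assms by (simp add: le_antisym)
qed

text \<open>
  Acting with an edge changes the length by exactly one. In particular the 1-skeleton is
  bipartite.
\<close>

lemma dist_adj:
  assumes "v0 \<in> vertices X" "adj w v"
  shows "cdist v0 w = Suc (cdist v0 v) \<or> cdist v0 v = Suc (cdist v0 w)"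
proof -
  have v: "v \<in> vertices X" using adj_vertices[OF assms(2)] by simp
  obtain p where p: "reduced (v # p)" "Suc (cdist v0 v) = length (v # p)"
    "Suc (cdist v0 w) = length (act w (v # p))"
    using dist_act[OF assms(1) v] assms(2) by metis
  show ?thesis using act_basic(4)[OF p(1) assms(2)] p(2,3) by linarith
qed

lemma closer_neighbour:
  assumes "v0 \<in> vertices X" "v \<in> vertices X" "v \<noteq> v0"
  obtains w where "adj w v" "cdist v0 v = Suc (cdist v0 w)"
proof -
  obtain p where p: "reduced (v # p)" "Suc (cdist v0 v) = length (v # p)"
    "\<And>w. adj w v \<Longrightarrow> Suc (cdist v0 w) = length (act w (v # p))"
    "\<And>w z. adj w v \<Longrightarrow> adj z w \<Longrightarrow> Suc (cdist v0 z) = length (act z (act w (v # p)))"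
    "last (v # p) = v0"
    using dist_act[OF assms(1,2)] by blast
  obtain w q where q: "p = w # q" using p(5) assms(3) by (cases p) auto
  have a: "adj w v" using p(1) q adj_sym by simp
  have "length (act w (v # p)) = length (w # q)"
    using feq_basic[OF act_descent[OF feq_refl[of "v # p", unfolded q]]] q by simp
  then have "cdist v0 v = Suc (cdist v0 w)" using p(2) p(3)[OF a] q by simp
  then show ?thesis using that a by simp
qed

text \<open>
  The geodesics to \<open>v\<close> through \<open>w1\<close> and \<open>w2\<close> are equivalent, and \<open>feq_decompose\<close> yields the
  square.
\<close>

lemma quadrangle:
  assumes v0: "v0 \<in> vertices X" and w1: "adj w1 v" "cdist v0 v = Suc (cdist v0 w1)"
    and w2: "adj w2 v" "cdist v0 v = Suc (cdist v0 w2)" and ne: "w1 \<noteq> w2"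
  obtains z where "sq w1 v w2 z" "cdist v0 w1 = Suc (cdist v0 z)"
proof -
  have v: "v \<in> vertices X" using adj_vertices[OF w1(1)] by simp
  obtain p where p: "reduced (v # p)" "Suc (cdist v0 v) = length (v # p)"
    and a1: "\<And>w. adj w v \<Longrightarrow> Suc (cdist v0 w) = length (act w (v # p))"
    and a2: "\<And>w z. adj w v \<Longrightarrow> adj z w \<Longrightarrow> Suc (cdist v0 z) = length (act z (act w (v # p)))"
    and "last (v # p) = v0"
    using dist_act[OF v0 v] by blast
  have desc: "\<exists>q. feq (v # p) (v # w # q)" if w: "adj w v" "cdist v0 v = Suc (cdist v0 w)" for w
  proof (rule ccontr)
    assume "\<not> ?thesis"
    then have "length (act w (v # p)) = Suc (length (v # p))" using act_ascent by simp
    then show False using a1[OF w(1)] p(2) w(2) by simp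
  qed
  obtain q1 q2 where q: "feq (v # p) (v # w1 # q1)" "feq (v # p) (v # w2 # q2)"
    using desc[OF w1] desc[OF w2] by auto
  from feq_decompose[OF feq_trans[OF feq_sym[OF q(1)] q(2)]] ne
  obtain z t where z: "sq w1 v w2 z" "feq (w1 # q1) (w1 # z # t)" by auto
  have zw: "adj z w1" using z(1) unfolding sq_def by simp
  have d: "feq (act w1 (v # p)) (w1 # z # t)" using feq_trans[OF act_descent[OF q(1)] z(2)] .
  have "feq (act z (act w1 (v # p))) (z # t)"
    using feq_trans[OF act_cong[OF d] act_descent[OF feq_refl]] by simp
  then have "length (act z (act w1 (v # p))) = length (z # t)" using feq_basic by blast
  then have "cdist v0 w1 = Suc (cdist v0 z)" using a1[OF w1(1)] a2[OF w1(1) zw] feq_basic[OF d] by simp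
  then show ?thesis using that z(1) by simp
qed

end

section \<open>Halfspaces in terms of the edge metric\<close>

context cat0_cubical
begin

text \<open>
  The vertices closer to \<open>a\<close> than to \<open>b\<close>. For an edge \<open>{a, b}\<close> this turns out to be the halfspace
  containing \<open>a\<close> of the hyperplane dual to the edge.
\<close>

definition W :: "'v \<Rightarrow> 'v \<Rightarrow> 'v set" where
  "W a b = {x \<in> vertices X. cdist x a < cdist x b}"

abbreviation "par \<equiv> equivclp (opposite_edges X)"

lemma adj_distances:
  assumes "x \<in> vertices X" "adj a b"
  shows "cdist x a = Suc (cdist x b) \<or> cdist x b = Suc (cdist x a)"
    "cdist a x = Suc (cdist b x) \<or> cdist b x = Suc (cdist a x)"
proof -
  show *: "cdist x a = Suc (cdist x b) \<or> cdist x b = Suc (cdist x a)" by (rule dist_adj[OF assms])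
  show "cdist a x = Suc (cdist b x) \<or> cdist b x = Suc (cdist a x)"
    using * dist_sym[OF assms(1), of a] dist_sym[OF assms(1), of b] adj_vertices[OF assms(2)] by simp
qed

lemma mem_W:
  assumes "adj a b" "x \<in> vertices X"
  shows "x \<in> W a b \<longleftrightarrow> cdist x b = Suc (cdist x a)"
proof -
  have "cdist x a < cdist x b \<longleftrightarrow> cdist x b = Suc (cdist x a)"
    using adj_distances(1)[OF assms(2,1)] by (elim disjE; linarith)
  then show ?thesis unfolding W_def using assms(2) by simp
qed

lemma W_sub: "W a b \<subseteq> vertices X"
  unfolding W_def by blast

lemma W_compl:
  assumes "adj a b" shows "W b a = vertices X - W a b"
proof -
  have "cdist x b < cdist x a \<longleftrightarrow> \<not> cdist x a < cdist x b" if "x \<in> vertices X" for x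
    using adj_distances(1)[OF that assms] by (elim disjE; linarith)
  then show ?thesis unfolding W_def by blast
qed

lemma W_ends:
  assumes "adj a b" shows "a \<in> W a b" "b \<notin> W a b" "b \<in> W b a" "a \<notin> W b a"
proof -
  have v: "a \<in> vertices X" "b \<in> vertices X" using adj_vertices[OF assms] by auto
  have "cdist a b \<noteq> 0" "cdist b a \<noteq> 0" using dist_zero v adj_neq[OF assms] by metis+
  then show "a \<in> W a b" "b \<notin> W a b" "b \<in> W b a" "a \<notin> W b a"
    using dist_self v unfolding W_def by simp_all
qed

lemma sq_reverse: "sq a b c d \<Longrightarrow> sq d c b a"
  using sq_rotate[OF sq_rotate[OF sq_rotate[OF sq_flip]]] .

text \<open>
  If \<open>x\<close> is closer to \<open>a\<close> than to \<open>b\<close>, but closer to \<open>c\<close> than to \<open>d\<close>, then \<open>a\<close> and \<open>c\<close> are both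
  closer to \<open>x\<close> than \<open>b\<close> is. The quadrangle condition gives a square on \<open>a, b, c\<close>, whose fourth
  vertex is \<open>d\<close> by uniqueness, but is too close to \<open>x\<close>.
\<close>

lemma W_square_sub:
  assumes s: "sq a b c d" shows "W a b \<subseteq> W d c"
proof
  fix x assume x: "x \<in> W a b"
  then have xv: "x \<in> vertices X" using W_sub by blast
  have e: "adj a b" "adj b c" "adj d c" "adj d a" using s adj_sym unfolding sq_def by auto
  have ab: "cdist x b = Suc (cdist x a)" using x mem_W[OF e(1) xv] by simp
  show "x \<in> W d c"
  proof (rule ccontr)
    assume "x \<notin> W d c"
    then have dc: "cdist x d = Suc (cdist x c)" using adj_distances(1)[OF xv e(3)] xv mem_W[OF e(3) xv] by blast
    have c: "cdist x b = Suc (cdist x c)"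
      using adj_distances(1)[OF xv e(2)] adj_distances(1)[OF xv e(4)] ab dc by (elim disjE; linarith)
    have ne: "a \<noteq> c" using sq_distinct[OF s] by simp
    obtain z where z: "sq a b c z" "cdist x a = Suc (cdist x z)"
      using quadrangle[OF xv e(1) ab adj_sym[OF e(2)] c ne] .
    have "z = d" by (rule sq_unique[OF z(1) s])
    then have "cdist x a = Suc (cdist x d)" using z(2) by simp
    then show False using ab c dc by linarith
  qed
qed

lemma W_square: "sq a b c d \<Longrightarrow> W a b = W d c"
  by (rule equalityI[OF W_square_sub W_square_sub[OF sq_reverse]])

lemma edge_elim:
  assumes "e \<in> edges X" obtains a b where "e = {a, b}" "adj a b"
proof -
  have "card e = 2" using assms unfolding edges_def by simp
  then obtain a b where "e = {a, b}" by (auto simp: card_2_iff)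
  then show ?thesis using that assms unfolding adj_def by simp
qed

lemma opposite_square:
  assumes "opposite_edges X {a, b} f"
  obtains c d where "f = {c, d}" "sq a b c d"
proof -
  have ab: "adj a b" using assms unfolding opposite_edges_def adj_def by simp
  obtain Q where Q: "Q \<in> X" "card Q = 4" "a \<in> Q" "b \<in> Q" "f \<subseteq> Q" and f: "{a, b} \<inter> f = {}" "card f = 2"
    using assms unfolding opposite_edges_def squares_def edges_def by auto
  obtain n \<phi> where ch: "cube_chart X Q n \<phi>" using chart_exists[OF Q(1)] by auto
  have "2 ^ n = (2::nat) ^ 2" using chart_card[OF ch] Q(2) by simp
  then have n: "n = 2" using power_inject_exp[of "2::nat" n 2] by simp
  obtain i where i: "i < n" "\<phi> b = switch (\<phi> a) i" using chart_adj[OF ch Q(3,4) ab] .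
  define j where "j = 1 - i"
  have j: "j < n" "i \<noteq> j" using i(1) n unfolding j_def by arith+
  define c where "c = inv_into Q \<phi> (switch (switch (\<phi> a) i) j)"
  define d where "d = inv_into Q \<phi> (switch (\<phi> a) j)"
  have A: "\<phi> a \<subseteq> {..<n}" using chart_mem(1)[OF ch Q(3)] .
  have "sq a b c d"
    using chart_square[OF ch A i(1) j] chart_mem(2)[OF ch Q(3)] chart_mem(2)[OF ch Q(4)]
    unfolding i(2) c_def d_def by simp
  moreover have "c \<in> Q" "d \<in> Q" unfolding c_def d_def
    using chart_inv(1)[OF ch switch_sub[OF switch_sub[OF A i(1)] j(1)]]
      chart_inv(1)[OF ch switch_sub[OF A j(1)]] by auto
  moreover have "f = {c, d}"
  proof -
    have D: "distinct [a, b, c, d]" using sq_distinct[OF \<open>sq a b c d\<close>] .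
    have fin: "finite Q" using Q(2) by (metis card.infinite zero_neq_numeral)
    have "{a, b, c, d} \<subseteq> Q" using Q \<open>c \<in> Q\<close> \<open>d \<in> Q\<close> by auto
    moreover have "card {a, b, c, d} = card Q" using D Q(2) by (simp add: card_insert_if)
    ultimately have "{a, b, c, d} = Q" using card_subset_eq[OF fin] by metis
    then have "f \<subseteq> {c, d}" using Q(5) f(1) by auto
    moreover have "card {c, d} = card f" using D f(2) by simp
    ultimately show ?thesis using card_subset_eq[of "{c, d}" f] by simp
  qed
  ultimately show ?thesis using that by blast
qed

lemma square_opposite: "sq a b c d \<Longrightarrow> opposite_edges X {a, b} {d, c}"
proof -
  assume s: "sq a b c d"
  have "adj a b" "adj d c" "{a, b, c, d} \<in> squares X" using s adj_sym unfolding sq_def by auto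
  moreover have "{a, b} \<inter> {d, c} = {}" using sq_distinct[OF s] by auto
  ultimately show ?thesis unfolding opposite_edges_def adj_def
    by (intro conjI bexI[of _ "{a, b, c, d}"]) auto
qed

lemma opposite_sym: "opposite_edges X e f \<Longrightarrow> opposite_edges X f e"
  unfolding opposite_edges_def by blast

lemma par_ends:
  assumes "par {a, b} f" "adj a b"
  obtains c d where "f = {c, d}" "adj c d" "W c d = W a b"
proof -
  have "\<exists>c d. f = {c, d} \<and> adj c d \<and> W c d = W a b"
    using assms(1)
  proof (induction rule: equivclp_induct)
    case base
    show ?case using assms(2) by blast
  next
    case (step y z)
    then obtain c d where y: "y = {c, d}" "adj c d" "W c d = W a b" by auto
    have "opposite_edges X {c, d} z" using step(2) opposite_sym y(1) by auto
    then obtain u v where z: "z = {u, v}" "sq c d u v" by (rule opposite_square)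
    have "adj v u" "z = {v, u}" using z adj_sym unfolding sq_def by auto
    then show ?case using W_square[OF z(2)] y(3) by metis
  qed
  then show ?thesis using that by metis
qed

text \<open>
  Induction on the distance to \<open>a\<close>: move one step from \<open>x\<close> to a neighbour \<open>x'\<close> closer to \<open>a\<close>. Both
  \<open>x'\<close> and \<open>y\<close> are closer to \<open>b\<close> than \<open>x\<close> is, and the square from the quadrangle condition
  contains an edge opposite to \<open>{x, y}\<close> at \<open>x'\<close>, which still crosses.
\<close>

lemma crossing_edge_par:
  assumes "adj a b" "adj x y" "x \<in> W a b" "y \<notin> W a b"
  shows "par {a, b} {x, y}"
  using assms(2-4)
proof (induction "cdist x a" arbitrary: x y)
  case 0
  have v: "x \<in> vertices X" "y \<in> vertices X" "a \<in> vertices X" "b \<in> vertices X"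
    using adj_vertices 0(2) assms(1) by auto
  have "x = a" using dist_zero[OF v(1,3)] 0 by simp
  moreover have "y = b"
  proof -
    have "cdist y a = Suc (cdist y b)" using adj_distances(1)[OF v(2) assms(1)] 0(4) mem_W[OF assms(1) v(2)] by auto
    moreover have "cdist a a = Suc (cdist y a) \<or> cdist y a = Suc (cdist a a)"
      using adj_distances(2)[OF v(3) 0(2)] \<open>x = a\<close> by simp
    then have "cdist y a = 1" using dist_self[OF v(3)] by (elim disjE; linarith)
    ultimately show ?thesis using dist_zero[OF v(2,4)] by simp
  qed
  ultimately show ?case by simp
next
  case (Suc k)
  have v: "x \<in> vertices X" "y \<in> vertices X" "a \<in> vertices X" "b \<in> vertices X"
    using adj_vertices Suc(3) assms(1) by auto
  have xa: "cdist x a = Suc k" using Suc(2) by (rule sym)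
  have xb: "cdist x b = Suc (Suc k)" using Suc(4) mem_W[OF assms(1) v(1)] xa by simp
  have ya: "cdist y a = Suc (cdist y b)" using adj_distances(1)[OF v(2) assms(1)] Suc(5) mem_W[OF assms(1) v(2)] by auto
  have yb: "cdist y b = Suc k"
    using ya xa xb adj_distances(2)[OF v(3) Suc(3)] adj_distances(2)[OF v(4) Suc(3)] by (elim disjE; linarith)
  have "x \<noteq> a" using dist_self[OF v(3)] xa by (metis nat.distinct(1))
  then obtain x' where x': "adj x' x" "cdist a x = Suc (cdist a x')" using closer_neighbour[OF v(3,1)] by blast
  have v': "x' \<in> vertices X" using adj_vertices[OF x'(1)] by simp
  have x'a: "cdist x' a = k" using x'(2) xa dist_sym[OF v(3,1)] dist_sym[OF v(3) v'] by simp
  have x'b: "cdist x' b = Suc k"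
    using adj_distances(2)[OF v(4) x'(1)] adj_distances(1)[OF v' assms(1)] xb x'a by (elim disjE; linarith)
  have ne: "y \<noteq> x'"
  proof
    assume "y = x'"
    then show False using ya yb x'a by simp
  qed
  have closer: "cdist b x = Suc (cdist b y)" "cdist b x = Suc (cdist b x')"
    using xb yb x'b dist_sym[OF v(4,1)] dist_sym[OF v(4,2)] dist_sym[OF v(4) v'] by simp_all
  obtain z where z: "sq y x x' z" "cdist b y = Suc (cdist b z)"
    using quadrangle[OF v(4) adj_sym[OF Suc(3)] closer(1) x'(1) closer(2) ne] .
  have e: "adj x' z" "adj z y" using z(1) unfolding sq_def by auto
  have vz: "z \<in> vertices X" using adj_vertices[OF e(1)] by simp
  have zb: "cdist z b = k" using z(2) yb dist_sym[OF v(4,2)] dist_sym[OF v(4) vz] by simp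
  have za: "cdist z a = Suc k"
    using adj_distances(2)[OF v(3) e(1)] adj_distances(2)[OF v(3) e(2)] x'a ya yb by (elim disjE; linarith)
  have "par {a, b} {x', z}"
  proof (rule Suc.hyps(1))
    show "k = cdist x' a" using x'a by simp
    show "adj x' z" by (rule e)
    show "x' \<in> W a b" using mem_W[OF assms(1) v'] x'a x'b by simp
    show "z \<notin> W a b" using mem_W[OF assms(1) vz] za zb by simp
  qed
  moreover have "opposite_edges X {x', z} {x, y}"
    using square_opposite[OF sq_rotate[OF sq_rotate[OF z(1)]]] by (simp add: insert_commute)
  ultimately show ?case using equivclp_trans[OF _ r_into_equivclp] by metis
qed

lemma crossing_edge_W:
  assumes "adj a b" "adj x y" "x \<in> W a b" "y \<notin> W a b"
  shows "W a b = W x y"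
proof -
  obtain c d where cd: "{x, y} = {c, d}" "adj c d" "W c d = W a b"
    using par_ends[OF crossing_edge_par[OF assms] assms(1)] .
  have "c = x \<and> d = y"
  proof (rule ccontr)
    assume "\<not> ?thesis"
    then have "c = y" using cd(1) by (auto simp: doubleton_eq_iff)
    then show False using W_ends(1)[OF cd(2)] cd(3) assms(4) by simp
  qed
  then show ?thesis using cd(3) by simp
qed

lemma par_iff_crosses:
  assumes "adj a b"
  shows "par {a, b} e \<longleftrightarrow> (\<exists>x y. e = {x, y} \<and> adj x y \<and> x \<in> W a b \<and> y \<notin> W a b)"
proof
  assume "par {a, b} e"
  then obtain c d where "e = {c, d}" "adj c d" "W c d = W a b" using par_ends assms by metis
  then show "\<exists>x y. e = {x, y} \<and> adj x y \<and> x \<in> W a b \<and> y \<notin> W a b" using W_ends by blast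
next
  assume "\<exists>x y. e = {x, y} \<and> adj x y \<and> x \<in> W a b \<and> y \<notin> W a b"
  then show "par {a, b} e" using crossing_edge_par[OF assms] by blast
qed

text \<open>
  The set is connected without crossing its own boundary, as geodesics to \<open>a\<close> stay inside, and all
  edges leaving it are parallel to \<open>{a, b}\<close>.
\<close>

lemma W_component:
  assumes ab: "adj a b" and v: "v \<in> W a b"
  shows "{w. (v, w) \<in> {(x, y). {x, y} \<in> edges X - Collect (par {a, b})}\<^sup>*} = W a b"
proof -
  let ?R = "{(x, y). {x, y} \<in> edges X - Collect (par {a, b})}"
  have av: "a \<in> vertices X" using adj_vertices[OF ab] by simp
  have symR: "sym ?R" by (auto simp: sym_def insert_commute)
  have stay: "y \<in> W a b" if "(x, y) \<in> ?R" "x \<in> W a b" for x y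
  proof (rule ccontr)
    assume "y \<notin> W a b"
    moreover have "adj x y" "\<not> par {a, b} {x, y}" using that(1) unfolding adj_def by auto
    ultimately show False using crossing_edge_par[OF ab _ that(2)] by metis
  qed
  have toa: "(x, a) \<in> ?R\<^sup>*" if "x \<in> W a b" for x
    using that
  proof (induction "cdist a x" arbitrary: x)
    case 0
    then have "x = a" using dist_zero[OF av] W_sub by auto
    then show ?case by simp
  next
    case (Suc k)
    have xv: "x \<in> vertices X" using W_sub Suc(3) by blast
    have "x \<noteq> a" using dist_self[OF av] Suc(2) by auto
    then obtain x' where x': "adj x' x" "cdist a x = Suc (cdist a x')" using closer_neighbour[OF av xv] by blast
    have v': "x' \<in> vertices X" using adj_vertices[OF x'(1)] by simp
    have bv: "b \<in> vertices X" using adj_vertices[OF ab] by simp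
    have "cdist x b = Suc (cdist x a)" using Suc(3) mem_W[OF ab xv] by simp
    then have "cdist x' b = Suc (cdist x' a)"
      using adj_distances(2)[OF bv x'(1)] adj_distances(1)[OF v' ab] x'(2) dist_sym[OF av xv] dist_sym[OF av v'] by (elim disjE; linarith)
    then have mem: "x' \<in> W a b" using mem_W[OF ab v'] by simp
    have "\<not> par {a, b} {x, x'}"
    proof
      assume "par {a, b} {x, x'}"
      then obtain p q where "{x, x'} = {p, q}" "q \<notin> W a b" using par_iff_crosses[OF ab] by blast
      then show False using mem Suc(3) by (auto simp: doubleton_eq_iff)
    qed
    then have "(x, x') \<in> ?R" using adj_sym[OF x'(1)] unfolding adj_def by simp
    moreover have "(x', a) \<in> ?R\<^sup>*" using Suc.hyps(1)[of x'] Suc.hyps(2) x'(2) mem by simp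
    ultimately show ?case by (rule converse_rtrancl_into_rtrancl)
  qed
  show ?thesis
  proof (intro equalityI subsetI; simp only: mem_Collect_eq)
    fix w assume "(v, w) \<in> ?R\<^sup>*"
    then show "w \<in> W a b" by (induction rule: rtrancl_induct) (use v stay in blast)+
  next
    fix w assume "w \<in> W a b"
    then have "(a, w) \<in> ?R\<^sup>*" using toa sym_rtrancl[OF symR] by (metis symD)
    then show "(v, w) \<in> ?R\<^sup>*" by (rule rtrancl_trans[OF toa[OF v]])
  qed
qed

lemma sides_par:
  assumes ab: "adj a b" shows "sides X (Collect (par {a, b})) = {W a b, W b a}"
proof -
  let ?c = "\<lambda>v. {w. (v, w) \<in> {(x, y). {x, y} \<in> edges X - Collect (par {a, b})}\<^sup>*}"
  have A: "?c v = W a b" if "v \<in> W a b" for v by (rule W_component[OF ab that])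
  have B: "?c v = W b a" if "v \<in> W b a" for v
    using W_component[OF adj_sym[OF ab] that] by (simp only: insert_commute)
  have "sides X (Collect (par {a, b})) = ?c ` vertices X" unfolding sides_def by blast
  also have "vertices X = W a b \<union> W b a" using W_sub W_compl[OF ab] by blast
  also have "?c ` (W a b \<union> W b a) = ?c ` W a b \<union> ?c ` W b a" by (rule image_Un)
  also have "?c ` W a b = {W a b}" using A W_ends(1)[OF ab] by (force simp only: image_iff)
  also have "?c ` W b a = {W b a}" using B W_ends(3)[OF ab] by (force simp only: image_iff)
  finally show ?thesis by auto
qed

lemma hyperplanes_iff: "H \<in> hyperplanes X \<longleftrightarrow> (\<exists>a b. adj a b \<and> H = Collect (par {a, b}))"
proof
  assume "H \<in> hyperplanes X"
  then obtain e where "H = Collect (par e)" "e \<in> edges X" unfolding hyperplanes_def by auto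
  then show "\<exists>a b. adj a b \<and> H = Collect (par {a, b})" using edge_elim[of e] by metis
next
  assume "\<exists>a b. adj a b \<and> H = Collect (par {a, b})"
  then show "H \<in> hyperplanes X" unfolding hyperplanes_def adj_def by blast
qed

lemma halfspaces_iff: "h \<in> halfspaces X \<longleftrightarrow> (\<exists>a b. adj a b \<and> h = W a b)"
proof
  assume "h \<in> halfspaces X"
  then obtain a b where "adj a b" "h \<in> {W a b, W b a}" unfolding halfspaces_def using hyperplanes_iff sides_par by auto
  then show "\<exists>a b. adj a b \<and> h = W a b" using adj_sym by blast
next
  assume "\<exists>a b. adj a b \<and> h = W a b"
  then obtain a b where ab: "adj a b" "h = W a b" by auto
  have "Collect (par {a, b}) \<in> hyperplanes X" using hyperplanes_iff ab(1) by metis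
  moreover have "h \<in> sides X (Collect (par {a, b}))" unfolding sides_par[OF ab(1)] ab(2) by simp
  ultimately show "h \<in> halfspaces X" unfolding halfspaces_def by (rule UN_I)
qed

lemma bounding_hyperplane_W:
  assumes ab: "adj a b" shows "bounding_hyperplane X (W a b) = Collect (par {a, b})"
  unfolding bounding_hyperplane_def
proof (rule the_equality)
  show "Collect (par {a, b}) \<in> hyperplanes X \<and> W a b \<in> sides X (Collect (par {a, b}))"
    using hyperplanes_iff sides_par[OF ab] ab by auto
  fix H assume "H \<in> hyperplanes X \<and> W a b \<in> sides X H"
  then obtain c d where cd: "adj c d" "H = Collect (par {c, d})" "W a b \<in> {W c d, W d c}"
    using hyperplanes_iff sides_par by auto
  have "par {c, d} {a, b}"
  proof (cases "W a b = W c d")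
    case True
    then show ?thesis using crossing_edge_par[OF cd(1) ab] W_ends[OF ab] by simp
  next
    case False
    then have "W a b = W d c" using cd(3) by simp
    then have "par {d, c} {a, b}" using crossing_edge_par[OF adj_sym[OF cd(1)] ab] W_ends[OF ab] by simp
    then show ?thesis by (simp only: insert_commute)
  qed
  then have "par {c, d} e = par {a, b} e" for e
    using equivclp_trans[of "opposite_edges X" "{c, d}" "{a, b}" e]
      equivclp_trans[of "opposite_edges X" "{a, b}" "{c, d}" e] equivclp_sym by metis
  then have "par {c, d} = par {a, b}" by (rule ext)
  then show "H = Collect (par {a, b})" using cd(2) by simp
qed

lemma triangle:
  assumes "u \<in> vertices X" "v \<in> vertices X" "w \<in> vertices X"
  shows "cdist u w \<le> cdist u v + cdist v w"
  using assms(3)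
proof (induction "cdist v w" arbitrary: w)
  case 0
  have "v = w" using dist_zero[OF assms(2) 0(2)] 0(1) by metis
  then show ?case by simp
next
  case (Suc k)
  have "w \<noteq> v" using dist_self[OF assms(2)] Suc(2) by auto
  then obtain w' where w': "adj w' w" "cdist v w = Suc (cdist v w')" using closer_neighbour[OF assms(2) Suc(3)] by blast
  have "cdist u w' \<le> cdist u v + cdist v w'" using Suc w'(2) adj_vertices[OF w'(1)] by simp
  then show ?case using adj_distances(1)[OF assms(1) w'(1)] w'(2) by (elim disjE; linarith)
qed

lemma convex:
  assumes ab: "adj a b" and "y \<in> W a b" "w \<in> W a b" and w': "adj w' w" "cdist y w = Suc (cdist y w')"
  shows "w' \<in> W a b"
proof (rule ccontr)
  assume n: "w' \<notin> W a b"
  have "W a b = W w w'" using crossing_edge_W[OF ab adj_sym[OF w'(1)] assms(3) n] .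
  then have "cdist y w < cdist y w'" using assms(2) unfolding W_def by simp
  then show False using w'(2) by simp
qed

text \<open>
  Halfspaces are gated. By induction along a geodesic from \<open>y\<close> inside the halfspace; if its last
  edge led closer to \<open>x\<close>, the quadrangle condition based at \<open>x\<close> and convexity would give a vertex
  \<open>z\<close> of the halfspace contradicting the induction hypothesis.
\<close>

lemma gate:
  assumes ab: "adj a b" and x: "x \<in> vertices X" and y: "y \<in> W a b"
    and near: "\<And>w. w \<in> W a b \<Longrightarrow> cdist x y \<le> cdist x w"
  shows "w \<in> W a b \<Longrightarrow> cdist x w = cdist x y + cdist y w"
proof (induction "cdist y w" arbitrary: w rule: less_induct)
  case less
  have yv: "y \<in> vertices X" and wv: "w \<in> vertices X" using y less(2) W_sub by auto
  show ?case
  proof (cases "w = y")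
    case True
    then show ?thesis using dist_self[OF yv] by simp
  next
    case False
    then obtain w' where w': "adj w' w" "cdist y w = Suc (cdist y w')" using closer_neighbour[OF yv wv] by blast
    have m': "w' \<in> W a b" using convex[OF ab y less(2) w'] .
    have v': "w' \<in> vertices X" using m' W_sub by blast
    have d': "cdist x w' = cdist x y + cdist y w'" using less(1)[OF _ m'] w'(2) by simp
    show ?thesis
    proof (rule ccontr)
      assume "\<not> ?thesis"
      then have wc: "cdist x w' = Suc (cdist x w)" using adj_distances(1)[OF x w'(1)] d' w'(2) by (elim disjE; linarith)
      have "w' \<noteq> y"
      proof
        assume "w' = y"
        then show False using near[OF less(2)] wc by simp
      qed
      then obtain w'' where w'': "adj w'' w'" "cdist y w' = Suc (cdist y w'')" using closer_neighbour[OF yv v'] by blast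
      have m'': "w'' \<in> W a b" using convex[OF ab y m' w''] .
      have v'': "w'' \<in> vertices X" using m'' W_sub by blast
      have d'': "cdist x w'' = cdist x y + cdist y w''" using less(1)[OF _ m''] w'(2) w''(2) by simp
      have ne: "w \<noteq> w''" using w'(2) w''(2) by auto
      have "cdist x w' = Suc (cdist x w'')" using d' d'' w''(2) by simp
      then obtain z where z: "sq w w' w'' z" "cdist x w = Suc (cdist x z)"
        using quadrangle[OF x adj_sym[OF w'(1)] wc w''(1) _ ne] by blast
      have e: "adj w'' z" "adj z w" using z(1) unfolding sq_def by auto
      have zv: "z \<in> vertices X" using adj_vertices[OF e(1)] by simp
      have dz: "cdist y z = cdist y w'"
        using adj_distances(1)[OF yv e(1)] adj_distances(1)[OF yv e(2)] w'(2) w''(2) by (elim disjE; linarith)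
      have "cdist w w' = 1"
        using adj_distances(1)[OF wv w'(1)] dist_self[OF wv] by (elim disjE; linarith)
      then have "cdist w w'' = 2"
        using adj_distances(1)[OF wv w''(1)] dist_zero[OF wv v''] ne by auto
      moreover have "cdist w z = 1"
        using adj_distances(1)[OF wv e(2)] dist_self[OF wv] by (elim disjE; linarith)
      ultimately have mz: "z \<in> W a b" using convex[OF ab less(2) m'' adj_sym[OF e(1)]] by simp
      have "cdist x z = cdist x y + cdist y z" using less(1)[OF _ mz] dz w'(2) by simp
      then show False using dz d' wc z(2) by simp
    qed
  qed
qed

lemma edge_separates_once:
  assumes "adj x y" "m \<in> halfspaces X" "x \<in> m" "y \<notin> m" shows "m = W x y"
proof -
  obtain a b where ab: "adj a b" "m = W a b" using assms(2) unfolding halfspaces_iff by auto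
  then show ?thesis using crossing_edge_W[OF ab(1) assms(1)] assms(3,4) by simp
qed

text \<open>
  The first edge of a geodesic from \<open>x\<close> to its gate \<open>y\<close> in the complement of \<open>h\<close>: all vertices
  outside \<open>h\<close> are reached through \<open>y\<close>, so the edge leads closer to each of them.
\<close>

lemma first_edge:
  assumes h: "h \<in> halfspaces X" "x \<in> h"
  shows "\<exists>y. adj x y \<and> W x y \<subseteq> h"
proof -
  obtain a b where ab: "adj a b" "h = W a b" using h halfspaces_iff by auto
  have xv: "x \<in> vertices X" using h ab W_sub by auto
  have ba: "adj b a" using adj_sym[OF ab(1)] .
  define y where "y = (ARG_MIN (\<lambda>w. cdist x w) w. w \<in> W b a)"
  have y: "y \<in> W b a" unfolding y_def by (rule arg_min_natI) (rule W_ends(3)[OF ab(1)])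
  have near: "cdist x y \<le> cdist x w" if "w \<in> W b a" for w
    unfolding y_def by (rule arg_min_nat_le) (rule that)
  have yv: "y \<in> vertices X" using y W_sub by blast
  have "x \<noteq> y" using y h ab W_compl[OF ab(1)] by auto
  then obtain z where z: "adj z x" "cdist y x = Suc (cdist y z)" using closer_neighbour[OF yv xv] by blast
  have zv: "z \<in> vertices X" using adj_vertices[OF z(1)] by simp
  have "w \<notin> W x z" if w: "w \<in> W b a" for w
  proof -
    have wv: "w \<in> vertices X" using w W_sub by blast
    have "cdist x w = cdist x y + cdist y w" using gate[OF ba xv y near w] .
    moreover have "cdist z w \<le> cdist z y + cdist y w" using triangle[OF zv yv wv] .
    ultimately have "cdist z w < cdist x w" using z(2) dist_sym[OF yv xv] dist_sym[OF yv zv] by simp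
    then show ?thesis unfolding W_def using dist_sym[OF xv wv] dist_sym[OF zv wv] by simp
  qed
  then have "W x z \<subseteq> h" using W_sub[of x z] W_compl[OF ab(1)] ab(2) by blast
  then show ?thesis using adj_sym[OF z(1)] by blast
qed

lemma finite_separating_halfspaces:
  assumes "u \<in> vertices X" "v \<in> vertices X"
  shows "finite {h \<in> halfspaces X. u \<in> h \<and> v \<notin> h}"
  using assms(2)
proof (induction "cdist u v" arbitrary: v)
  case 0
  then have "u = v" using dist_zero[OF assms(1)] by simp
  then show ?case by simp
next
  case (Suc k)
  have "v \<noteq> u" using dist_self[OF assms(1)] Suc(2) by auto
  then obtain w where w: "adj w v" "cdist u v = Suc (cdist u w)" using closer_neighbour[OF assms(1) Suc(3)] by blast
  have "finite {h \<in> halfspaces X. u \<in> h \<and> w \<notin> h}" using Suc w adj_vertices[OF w(1)] by simp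
  moreover have "{h \<in> halfspaces X. u \<in> h \<and> v \<notin> h} \<subseteq> insert (W w v) {h \<in> halfspaces X. u \<in> h \<and> w \<notin> h}"
    using edge_separates_once[OF w(1)] by blast
  ultimately show ?case using finite_subset by blast
qed

lemma separating_halfspace:
  assumes "u \<in> vertices X" "v \<in> vertices X" "u \<noteq> v"
  shows "\<exists>h\<in>halfspaces X. u \<in> h \<and> v \<notin> h"
proof -
  obtain w where w: "adj w u" "cdist v u = Suc (cdist v w)" using closer_neighbour[OF assms(2,1,3)] by blast
  have "u \<in> W u w" using W_ends(3)[OF w(1)] .
  moreover have "v \<notin> W u w" using w(2) unfolding W_def by simp
  ultimately show ?thesis using halfspaces_iff adj_sym[OF w(1)] by blast
qed

end

section \<open>Cube complexes as halfspace systems\<close>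

context cat0_cubical
begin

lemma cube_finite: assumes "C \<in> X" shows "finite C" "C \<noteq> {}" "C \<subseteq> vertices X"
proof -
  obtain n \<phi> where "cube_chart X C n \<phi>" using chart_exists[OF assms] by auto
  then have "card C = 2 ^ n" by (rule chart_card)
  then have "0 < card C" by simp
  then show "finite C" "C \<noteq> {}" using card_gt_0_iff by blast+
  show "C \<subseteq> vertices X" unfolding vertices_def using assms by blast
qed

lemma vertices_nonempty: "vertices X \<noteq> {}"
proof -
  have "X \<noteq> {}" using CAT0
    unfolding CAT0_cube_complex_def simply_connected_complex_def connected_complex_def by blast
  then show ?thesis using cube_finite by blast
qed

lemma halfspace_system: "halfspace_system (vertices X) (halfspaces X)"
proof
  show "vertices X \<noteq> {}" by (rule vertices_nonempty)
  show "h \<subseteq> vertices X" if "h \<in> halfspaces X" for h using that W_sub unfolding halfspaces_iff by auto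
  show "h \<noteq> {}" if "h \<in> halfspaces X" for h using that W_ends(1) unfolding halfspaces_iff by blast
  show "vertices X - h \<in> halfspaces X" if "h \<in> halfspaces X" for h
  proof -
    obtain a b where ab: "adj a b" "h = W a b" using \<open>h \<in> halfspaces X\<close> unfolding halfspaces_iff by auto
    then have "vertices X - h = W b a" using W_compl[OF ab(1)] by simp
    then show ?thesis unfolding halfspaces_iff using adj_sym[OF ab(1)] by blast
  qed
  show "finite {h \<in> halfspaces X. u \<in> h \<and> v \<notin> h}" if "u \<in> vertices X" "v \<in> vertices X" for u v
    by (rule finite_separating_halfspaces[OF that])
  show "\<exists>h\<in>halfspaces X. u \<in> h \<and> v \<notin> h" if "u \<in> vertices X" "v \<in> vertices X" "u \<noteq> v" for u v
    by (rule separating_halfspace[OF that])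
  fix h x assume h: "h \<in> halfspaces X" "x \<in> h"
  obtain y where y: "adj x y" "W x y \<subseteq> h" using first_edge[OF h] by auto
  have "W x y \<in> halfspaces X" unfolding halfspaces_iff using y(1) by blast
  moreover have "y \<in> vertices X" "x \<in> W x y" "y \<notin> W x y"
    using adj_vertices[OF y(1)] W_ends[OF y(1)] by auto
  ultimately show "\<exists>y\<in>vertices X. \<exists>n\<in>halfspaces X. x \<in> n \<and> y \<notin> n \<and> n \<subseteq> h \<and>
      (\<forall>m\<in>halfspaces X. x \<in> m \<and> y \<notin> m \<longrightarrow> m = n)"
    using y(2) edge_separates_once[OF y(1)] by blast
qed

end

sublocale cat0_cubical \<subseteq> hs: halfspace_system "vertices X" "halfspaces X"
  by (rule halfspace_system)

context cat0_cubical
begin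

lemma pc_iff_edge:
  assumes "k \<in> halfspaces X" shows "x \<in> hs.pc k \<longleftrightarrow> (\<exists>y. adj x y \<and> k = W x y)"
proof
  assume x: "x \<in> hs.pc k"
  then have "x \<in> k" using hs.pc_sub by blast
  then obtain y where y: "adj x y" "W x y \<subseteq> k" using first_edge[OF assms] by auto
  have "W x y \<in> halfspaces X" unfolding halfspaces_iff using y(1) by blast
  then have "W x y = k" using x y(2) W_ends(1)[OF y(1)] unfolding hs.pc_def by blast
  then show "\<exists>y. adj x y \<and> k = W x y" using y(1) by metis
next
  assume "\<exists>y. adj x y \<and> k = W x y"
  then obtain y where y: "adj x y" "k = W x y" by auto
  have "q = k" if "q \<in> halfspaces X" "x \<in> q" "q \<subseteq> k" for q
  proof -
    have "y \<notin> q" using that(3) y(2) W_ends(2)[OF y(1)] by blast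
    then show ?thesis using edge_separates_once[OF y(1) that(1,2)] y(2) by simp
  qed
  then show "x \<in> hs.pc k" unfolding hs.pc_def using y W_ends(1)[OF y(1)] by simp
qed

lemma finite_adjacent:
  assumes "locally_finite_complex X" "x \<in> vertices X" shows "finite (hs.adjacent x)"
proof -
  have "finite {e \<in> edges X. x \<in> e}" using assms unfolding locally_finite_complex_def by simp
  moreover have "finite e" if "e \<in> edges X" for e using that cube_finite(1) unfolding edges_def by simp
  ultimately have "finite (\<Union>{e \<in> edges X. x \<in> e})" by (intro finite_Union) auto
  moreover have "hs.adjacent x \<subseteq> W x ` \<Union>{e \<in> edges X. x \<in> e}"
  proof
    fix k assume "k \<in> hs.adjacent x"
    then have "k \<in> halfspaces X" "x \<in> hs.pc k" unfolding hs.adjacent_def by auto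
    then obtain y where y: "adj x y" "k = W x y" using pc_iff_edge by blast
    then have "y \<in> \<Union>{e \<in> edges X. x \<in> e}" unfolding adj_def by blast
    then show "k \<in> W x ` \<Union>{e \<in> edges X. x \<in> e}" using y(2) by (rule image_eqI[rotated])
  qed
  ultimately show ?thesis using finite_surj by blast
qed

lemma cubical_automorphism_inverse:
  assumes "cubical_automorphism X g" shows "cubical_automorphism X (inv_into (vertices X) g)"
proof -
  let ?f = "inv_into (vertices X) g"
  have b: "bij_betw g (vertices X) (vertices X)" and im: "(`) g ` X = X" using assms unfolding cubical_automorphism_def by auto
  have "?f ` g ` C = C" if "C \<in> X" for C
    using inv_into_image_cancel[of g "vertices X" C] b cube_finite(3)[OF that] unfolding bij_betw_def by simp
  then have "(`) ?f ` ((`) g ` X) = X" unfolding image_image by simp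
  then have "(`) ?f ` X = X" unfolding im .
  then show ?thesis using bij_betw_inv_into[OF b] unfolding cubical_automorphism_def by simp
qed

lemma cubical_automorphism_adj:
  assumes "cubical_automorphism X g" "adj a b" shows "adj (g a) (g b)"
proof -
  have v: "a \<in> vertices X" "b \<in> vertices X" using adj_vertices[OF assms(2)] by auto
  have "inj_on g (vertices X)" using assms(1) unfolding cubical_automorphism_def bij_betw_def by simp
  then have "g a \<noteq> g b" using v adj_neq[OF assms(2)] inj_onD by metis
  moreover have "{a, b} \<in> X" using assms(2) unfolding adj_def edges_def by simp
  then have "g ` {a, b} \<in> X" using assms(1) unfolding cubical_automorphism_def by blast
  ultimately show ?thesis unfolding adj_def edges_def by simp
qed

text \<open>
  Stated as an inequality, so that the equality follows by applying it to the inverse.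
\<close>

lemma cubical_automorphism_dist_le:
  assumes g: "cubical_automorphism X g" and u: "u \<in> vertices X" and "v \<in> vertices X"
  shows "cdist (g u) (g v) \<le> cdist u v"
  using assms(3)
proof (induction "cdist u v" arbitrary: v)
  case 0
  have gu: "g u \<in> vertices X" using g u unfolding cubical_automorphism_def bij_betw_def by blast
  have "u = v" using dist_zero[OF u 0(2)] 0(1) by metis
  then show ?case using dist_self[OF gu] by simp
next
  case (Suc k)
  have gu: "g u \<in> vertices X" using g u unfolding cubical_automorphism_def bij_betw_def by blast
  have "v \<noteq> u" using dist_self[OF u] Suc(2) by auto
  then obtain w where w: "adj w v" "cdist u v = Suc (cdist u w)" using closer_neighbour[OF u Suc(3)] by blast
  have "cdist (g u) (g w) \<le> cdist u w" using Suc w(2) adj_vertices[OF w(1)] by simp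
  then show ?case
    using adj_distances(1)[OF gu cubical_automorphism_adj[OF g w(1)]] w(2) by (elim disjE; linarith)
qed

lemma cubical_automorphism_inv_apply:
  assumes "cubical_automorphism X g" "x \<in> vertices X"
  shows "inv_into (vertices X) g (g x) = x" "g (inv_into (vertices X) g x) = x" "g x \<in> vertices X"
    "inv_into (vertices X) g x \<in> vertices X"
proof -
  have b: "inj_on g (vertices X)" "g ` vertices X = vertices X"
    using assms(1) unfolding cubical_automorphism_def bij_betw_def by auto
  show "inv_into (vertices X) g (g x) = x" using b(1) assms(2) by simp
  show "g (inv_into (vertices X) g x) = x" using b(2) assms(2) by (simp add: f_inv_into_f)
  show "g x \<in> vertices X" using b(2) assms(2) by blast
  show "inv_into (vertices X) g x \<in> vertices X" using b(2) assms(2) inv_into_into[of x g "vertices X"] by simp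
qed

lemma cubical_automorphism_dist:
  assumes g: "cubical_automorphism X g" and v: "u \<in> vertices X" "v \<in> vertices X"
  shows "cdist (g u) (g v) = cdist u v"
  using cubical_automorphism_dist_le[OF g v]
    cubical_automorphism_dist_le[OF cubical_automorphism_inverse[OF g]
      cubical_automorphism_inv_apply(3)[OF g v(1)] cubical_automorphism_inv_apply(3)[OF g v(2)]]
    cubical_automorphism_inv_apply(1)[OF g v(1)] cubical_automorphism_inv_apply(1)[OF g v(2)] by simp

lemma cubical_automorphism_W:
  assumes g: "cubical_automorphism X g" and ab: "adj a b"
  shows "g ` W a b = W (g a) (g b)"
proof (rule set_eqI)
  fix y
  note v = adj_vertices[OF ab]
  have iff: "g x \<in> W (g a) (g b) \<longleftrightarrow> x \<in> W a b" if "x \<in> vertices X" for x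
    using cubical_automorphism_dist[OF g that] cubical_automorphism_inv_apply(3)[OF g that] that v unfolding W_def by simp
  show "y \<in> g ` W a b \<longleftrightarrow> y \<in> W (g a) (g b)"
  proof
    assume "y \<in> g ` W a b"
    then show "y \<in> W (g a) (g b)" using iff W_sub by blast
  next
    assume y: "y \<in> W (g a) (g b)"
    then have yv: "y \<in> vertices X" using W_sub by blast
    have "inv_into (vertices X) g y \<in> W a b"
      using iff[OF cubical_automorphism_inv_apply(4)[OF g yv]] cubical_automorphism_inv_apply(2)[OF g yv] y by simp
    then show "y \<in> g ` W a b" using cubical_automorphism_inv_apply(2)[OF g yv] by (metis imageI)
  qed
qed

lemma halfspace_automorphism:
  assumes g: "cubical_automorphism X g" shows "hs.automorphism g"
proof -
  have sub: "f ` h \<in> halfspaces X" if f: "cubical_automorphism X f" and h: "h \<in> halfspaces X" for f h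
  proof -
    obtain a b where "adj a b" "h = W a b" using h unfolding halfspaces_iff by auto
    then have "adj (f a) (f b)" "f ` h = W (f a) (f b)"
      using cubical_automorphism_adj[OF f] cubical_automorphism_W[OF f] by auto
    then show ?thesis unfolding halfspaces_iff by blast
  qed
  have "h \<in> (`) g ` halfspaces X" if h: "h \<in> halfspaces X" for h
  proof -
    let ?f = "inv_into (vertices X) g"
    have "g ` ?f ` h = h" using cubical_automorphism_inv_apply(2)[OF g] hs.halfspace_sub[OF h]
      unfolding image_image by force
    then show ?thesis using sub[OF cubical_automorphism_inverse[OF g] h] by (metis imageI)
  qed
  then have "(`) g ` halfspaces X = halfspaces X" using sub[OF g] by blast
  then show ?thesis using g unfolding hs.automorphism_def cubical_automorphism_def by simp
qed

lemma cocompact_vertices: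
  assumes "cocompact_complex X"
  shows "\<exists>V0. finite V0 \<and> V0 \<subseteq> vertices X \<and> (\<forall>x\<in>vertices X. \<exists>g. hs.automorphism g \<and> g x \<in> V0)"
proof -
  obtain F where F: "finite F" "F \<subseteq> X" "\<And>C. C \<in> X \<Longrightarrow> \<exists>D\<in>F. \<exists>g. cubical_automorphism X g \<and> C = g ` D"
    using assms unfolding cocompact_complex_def by metis
  have fin: "finite (\<Union>F)" using F(1,2) cube_finite(1) by (intro finite_Union) auto
  have sub: "\<Union>F \<subseteq> vertices X" using F(2) cube_finite(3) by blast
  have tr: "\<exists>g. hs.automorphism g \<and> g x \<in> \<Union>F" if x: "x \<in> vertices X" for x
  proof -
    obtain D g where D: "D \<in> F" "cubical_automorphism X g" "{x} = g ` D" using F(3)[OF singleton_cube[OF x]] by auto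
    then obtain y where y: "y \<in> D" "g y = x" by blast
    have "y \<in> vertices X" using D(1) F(2) y(1) cube_finite(3) by blast
    then have "inv_into (vertices X) g x = y" using cubical_automorphism_inv_apply(1)[OF D(2)] y(2) by blast
    then show ?thesis
      using halfspace_automorphism[OF cubical_automorphism_inverse[OF D(2)]] D(1) y(1) by blast
  qed
  show ?thesis by (intro exI[of _ "\<Union>F"] conjI ballI fin sub tr)
qed

lemma essential_proper_halfspace:
  assumes "essential X" "h \<in> halfspaces X" shows "\<exists>k\<in>halfspaces X. k \<subset> h"
proof -
  obtain a b where ab: "adj a b" "h = W a b" using assms(2) unfolding halfspaces_iff by auto
  obtain v where v: "v \<in> h" "\<And>e u. e \<in> bounding_hyperplane X h \<Longrightarrow> u \<in> e \<Longrightarrow> 1 \<le> cdist v u"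
    using assms(1)[unfolded essential_def, rule_format, OF assms(2), of 1] by blast
  obtain y where y: "adj v y" "W v y \<subseteq> h" using first_edge[OF assms(2) v(1)] by auto
  have "W v y \<noteq> h"
  proof
    assume "W v y = h"
    then have "bounding_hyperplane X h = Collect (par {v, y})" using bounding_hyperplane_W[OF y(1)] by simp
    then have "1 \<le> cdist v v" using v(2)[of "{v, y}" v] by simp
    then show False using dist_self[of v] adj_vertices[OF y(1)] by simp
  qed
  then show ?thesis using y halfspaces_iff by blast
qed

text \<open>
  All edges of a cube in direction \<open>i\<close> are parallel. Two vertices of the cube with the same \<open>i\<close>-th
  coordinate differ in a set \<open>S\<close> of other coordinates, which are switched one after another.
\<close>

lemma cube_parallel_edges:
  assumes ch: "cube_chart X D n \<phi>" and i: "i < n" and A: "A \<subseteq> {..<n}" and S: "finite S" "S \<subseteq> {..<n} - {i}"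
  shows "W (inv_into D \<phi> (sym_diff A S)) (inv_into D \<phi> (switch (sym_diff A S) i)) =
    W (inv_into D \<phi> A) (inv_into D \<phi> (switch A i))"
  using S
proof (induction S rule: finite_induct)
  case (insert j S)
  let ?B = "sym_diff A S"
  have B: "?B \<subseteq> {..<n}" using A insert.prems by auto
  have j: "j < n" "i \<noteq> j" using insert.prems by auto
  have e: "sym_diff A (insert j S) = switch ?B j" using insert.hyps(2) unfolding switch_def by auto
  have "W (inv_into D \<phi> ?B) (inv_into D \<phi> (switch ?B i)) =
      W (inv_into D \<phi> (switch ?B j)) (inv_into D \<phi> (switch (switch ?B i) j))"
    by (rule W_square[OF chart_square[OF ch B i j]])
  then show ?case unfolding e switch_switch[of ?B i j] using insert by simp
qed simp

lemma cube_edge_at_vertex: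
  assumes D: "D \<in> X" and pq: "p \<in> D" "q \<in> D" "adj p q" and v: "v \<in> D" "v \<in> W p q"
  shows "\<exists>y. adj v y \<and> W v y = W p q"
proof -
  obtain n \<phi> where ch: "cube_chart X D n \<phi>" using chart_exists[OF D] by auto
  obtain i where i: "i < n" "\<phi> q = switch (\<phi> p) i" using chart_adj[OF ch pq] .
  note sub = chart_mem(1)[OF ch pq(1)] chart_mem(1)[OF ch pq(2)] chart_mem(1)[OF ch v(1)]
  let ?y = "inv_into D \<phi> (switch (\<phi> v) i)"
  have vy: "adj v ?y" using chart_edge[OF ch sub(3) i(1)] chart_mem(2)[OF ch v(1)] by simp
  have W: "W v ?y = W (inv_into D \<phi> A) (inv_into D \<phi> (switch A i))"
    if A: "A \<subseteq> {..<n}" "i \<in> A \<longleftrightarrow> i \<in> \<phi> v" for A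
  proof -
    have S: "finite (sym_diff A (\<phi> v))" "sym_diff A (\<phi> v) \<subseteq> {..<n} - {i}"
      using A sub(3) finite_subset[of _ "{..<n}"] by auto
    have "sym_diff A (sym_diff A (\<phi> v)) = \<phi> v" by auto
    then show ?thesis using cube_parallel_edges[OF ch i(1) A(1) S] chart_mem(2)[OF ch v(1)] by simp
  qed
  note back_p = chart_mem(2)[OF ch pq(1)] and back_q = chart_mem(2)[OF ch pq(2)]
  show ?thesis
  proof (cases "i \<in> \<phi> p \<longleftrightarrow> i \<in> \<phi> v")
    case True
    then show ?thesis using W[OF sub(1)] vy back_p back_q i(2) by metis
  next
    case False
    then have "i \<in> \<phi> q \<longleftrightarrow> i \<in> \<phi> v" using i(2) by (auto simp: mem_switch)
    moreover have "switch (\<phi> q) i = \<phi> p" using i(2) by simp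
    ultimately have "W v ?y = W q p" using W[OF sub(2)] back_p back_q by simp
    then have "v \<in> W q p" using W_ends(1)[OF vy] by simp
    then show ?thesis using v(2) W_compl[OF pq(3)] by blast
  qed
qed

text \<open>
  A cube in the positive carriers of all members may be replaced by any of its vertices \<open>v\<close>: if it
  lies in a cube with an edge dual to the hyperplane of \<open>k\<close>, then this cube contains a dual edge
  at \<open>v\<close>.
\<close>

lemma cage_iff_corner:
  assumes "\<alpha> \<in> ultrafilters X"
  shows "cage X \<alpha> K \<longleftrightarrow> K \<subseteq> \<alpha> \<and> hs.corner K \<noteq> {}"
proof -
  have "\<alpha> \<subseteq> halfspaces X" using assms unfolding ultrafilters_def by simp
  then have KHS: "k \<in> halfspaces X" if "K \<subseteq> \<alpha>" "k \<in> K" for k using that by blast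
  have A: "v \<in> hs.pc k" if k: "k \<in> halfspaces X" and C: "C \<in> positive_carrier X k" and v: "v \<in> C" for k C v
  proof -
    obtain a b where ab: "adj a b" "k = W a b" using k unfolding halfspaces_iff by auto
    have bh: "bounding_hyperplane X k = Collect (par {a, b})" using bounding_hyperplane_W[OF ab(1)] ab(2) by simp
    obtain D e where D: "D \<in> X" "C \<subseteq> D" "par {a, b} e" "e \<subseteq> D" "C \<subseteq> k"
      using C unfolding positive_carrier_def carrier_cubes_def bh by auto
    obtain p q where pq: "e = {p, q}" "adj p q" "p \<in> W a b" "q \<notin> W a b"
      using D(3) unfolding par_iff_crosses[OF ab(1)] by blast
    have "W a b = W p q" by (rule crossing_edge_W[OF ab(1) pq(2-4)])
    then have mem: "p \<in> D" "q \<in> D" "v \<in> D" "v \<in> W p q" "k = W p q" using D(2,4,5) v pq(1) ab(2) by auto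
    obtain y where "adj v y" "W v y = W p q" using cube_edge_at_vertex[OF D(1) mem(1,2) pq(2) mem(3,4)] by blast
    then have "\<exists>y. adj v y \<and> k = W v y" using mem(5) by metis
    then show ?thesis by (rule pc_iff_edge[OF k, THEN iffD2])
  qed
  have B: "{v} \<in> positive_carrier X k" if k: "k \<in> halfspaces X" and v: "v \<in> hs.pc k" for k v
  proof -
    obtain y where y: "adj v y" "k = W v y" using pc_iff_edge[OF k] v by auto
    have "v \<in> vertices X" using adj_vertices[OF y(1)] by simp
    then have c: "{v} \<in> X" by (rule singleton_cube)
    have e: "{v, y} \<in> X" "{v} \<subseteq> {v, y}" using y(1) unfolding adj_def edges_def by simp_all
    have h: "{v, y} \<in> bounding_hyperplane X k" using bounding_hyperplane_W[OF y(1)] y(2) by simp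
    have "{v} \<subseteq> k" using W_ends(1)[OF y(1)] y(2) by simp
    moreover have "{v} \<in> carrier_cubes X (bounding_hyperplane X k)"
      unfolding carrier_cubes_def mem_Collect_eq
      by (intro conjI c bexI[of _ "{v, y}"] e bexI[OF _ h] order_refl)
    ultimately show ?thesis unfolding positive_carrier_def by simp
  qed
  show ?thesis
  proof (cases "K \<subseteq> \<alpha>")
    case True
    have "(\<exists>C\<in>X. \<forall>k\<in>K. C \<in> positive_carrier X k) \<longleftrightarrow> (\<exists>v. v \<in> hs.corner K)"
    proof
      assume "\<exists>C\<in>X. \<forall>k\<in>K. C \<in> positive_carrier X k"
      then obtain C where C: "C \<in> X" "\<And>k. k \<in> K \<Longrightarrow> C \<in> positive_carrier X k" by auto
      obtain v where v: "v \<in> C" using cube_finite(2)[OF C(1)] by auto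
      have "v \<in> vertices X" using v cube_finite(3)[OF C(1)] by auto
      then have "v \<in> hs.corner K" unfolding hs.corner_def using A[OF KHS[OF True] C(2) v] by simp
      then show "\<exists>v. v \<in> hs.corner K" by blast
    next
      assume "\<exists>v. v \<in> hs.corner K"
      then obtain v where v: "v \<in> vertices X" "\<And>k. k \<in> K \<Longrightarrow> v \<in> hs.pc k" unfolding hs.corner_def by auto
      then show "\<exists>C\<in>X. \<forall>k\<in>K. C \<in> positive_carrier X k"
        using B[OF KHS[OF True]] singleton_cube[OF v(1)] by (intro bexI[of _ "{v}"]) auto
    qed
    then show ?thesis unfolding cage_def by blast
  next
    case False
    then show ?thesis unfolding cage_def by simp
  qed
qed

text \<open>
  A geodesic between two vertices of \<open>W c d\<close> stays there by convexity, and it crosses from \<open>W a b\<close>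
  to its complement.
\<close>

lemma crossing_edge_in_halfspace:
  assumes "adj a b" "adj c d" "x \<in> W c d" "x \<in> W a b"
  shows "y \<in> W c d \<Longrightarrow> y \<notin> W a b \<Longrightarrow> \<exists>p q. adj p q \<and> p \<in> W a b \<and> q \<notin> W a b \<and> p \<in> W c d \<and> q \<in> W c d"
proof (induction "cdist x y" arbitrary: y)
  case 0
  then have "x = y" using dist_zero[of x y] assms(3) W_sub by auto
  then show ?case using assms(4) 0 by blast
next
  case (Suc k)
  have v: "x \<in> vertices X" "y \<in> vertices X" using assms(3) Suc(3) W_sub by auto
  have "y \<noteq> x" using assms(4) Suc(4) by blast
  then obtain z where z: "adj z y" "cdist x y = Suc (cdist x z)" using closer_neighbour[OF v] by blast
  have zm: "z \<in> W c d" by (rule convex[OF assms(2,3) Suc(3) z])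
  show ?case
  proof (cases "z \<in> W a b")
    case True
    then show ?thesis using z(1) zm Suc(3,4) by blast
  next
    case False
    have "k = cdist x z" using Suc(2) z(2) by simp
    then show ?thesis using Suc(1) zm False by blast
  qed
qed

text \<open>
  If neither side of the hyperplane were contained in \<open>k\<close>, both would meet the complement of \<open>k\<close>,
  which would therefore contain one of the dual edges.
\<close>

lemma hyperplane_inside_iff:
  assumes ab: "adj a b" and k: "k \<in> halfspaces X"
  shows "(\<forall>e. par {a, b} e \<longrightarrow> e \<subseteq> k) \<longleftrightarrow> W a b \<subset> k \<or> vertices X - W a b \<subset> k"
proof
  assume H: "\<forall>e. par {a, b} e \<longrightarrow> e \<subseteq> k"
  obtain c d where cd: "adj c d" "k = W c d" using k unfolding halfspaces_iff by auto
  note dc = adj_sym[OF cd(1)]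
  have "a \<in> k" "b \<in> k" using H[rule_format, of "{a, b}"] by auto
  then have "k \<noteq> W a b" "k \<noteq> W b a" using W_ends[OF ab] by auto
  moreover have "W a b \<subseteq> k \<or> W b a \<subseteq> k"
  proof (rule ccontr)
    assume "\<not> ?thesis"
    then obtain x y where x: "x \<in> W a b" "x \<notin> k" and y: "y \<in> W b a" "y \<notin> k" by blast
    then have "x \<in> W d c" "y \<in> W d c" "y \<notin> W a b" using W_sub W_compl[OF cd(1)] W_compl[OF ab] cd(2) by blast+
    then obtain p q where pq: "adj p q" "p \<in> W a b" "q \<notin> W a b" "p \<in> W d c"
      using crossing_edge_in_halfspace[OF ab dc _ x(1)] by blast
    then have "p \<in> k" using H[rule_format, OF crossing_edge_par[OF ab pq(1-3)]] by blast
    then show False using pq(4) W_compl[OF cd(1)] cd(2) by blast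
  qed
  ultimately show "W a b \<subset> k \<or> vertices X - W a b \<subset> k" using W_compl[OF ab] by blast
next
  have one: "e \<subseteq> k" if uv: "adj u v" and sub: "W u v \<subset> k" and e: "par {u, v} e" for u v e
  proof -
    obtain p q where pq: "e = {p, q}" "adj p q" "p \<in> W u v" "q \<notin> W u v"
      using e unfolding par_iff_crosses[OF uv] by blast
    have "q \<in> k"
    proof (rule ccontr)
      assume "q \<notin> k"
      then have "k = W p q" using edge_separates_once[OF pq(2) k] pq(3) sub by blast
      moreover have "W u v = W p q" by (rule crossing_edge_W[OF uv pq(2-4)])
      ultimately show False using sub by simp
    qed
    then show ?thesis using pq sub by blast
  qed
  assume "W a b \<subset> k \<or> vertices X - W a b \<subset> k"
  then show "\<forall>e. par {a, b} e \<longrightarrow> e \<subseteq> k"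
  proof
    assume "W a b \<subset> k"
    then show ?thesis using one[OF ab] by blast
  next
    assume "vertices X - W a b \<subset> k"
    then have "W b a \<subset> k" using W_compl[OF ab] by simp
    then have "par {b, a} e \<longrightarrow> e \<subseteq> k" for e using one[OF adj_sym[OF ab]] by blast
    then show ?thesis unfolding insert_commute[of b a] by blast
  qed
qed

text \<open>
  The hyperplane bounding \<open>k\<close> has a dual edge with an end outside \<open>k\<close>, so the second condition of
  \<open>hyperplane_in_halfspace\<close> implies the first.
\<close>

lemma hyperplane_in_halfspace_iff:
  assumes k: "k \<in> halfspaces X"
  shows "hyperplane_in_halfspace X (Collect (par {a, b})) k \<longleftrightarrow> (\<forall>e. par {a, b} e \<longrightarrow> e \<subseteq> k)"
proof -
  have "Collect (par {a, b}) \<noteq> bounding_hyperplane X k" if sub: "\<forall>e. par {a, b} e \<longrightarrow> e \<subseteq> k"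
  proof
    obtain c d where cd: "adj c d" "k = W c d" using k unfolding halfspaces_iff by auto
    assume "Collect (par {a, b}) = bounding_hyperplane X k"
    then have "Collect (par {a, b}) = Collect (par {c, d})" using bounding_hyperplane_W[OF cd(1)] cd(2) by simp
    then have "par {a, b} {c, d}" by (metis equivclp_refl mem_Collect_eq)
    then have "d \<in> k" using sub by blast
    then show False using W_ends(2)[OF cd(1)] cd(2) by simp
  qed
  then show ?thesis unfolding hyperplane_in_halfspace_def by blast
qed

end

section \<open>The topology of the space of ultrafilters\<close>

context cat0_cubical
begin

lemma ultrafilters_eq: "ultrafilters X = hs.UF"
  unfolding ultrafilters_def hs.UF_def opp_def ..

lemma Roller_boundary_eq: "Roller_boundary X = hs.boundary"
  unfolding Roller_boundary_def hs.boundary_def ultrafilters_eq ..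

lemma vertex_ultrafilter_eq: "vertex_ultrafilter X v = hs.vertex_uf v"
  unfolding vertex_ultrafilter_def hs.vertex_uf_def ..

lemma vertex_uf_ultrafilter:
  assumes "v \<in> vertices X" shows "hs.vertex_uf v \<in> ultrafilters X"
  unfolding ultrafilters_def hs.vertex_uf_def opp_def
  using assms hs.compl_halfspace by auto

text \<open>
  The sets \<open>basic_open X M\<close> form a basis because \<open>basic_open X (M \<union> N)\<close> is the intersection of
  \<open>basic_open X M\<close> and \<open>basic_open X N\<close>.
\<close>

lemma openin_iff:
  "openin (ultrafilter_topology X) U \<longleftrightarrow>
    U \<subseteq> ultrafilters X \<and> (\<forall>\<alpha>\<in>U. \<exists>M. finite M \<and> M \<subseteq> \<alpha> \<and> basic_open X M \<subseteq> U)" (is "_ \<longleftrightarrow> ?R U")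
proof
  let ?B = "{basic_open X H | H. finite H \<and> H \<subseteq> halfspaces X}"
  assume "openin (ultrafilter_topology X) U"
  then have "generate_topology_on ?B U"
    unfolding ultrafilter_topology_def openin_topology_generated_by_iff .
  then show "?R U"
  proof (induction rule: generate_topology_on.induct)
    case (Int U U')
    show ?case
    proof (intro conjI ballI)
      show "U \<inter> U' \<subseteq> ultrafilters X" using Int.IH by blast
      fix \<alpha> assume "\<alpha> \<in> U \<inter> U'"
      then obtain M M' where "finite M" "M \<subseteq> \<alpha>" "basic_open X M \<subseteq> U"
        and "finite M'" "M' \<subseteq> \<alpha>" "basic_open X M' \<subseteq> U'" using Int.IH by (meson IntD1 IntD2)
      then show "\<exists>M. finite M \<and> M \<subseteq> \<alpha> \<and> basic_open X M \<subseteq> U \<inter> U'"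
        by (intro exI[of _ "M \<union> M'"]) (auto simp: basic_open_def)
    qed
  next
    case (UN K)
    show ?case
    proof (intro conjI ballI)
      show "\<Union>K \<subseteq> ultrafilters X" using UN.IH by blast
      fix \<alpha> assume "\<alpha> \<in> \<Union>K"
      then obtain k where "k \<in> K" "\<alpha> \<in> k" by blast
      then show "\<exists>M. finite M \<and> M \<subseteq> \<alpha> \<and> basic_open X M \<subseteq> \<Union>K" using UN.IH by (meson Union_upper order_trans)
    qed
  next
    case (Basis s)
    then obtain H where H: "s = basic_open X H" "finite H" by auto
    have "\<And>\<alpha>. \<alpha> \<in> s \<Longrightarrow> H \<subseteq> \<alpha>" "s \<subseteq> ultrafilters X" unfolding H(1) basic_open_def by auto
    then show ?case using H by blast
  qed simp
next
  assume R: "?R U"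
  show "openin (ultrafilter_topology X) U"
  proof (subst openin_subopen, intro ballI)
    fix \<alpha> assume \<alpha>: "\<alpha> \<in> U"
    then obtain M where M: "finite M" "M \<subseteq> \<alpha>" "basic_open X M \<subseteq> U" using R by blast
    have uf: "\<alpha> \<in> ultrafilters X" using R \<alpha> by blast
    then have "\<alpha> \<subseteq> halfspaces X" unfolding ultrafilters_def by simp
    then have "openin (ultrafilter_topology X) (basic_open X M)"
      unfolding ultrafilter_topology_def using M(1,2) by (intro topology_generated_by_Basis) auto
    moreover have "\<alpha> \<in> basic_open X M" unfolding basic_open_def using uf M(2) by simp
    ultimately show "\<exists>T. openin (ultrafilter_topology X) T \<and> \<alpha> \<in> T \<and> T \<subseteq> U" using M(3) by blast
  qed
qed

lemma open_neighbourhood: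
  assumes "openin (ultrafilter_topology X) U" "\<alpha> \<in> U"
  shows "\<exists>M. finite M \<and> M \<subseteq> \<alpha> \<and> basic_open X M \<subseteq> U"
  using assms(1)[unfolded openin_iff, THEN conjunct2] assms(2) by (rule bspec)

lemma openin_basic_open: "finite M \<Longrightarrow> openin (ultrafilter_topology X) (basic_open X M)"
  unfolding openin_iff basic_open_def by auto

lemma topspace_ultrafilters: "topspace (ultrafilter_topology X) = ultrafilters X"
proof (rule antisym)
  show "topspace (ultrafilter_topology X) \<subseteq> ultrafilters X"
    using openin_topspace[of "ultrafilter_topology X"] unfolding openin_iff by (rule conjunct1)
  have "openin (ultrafilter_topology X) (ultrafilters X)"
    unfolding openin_iff basic_open_def by (intro conjI ballI exI[of _ "{}"]) auto
  then show "ultrafilters X \<subseteq> topspace (ultrafilter_topology X)" by (rule openin_subset)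
qed

lemma B_boundary_iff:
  "\<alpha> \<in> B_boundary X \<longleftrightarrow> \<alpha> \<in> ultrafilters X \<and>
    (\<forall>M. finite M \<and> M \<subseteq> \<alpha> \<longrightarrow> (\<exists>\<gamma>\<in>Roller_boundary X. non_terminating \<gamma> \<and> M \<subseteq> \<gamma>))"
proof -
  let ?T = "ultrafilter_topology X"
  have A: "\<exists>\<gamma>\<in>Roller_boundary X. non_terminating \<gamma> \<and> M \<subseteq> \<gamma>"
    if uf: "\<alpha> \<in> ultrafilters X" and M: "finite M" "M \<subseteq> \<alpha>"
      and H: "\<forall>U. \<alpha> \<in> U \<and> openin ?T U \<longrightarrow> (\<exists>\<gamma>\<in>Roller_boundary X. non_terminating \<gamma> \<and> \<gamma> \<in> U)" for M
  proof -
    have "\<alpha> \<in> basic_open X M" unfolding basic_open_def using uf M(2) by simp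
    then have "\<exists>\<gamma>\<in>Roller_boundary X. non_terminating \<gamma> \<and> \<gamma> \<in> basic_open X M"
      using H openin_basic_open[OF M(1)] by simp
    then show ?thesis unfolding basic_open_def by blast
  qed
  have B: "\<exists>\<gamma>\<in>Roller_boundary X. non_terminating \<gamma> \<and> \<gamma> \<in> U"
    if U: "\<alpha> \<in> U" "openin ?T U"
      and H: "\<forall>M. finite M \<and> M \<subseteq> \<alpha> \<longrightarrow> (\<exists>\<gamma>\<in>Roller_boundary X. non_terminating \<gamma> \<and> M \<subseteq> \<gamma>)" for U
  proof -
    obtain M where M: "finite M" "M \<subseteq> \<alpha>" "basic_open X M \<subseteq> U" using open_neighbourhood[OF U(2,1)] by blast
    obtain \<gamma> where \<gamma>: "\<gamma> \<in> Roller_boundary X" "non_terminating \<gamma>" "M \<subseteq> \<gamma>"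
      using H[rule_format, OF conjI[OF M(1,2)]] by blast
    then have "\<gamma> \<in> basic_open X M" unfolding basic_open_def Roller_boundary_def by simp
    then show ?thesis using \<gamma> M(3) by blast
  qed
  have "\<alpha> \<in> B_boundary X \<longleftrightarrow> \<alpha> \<in> ultrafilters X \<and>
      (\<forall>U. \<alpha> \<in> U \<and> openin ?T U \<longrightarrow> (\<exists>\<gamma>\<in>Roller_boundary X. non_terminating \<gamma> \<and> \<gamma> \<in> U))"
    unfolding B_boundary_def in_closure_of topspace_ultrafilters by blast
  also have "\<dots> \<longleftrightarrow> \<alpha> \<in> ultrafilters X \<and>
      (\<forall>M. finite M \<and> M \<subseteq> \<alpha> \<longrightarrow> (\<exists>\<gamma>\<in>Roller_boundary X. non_terminating \<gamma> \<and> M \<subseteq> \<gamma>))"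
  proof (intro conj_cong refl iffI allI impI; elim conjE)
    fix M
    assume "\<alpha> \<in> ultrafilters X" "finite M" "M \<subseteq> \<alpha>"
      "\<forall>U. \<alpha> \<in> U \<and> openin ?T U \<longrightarrow> (\<exists>\<gamma>\<in>Roller_boundary X. non_terminating \<gamma> \<and> \<gamma> \<in> U)"
    then show "\<exists>\<gamma>\<in>Roller_boundary X. non_terminating \<gamma> \<and> M \<subseteq> \<gamma>" by (rule A)
  next
    fix U
    assume "\<alpha> \<in> U" "openin ?T U"
      "\<forall>M. finite M \<and> M \<subseteq> \<alpha> \<longrightarrow> (\<exists>\<gamma>\<in>Roller_boundary X. non_terminating \<gamma> \<and> M \<subseteq> \<gamma>)"
    then show "\<exists>\<gamma>\<in>Roller_boundary X. non_terminating \<gamma> \<and> \<gamma> \<in> U" by (rule B)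
  qed
  finally show ?thesis .
qed

lemma hyperplane_in_all_iff:
  assumes "M \<subseteq> halfspaces X" "adj a b"
  shows "(\<forall>k\<in>M. hyperplane_in_halfspace X (Collect (par {a, b})) k) \<longleftrightarrow> hs.hyperplane_inside (W a b) M"
  unfolding hs.hyperplane_inside_def
  using hyperplane_in_halfspace_iff hyperplane_inside_iff[OF assms(2)] assms(1) by (meson subsetD)

lemma caged_hyperplanes_iff: "caged_hyperplanes X \<longleftrightarrow> hs.cages_filled"
proof -
  have "(\<exists>H\<in>hyperplanes X. \<forall>k\<in>K. hyperplane_in_halfspace X H k) \<longleftrightarrow>
      (\<exists>q\<in>halfspaces X. hs.hyperplane_inside q K)" if K: "K \<subseteq> halfspaces X" for K
  proof
    assume "\<exists>H\<in>hyperplanes X. \<forall>k\<in>K. hyperplane_in_halfspace X H k"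
    then obtain a b where "adj a b" "\<forall>k\<in>K. hyperplane_in_halfspace X (Collect (par {a, b})) k"
      unfolding hyperplanes_iff Bex_def by blast
    then show "\<exists>q\<in>halfspaces X. hs.hyperplane_inside q K"
      using hyperplane_in_all_iff[OF K] halfspaces_iff by blast
  next
    assume "\<exists>q\<in>halfspaces X. hs.hyperplane_inside q K"
    then obtain a b where "adj a b" "hs.hyperplane_inside (W a b) K" unfolding halfspaces_iff Bex_def by blast
    then show "\<exists>H\<in>hyperplanes X. \<forall>k\<in>K. hyperplane_in_halfspace X H k"
      using hyperplane_in_all_iff[OF K] hyperplanes_iff by blast
  qed
  moreover have "K \<subseteq> halfspaces X" if "\<alpha> \<in> hs.boundary" "K \<subseteq> \<alpha>" for \<alpha> K
    using hs.uf_sub[OF hs.boundary_uf[OF that(1)]] that(2) by blast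
  moreover have "cage X \<alpha> K \<longleftrightarrow> K \<subseteq> \<alpha> \<and> hs.corner K \<noteq> {}" if "\<alpha> \<in> hs.boundary" for \<alpha> K
    using cage_iff_corner hs.boundary_uf[OF that] unfolding ultrafilters_eq by blast
  ultimately show ?thesis
    unfolding caged_hyperplanes_def hs.cages_filled_def Roller_boundary_eq by (smt (verit, best))
qed

lemma contains_hyperplane_basic_open:
  assumes "M \<subseteq> halfspaces X" "adj a b"
  shows "contains_hyperplane X (basic_open X M) (Collect (par {a, b})) \<longleftrightarrow> hs.hyperplane_inside (W a b) M"
proof -
  have "hs.vertex_uf v \<in> basic_open X M \<longleftrightarrow> (\<forall>m\<in>M. v \<in> m)" if "v \<in> vertices X" for v
    using vertex_uf_ultrafilter[OF that] assms(1) unfolding basic_open_def hs.vertex_uf_def by auto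
  moreover have "v \<in> vertices X" if "par {a, b} e" "v \<in> e" for e v
    using that adj_vertices unfolding par_iff_crosses[OF assms(2)] by blast
  ultimately have "contains_hyperplane X (basic_open X M) (Collect (par {a, b})) \<longleftrightarrow>
      (\<forall>m\<in>M. \<forall>e. par {a, b} e \<longrightarrow> e \<subseteq> m)"
    unfolding contains_hyperplane_def vertex_ultrafilter_eq by blast
  also have "\<dots> \<longleftrightarrow> hs.hyperplane_inside (W a b) M"
    unfolding hs.hyperplane_inside_def using hyperplane_inside_iff[OF assms(2)] assms(1) by (meson subsetD)
  finally show ?thesis .
qed

lemma open_sets_contain_hyperplane_iff:
  "(\<forall>U. openin (ultrafilter_topology X) U \<and> U \<inter> Roller_boundary X \<noteq> {} \<longrightarrow>
      (\<exists>H\<in>hyperplanes X. contains_hyperplane X U H)) \<longleftrightarrow> hs.neighbourhoods_filled"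
proof
  assume L: "\<forall>U. openin (ultrafilter_topology X) U \<and> U \<inter> Roller_boundary X \<noteq> {} \<longrightarrow>
      (\<exists>H\<in>hyperplanes X. contains_hyperplane X U H)"
  show "hs.neighbourhoods_filled" unfolding hs.neighbourhoods_filled_def
  proof (intro ballI allI impI)
    fix \<alpha> M assume \<alpha>: "\<alpha> \<in> hs.boundary" and M: "finite M \<and> M \<subseteq> \<alpha>"
    have uf: "\<alpha> \<in> ultrafilters X" using hs.boundary_uf[OF \<alpha>] unfolding ultrafilters_eq .
    have MHS: "M \<subseteq> halfspaces X" using hs.uf_sub[OF hs.boundary_uf[OF \<alpha>]] M by blast
    have "\<alpha> \<in> basic_open X M \<inter> Roller_boundary X"
      unfolding basic_open_def Roller_boundary_eq using uf M \<alpha> by simp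
    then have "basic_open X M \<inter> Roller_boundary X \<noteq> {}" by (metis empty_iff)
    then obtain H where H: "H \<in> hyperplanes X" "contains_hyperplane X (basic_open X M) H"
      using L[rule_format, OF conjI[OF openin_basic_open]] M by blast
    obtain a b where ab: "adj a b" "H = Collect (par {a, b})" using H(1) unfolding hyperplanes_iff by blast
    then have "hs.hyperplane_inside (W a b) M" using H(2) contains_hyperplane_basic_open[OF MHS ab(1)] by simp
    then show "\<exists>q\<in>halfspaces X. hs.hyperplane_inside q M" using ab(1) halfspaces_iff by blast
  qed
next
  assume R: "hs.neighbourhoods_filled"
  show "\<forall>U. openin (ultrafilter_topology X) U \<and> U \<inter> Roller_boundary X \<noteq> {} \<longrightarrow>
      (\<exists>H\<in>hyperplanes X. contains_hyperplane X U H)"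
  proof (intro allI impI, elim conjE)
    fix U assume U: "openin (ultrafilter_topology X) U" "U \<inter> Roller_boundary X \<noteq> {}"
    then obtain \<alpha> where \<alpha>: "\<alpha> \<in> U" "\<alpha> \<in> hs.boundary" unfolding Roller_boundary_eq by blast
    obtain M where M: "finite M" "M \<subseteq> \<alpha>" "basic_open X M \<subseteq> U" using open_neighbourhood[OF U(1) \<alpha>(1)] by blast
    have MHS: "M \<subseteq> halfspaces X" using hs.uf_sub[OF hs.boundary_uf[OF \<alpha>(2)]] M(2) by blast
    obtain q where q: "q \<in> halfspaces X" "hs.hyperplane_inside q M"
      using R[unfolded hs.neighbourhoods_filled_def, rule_format, OF \<alpha>(2) conjI[OF M(1,2)]] by blast
    obtain a b where ab: "adj a b" "q = W a b" using q(1) unfolding halfspaces_iff by blast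
    have "contains_hyperplane X (basic_open X M) (Collect (par {a, b}))"
      using contains_hyperplane_basic_open[OF MHS ab(1)] q(2) ab(2) by simp
    then have "contains_hyperplane X U (Collect (par {a, b}))"
      using M(3) unfolding contains_hyperplane_def by blast
    then show "\<exists>H\<in>hyperplanes X. contains_hyperplane X U H" using ab(1) hyperplanes_iff by blast
  qed
qed

end

theorem theorem1:
  fixes X :: "'v set set"
  assumes "CAT0_cube_complex X"
    and "essential X"
    and "locally_finite_complex X"
    and "cocompact_complex X"
  shows "(Roller_boundary X = B_boundary X \<longleftrightarrow> caged_hyperplanes X) \<and>
         (caged_hyperplanes X \<longleftrightarrow>
            (\<forall>U. openin (ultrafilter_topology X) U \<and> U \<inter> Roller_boundary X \<noteq> {} \<longrightarrow>
               (\<exists>H\<in>hyperplanes X. contains_hyperplane X U H)))"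
proof -
  interpret cat0_cubical X by standard (rule assms(1))
  interpret E: essential_halfspace_system "vertices X" "halfspaces X"
    by standard
      (rule finite_adjacent[OF assms(3)] cocompact_vertices[OF assms(4)] essential_proper_halfspace[OF assms(2)];
        assumption?)+
  have "Roller_boundary X = B_boundary X \<longleftrightarrow> hs.nonterminating_dense"
  proof
    assume eq: "Roller_boundary X = B_boundary X"
    show "hs.nonterminating_dense" unfolding hs.nonterminating_dense_def
    proof (intro ballI allI impI)
      fix \<beta> M assume \<beta>: "\<beta> \<in> hs.boundary" and M: "finite M \<and> M \<subseteq> \<beta>"
      have "\<beta> \<in> B_boundary X" using \<beta> eq unfolding Roller_boundary_eq by simp
      then show "\<exists>\<gamma>\<in>hs.UF. non_terminating \<gamma> \<and> M \<subseteq> \<gamma>"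
        using M hs.boundary_uf unfolding B_boundary_iff Roller_boundary_eq by blast
    qed
  next
    assume dense: "hs.nonterminating_dense"
    show "Roller_boundary X = B_boundary X"
    proof (intro equalityI subsetI)
      fix \<beta> assume "\<beta> \<in> Roller_boundary X"
      then have \<beta>: "\<beta> \<in> hs.boundary" unfolding Roller_boundary_eq .
      obtain s :: "nat \<Rightarrow> 'v set" where "\<And>n. s n \<in> \<beta>" using hs.boundary_chain[OF \<beta>] by metis
      then have h: "s 0 \<in> halfspaces X" using hs.uf_sub[OF hs.boundary_uf[OF \<beta>]] by blast
      have "\<exists>\<gamma>\<in>hs.boundary. non_terminating \<gamma> \<and> M \<subseteq> \<gamma>" if M: "finite M" "M \<subseteq> \<beta>" for M
      proof -
        obtain \<gamma> where \<gamma>: "\<gamma> \<in> hs.UF" "non_terminating \<gamma>" "M \<subseteq> \<gamma>"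
          using dense[unfolded hs.nonterminating_dense_def, rule_format, OF \<beta> conjI[OF M]] by blast
        \<comment> \<open>the empty family would be non-terminating vacuously\<close>
        have "\<gamma> \<noteq> {}" using \<gamma>(1) h unfolding hs.UF_def by blast
        then show ?thesis using hs.nonterminating_boundary[OF \<gamma>(1,2)] \<gamma>(2,3) by blast
      qed
      then show "\<beta> \<in> B_boundary X"
        unfolding B_boundary_iff Roller_boundary_eq ultrafilters_eq using hs.boundary_uf[OF \<beta>] by blast
    next
      fix \<alpha> assume "\<alpha> \<in> B_boundary X"
      then have \<alpha>: "\<alpha> \<in> hs.UF" "\<And>M. finite M \<Longrightarrow> M \<subseteq> \<alpha> \<Longrightarrow> \<exists>\<gamma>\<in>hs.boundary. M \<subseteq> \<gamma>"
        unfolding B_boundary_iff Roller_boundary_eq ultrafilters_eq by blast+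
      \<comment> \<open>the halfspaces adjacent to \<open>w\<close> cut out an isolated point\<close>
      have "\<alpha> \<noteq> hs.vertex_uf w" if w: "w \<in> vertices X" for w
      proof
        assume eq: "\<alpha> = hs.vertex_uf w"
        have "hs.adjacent w \<subseteq> \<alpha>" unfolding eq hs.adjacent_def hs.vertex_uf_def using hs.pc_sub by blast
        then obtain \<gamma> where \<gamma>: "\<gamma> \<in> hs.boundary" "hs.adjacent w \<subseteq> \<gamma>"
          using \<alpha>(2) finite_adjacent[OF assms(3) w] by blast
        have "\<gamma> = hs.vertex_uf w" by (rule hs.uf_containing_adjacent[OF hs.boundary_uf[OF \<gamma>(1)] w \<gamma>(2)])
        then show False using hs.vertex_uf_not_boundary[OF w] \<gamma>(1) by simp
      qed
      then show "\<alpha> \<in> Roller_boundary X" unfolding Roller_boundary_eq by (rule E.nonprincipal_boundary[OF \<alpha>(1)])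
    qed
  qed
  moreover have "hs.nonterminating_dense \<longleftrightarrow> hs.cages_filled"
    using E.cages_filled_if_nonterminating_dense E.nonterminating_dense_if_neighbourhoods_filled
      hs.neighbourhoods_filled_if_cages_filled by blast
  moreover have "hs.cages_filled \<longleftrightarrow> hs.neighbourhoods_filled"
    using E.cages_filled_if_neighbourhoods_filled hs.neighbourhoods_filled_if_cages_filled by blast
  ultimately show ?thesis unfolding caged_hyperplanes_iff open_sets_contain_hyperplane_iff by simp
qed

end
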